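(* Let $P\subset\mathbb{R}^m$ be an $m$-dimensional lattice polytope and $Q\subset\mathbb{R}^n$ an $n$-dimensional lattice polytope, and let $P^\lambda$ and $Q^\mu$ be rdf-triangulations of $P$ and $Q$, respectively. Let $O_P$ and $O_Q$ be color consecutive orderings of the vertices of $P^\lambda$ and of $Q^\mu$, respectively. Then the simplicial product $P^\lambda\times_{\mathrm{stc}}Q^\mu$ with respect to $O_P$ and $O_Q$ is an rdf-triangulation of the polytope $P\times Q$, and its signature is \[\sigma(P^\lambda\times_{\mathrm{stc}} Q^\mu)=\sigma_{m,n}\,\sigma(P^\lambda)\,\sigma(Q^\mu).\]
   Context: A lattice polytope in $\mathbb{R}^m$ is a polytope whose vertices lie in $\mathbb{Z}^m$. Facets of a triangulation of an $m$-polytope are its $m$-dimensional simplices. A triangulation $K$ of an $m$-dimensional lattice polytope $P\subset\mathbb{R}^m$ is: - regular if there is a convex function $\lambda:\mathbb{R}^m\to\mathbb{R}$ (a lifting function) such that $K$ is the polyhedral subdivision of $P$ induced by the lower convex hull of $\{(v,\lambda(v)) : v \text{ a vertex of } K\}\subset\mathbb{R}^{m+1}$; it is then written $P^\lambda$; - dense if its vertex set is $P\cap\mathbb{Z}^m$; - foldable if it admits a non-degenerate simplicial map to an $m$-simplex, equivalently its $1$-skeleton has a proper vertex coloring with $m+1$ colors (unique up to renaming the colors); - an rdf-triangulation if it is regular, dense and foldable. The dual graph of $K$ has the facets of $K$ as nodes, two being adjacent if they share a common $(m-1)$-face; for a foldable triangulation of a polytope it is connected and bipartite. Call the two color classes of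 facets black and white. The normalized volume of a lattice $m$-simplex is $m!$ times its volume (an integer), and the simplex is odd or even according to the parity of this integer. The signature $\sigma(P^\lambda)$ of an rdf-triangulation is the absolute value of the difference between the number of odd black facets and the number of odd white facets. Color consecutive ordering: a linear ordering $v_0<v_1<\dots<v_{k-1}$ of the vertices of a foldable $m$-dimensional complex is color consecutive if there is a proper coloring $c$ of its $1$-skeleton with colors $\{0,1,\dots,m\}$ such that $c(v_0)\le c(v_1)\le\dots\le c(v_{k-1})$. Simplicial product: for simplicial complexes $K,L$ with linearly ordered vertex sets $V_K,V_L$, order $V_K\times V_L$ partially by $(v,w)\ge(v',w')$ iff $v\ge v'$ and $w\ge w'$. Then $K\times_{\mathrm{stc}}L$ is the set of all $F\subseteq V_K\times V_L$ such that the projection of $F$ to $V_K$ is a face of $K$, the projection of $F$ to $V_L$ is a face of $L$, and the partial order restricted to $F$ is total. For triangulations of polytopes $P,Q$ it is realized geometrically by the simplices $\mathrm{conv}(F)\subset\mathbb{R}^{m+n}$. $\Delta_m=\mathrm{conv}(0,e_1,\dots,e_m)$ is the standard $m$-simplex, and $\sigma_{m,n}$ is the signature of the staircase triangulation of $\Delta_m\times\Delta_n$, i.e. of the simplicial product $\Delta_m\times_{\mathrm{stc}}\Delta_n$ (each factor regarded as the trivial triangulation of itself, with vertices ordered $0,e_1,e_2,\dots$). *)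

theory Defs
  imports "HOL-Analysis.Analysis"
begin

text \<open>
  Everything is stated in a Euclidean space with its standard basis. The dimension of the ambient
  space is \<open>DIM('a)\<close>, and the space $\mathbb{R}^{m+n}$ containing a product of polytopes is the
  product type, whose standard basis consists of the vectors \<open>(b, 0)\<close> and \<open>(0, b)\<close>.
\<close>

definition integer_points :: "'a::euclidean_space set" where
  "integer_points = {x. \<forall>b\<in>Basis. x \<bullet> b \<in> \<int>}"

definition lattice_polytope :: "'a::euclidean_space set \<Rightarrow> bool" where
  "lattice_polytope P \<longleftrightarrow> polytope P \<and> (\<forall>v. v extreme_point_of P \<longrightarrow> v \<in> integer_points)"


subsection \<open>Triangulations\<close>

text \<open>
  A triangulation is given by the vertex sets of its simplices (including the empty one);
  the geometric simplices are their convex hulls. So \<open>\<Union>K\<close> is the vertex set of \<open>K\<close>.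
\<close>

definition triangulates :: "'a::euclidean_space set set \<Rightarrow> 'a set \<Rightarrow> bool" where
  "triangulates K P \<longleftrightarrow>
     (\<forall>F\<in>K. \<not> affine_dependent F) \<and>
     simplicial_complex ((hull) convex ` K) \<and>
     \<Union> ((hull) convex ` K) = P"

text \<open>
  A lower face is one exposed by a non-vertical hyperplane lying below the set. The empty face is
  included, in accordance with the conventions for \<open>K\<close> and for \<open>simplicial_complex\<close>.
\<close>

definition lower_face_of :: "('a::euclidean_space \<times> real) set \<Rightarrow> ('a \<times> real) set \<Rightarrow> bool"
    (infix \<open>lower'_face'_of\<close> 50) where
  "F lower_face_of L \<longleftrightarrow>
     (\<exists>a b. L \<subseteq> {z. (a, 1) \<bullet> z \<ge> b} \<and> F = L \<inter> {z. (a, 1) \<bullet> z = b})"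

definition induced_subdivision :: "'a::euclidean_space set \<Rightarrow> ('a \<Rightarrow> real) \<Rightarrow> 'a set set" where
  "induced_subdivision V lift =
     {fst ` F | F. F lower_face_of (convex hull ((\<lambda>v. (v, lift v)) ` V))}"

definition regular :: "'a::euclidean_space set set \<Rightarrow> bool" where
  "regular K \<longleftrightarrow>
     (\<exists>lift :: 'a \<Rightarrow> real. convex_on UNIV lift \<and>
        (hull) convex ` K = induced_subdivision (\<Union>K) lift)"

definition dense_in :: "'a::euclidean_space set set \<Rightarrow> 'a set \<Rightarrow> bool" where
  "dense_in K P \<longleftrightarrow> \<Union>K = P \<inter> integer_points"

definition nondegenerate_simplicial_map :: "'a set set \<Rightarrow> 'b set set \<Rightarrow> ('a \<Rightarrow> 'b) \<Rightarrow> bool" where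
  "nondegenerate_simplicial_map K L f \<longleftrightarrow> (\<forall>F\<in>K. f ` F \<in> L \<and> inj_on f F)"

definition foldable :: "'a::euclidean_space set set \<Rightarrow> bool" where
  "foldable K \<longleftrightarrow> (\<exists>f :: 'a \<Rightarrow> nat. nondegenerate_simplicial_map K (Pow {0..DIM('a)}) f)"

definition rdf_triangulation :: "'a::euclidean_space set set \<Rightarrow> 'a set \<Rightarrow> bool" where
  "rdf_triangulation K P \<longleftrightarrow> triangulates K P \<and> regular K \<and> dense_in K P \<and> foldable K"


subsection \<open>The signature\<close>

definition facets :: "'a::euclidean_space set set \<Rightarrow> 'a set set" where
  "facets K = {F \<in> K. card F = DIM('a) + 1}"

definition dual_adjacent :: "'a::euclidean_space set set \<Rightarrow> 'a set \<Rightarrow> 'a set \<Rightarrow> bool" where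
  "dual_adjacent K F G \<longleftrightarrow>
     F \<in> facets K \<and> G \<in> facets K \<and> F \<noteq> G \<and>
     (\<exists>R\<in>K. card R = DIM('a) \<and> R \<subseteq> F \<and> R \<subseteq> G)"

definition black_class :: "'a::euclidean_space set set \<Rightarrow> 'a set set \<Rightarrow> bool" where
  "black_class K B \<longleftrightarrow>
     B \<subseteq> facets K \<and> (\<forall>F G. dual_adjacent K F G \<longrightarrow> (F \<in> B \<longleftrightarrow> G \<notin> B))"

definition normalized_volume :: "'a::euclidean_space set \<Rightarrow> real" where
  "normalized_volume F = fact DIM('a) * measure lborel (convex hull F)"

definition odd_simplex :: "'a::euclidean_space set \<Rightarrow> bool" where
  "odd_simplex F \<longleftrightarrow> (\<exists>k::nat. odd k \<and> normalized_volume F = real k)"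

text \<open>
  For a foldable triangulation of a full-dimensional polytope the dual graph is bipartite and
  connected, so the black class is unique up to swapping the colors, and the description below
  determines exactly one number.
\<close>

definition signature :: "'a::euclidean_space set set \<Rightarrow> int" where
  "signature K =
     (THE s. \<exists>B. black_class K B \<and>
        s = \<bar>int (card {F \<in> B. odd_simplex F}) - int (card {F \<in> facets K - B. odd_simplex F})\<bar>)"


subsection \<open>Color consecutive orderings and simplicial products\<close>

text \<open>Linear orderings are reflexive relations, as in \<open>linear_order_on\<close>.\<close>

definition proper_coloring :: "'a::euclidean_space set set \<Rightarrow> ('a \<Rightarrow> nat) \<Rightarrow> bool" where
  "proper_coloring K c \<longleftrightarrow>
     (\<forall>v\<in>\<Union>K. c v \<in> {0..DIM('a)}) \<and>
     (\<forall>u v. {u, v} \<in> K \<and> u \<noteq> v \<longrightarrow> c u \<noteq> c v)"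

definition color_consecutive :: "'a::euclidean_space set set \<Rightarrow> 'a rel \<Rightarrow> bool" where
  "color_consecutive K r \<longleftrightarrow>
     linear_order_on (\<Union>K) r \<and>
     (\<exists>c. proper_coloring K c \<and> (\<forall>(v, w)\<in>r. c v \<le> c w))"

definition product_order :: "'a rel \<Rightarrow> 'b rel \<Rightarrow> ('a \<times> 'b) rel" where
  "product_order r s = {((v, w), (v', w')). (v, v') \<in> r \<and> (w, w') \<in> s}"

definition stc_product ::
    "'a set set \<Rightarrow> 'a rel \<Rightarrow> 'b set set \<Rightarrow> 'b rel \<Rightarrow> ('a \<times> 'b) set set" where
  "stc_product K r L s =
     {F. F \<subseteq> \<Union>K \<times> \<Union>L \<and> fst ` F \<in> K \<and> snd ` F \<in> L \<and> total_on F (product_order r s)}"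


subsection \<open>The staircase triangulation\<close>

definition std_vertices :: "(real ^ 'm::finite) set" where
  "std_vertices = insert 0 (range (\<lambda>i. axis i 1))"

text \<open>The ordering $0 < e_1 < e_2 < \cdots$, where the index type plays the role of $\{1,\dots,m\}$.\<close>

definition std_order :: "(real ^ 'm::{finite, linorder}) rel" where
  "std_order =
     {(0, v) | v. v \<in> std_vertices} \<union> {(axis i 1, axis j 1) | i j. i \<le> j}"

text \<open>The trivial triangulation of a simplex consists of all its faces.\<close>

definition staircase_triangulation ::
    "((real ^ 'm::{finite, linorder}) \<times> (real ^ 'n::{finite, linorder})) set set" where
  "staircase_triangulation = stc_product (Pow std_vertices) std_order (Pow std_vertices) std_order"

definition staircase_signature ::
    "'m::{finite, linorder} itself \<Rightarrow> 'n::{finite, linorder} itself \<Rightarrow> int" where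
  "staircase_signature _ _ =
     signature (staircase_triangulation ::
       ((real ^ 'm::{finite, linorder}) \<times> (real ^ 'n::{finite, linorder})) set set)"

end

theory Submission
  imports Defs
begin

text \<open>
  The triangulations are handled through exact supports: a triangulation is regular with heights
  \<open>h\<close> if for every face some affine function agrees with \<open>- h\<close> on it, up to a constant, and is
  larger at all other vertices. For a product take the heights $M(\lambda(v) + \mu(w)) - \rho(v)\sigma(w)$
  with $M$ large and $\rho$, $\sigma$ the ranks in the vertex orderings: the first part induces the
  product cells, and the strictly submodular second part refines them to the chains. Supports of a
  chain are the Kantorovich potentials of a monotone curve through it. The northwest corner rule
  shows that the chains cover the product.

  For the signature, a facet of the product over facets $F$, $G$ is, after replacing vertices by
  colors, a monotone lattice path $p$ in $\{0..m\} \times \{0..n\}$. With orientations $s_K$, $s_L$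
  of the factors (signs of determinants of the colored simplices), the sign
  $s_K(F) s_L(G) (-1)^{\sum_{(i,j) \in p} i}$ alternates along the dual graph, and the normalized
  volume is multiplicative. So the signed sum over the odd facets factors, and the factor summing
  over paths is the same as for the product of two standard simplices.
\<close>


subsection \<open>Regular triangulations and exact supports\<close>

text \<open>Color consecutiveness makes the given order, restricted to any single face, the order by
  colors, so that the simplices of the product become monotone sets of color pairs; the regular
  triangulation itself arises from arbitrary linear orders. The sign comes from the ways of crossing
  a ridge of the product. Either a corner of the path flips, which moves one first color, and with
  it the exponent, by one; or a vertex of one factor is exchanged for the vertex of the same color
  across a ridge of that factor, where the orientation of the factor changes and the path stays. Two
  definitions shape the proof. \<open>regular\<close> asks for a function that is convex on the
  whole space, whereas supports give heights at the vertices only; a maximum of affine functions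
  bridges the gap. \<open>signature\<close> is a definite description, so the bipartition must be
  shown unique, which is connectedness of the dual graph.\<close>

lemma affine_interpolation:
  fixes F :: "'a::euclidean_space set" and f :: "'a \<Rightarrow> real"
  assumes "\<not> affine_dependent F"
  obtains a b where "\<And>v. v \<in> F \<Longrightarrow> a \<bullet> v + b = f v"
proof (cases "F = {}")
  case False
  then obtain v0 where v0: "v0 \<in> F" by auto
  have "independent ((\<lambda>x. x - v0) ` (F - {v0}))"
    using assms v0 affine_dependent_iff_dependent2[of v0 F] by (simp add: add.commute)
  then obtain g where g: "linear g"
    "\<forall>x\<in>(\<lambda>x. x - v0) ` (F - {v0}). g x = f (x + v0) - f v0"
    using linear_independent_extend[of _ "\<lambda>x. f (x + v0) - f v0"] by blast
  define a where "a = (\<Sum>b\<in>Basis. g b *\<^sub>R b)"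
  have a: "a \<bullet> x = g x" for x
  proof -
    have "g x = g (\<Sum>b\<in>Basis. (x \<bullet> b) *\<^sub>R b)" by (simp add: euclidean_representation)
    also have "\<dots> = (\<Sum>b\<in>Basis. (x \<bullet> b) * g b)"
      using g(1) by (simp add: linear_sum linear_cmul)
    also have "\<dots> = a \<bullet> x"
      by (simp add: a_def inner_sum_left inner_commute[of x] mult.commute)
    finally show ?thesis by simp
  qed
  have "a \<bullet> v + (f v0 - a \<bullet> v0) = f v" if "v \<in> F" for v
  proof (cases "v = v0")
    case False
    with that have "g (v - v0) = f v - f v0" using g(2) by auto
    then show ?thesis by (simp add: a[symmetric] inner_diff_right)
  qed auto
  then show ?thesis using that by blast
qed (use that in auto)

text \<open>An affinely independent set is recovered from its hull as the set of extreme points.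
  This carries facts about hulls, in which \<open>simplicial_complex\<close> is phrased, back to the
  vertex sets that make up \<open>K\<close>.\<close>

lemma convex_hull_affine_independent_inj:
  fixes F G :: "'a::euclidean_space set"
  assumes "\<not> affine_dependent F" "\<not> affine_dependent G" "convex hull F = convex hull G"
  shows "F = G"
  using assms extreme_point_of_convex_hull_affine_independent by (metis subsetI subset_antisym)

section \<open>Triangulations in terms of vertex sets\<close>

lemma triangulates_finite:
  assumes "triangulates K P" shows "finite K"
proof -
  have "inj_on ((hull) convex) K"
    using assms convex_hull_affine_independent_inj unfolding triangulates_def inj_on_def by blast
  moreover have "finite ((hull) convex ` K)"
    using assms by (simp add: triangulates_def simplicial_complex_def)
  ultimately show ?thesis using finite_imageD by blast
qed

lemma triangulates_affine_independent:
  "triangulates K P \<Longrightarrow> F \<in> K \<Longrightarrow> \<not> affine_dependent F"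
  by (simp add: triangulates_def)

lemma triangulates_finite_face:
  "triangulates K P \<Longrightarrow> F \<in> K \<Longrightarrow> finite F"
  using aff_independent_finite triangulates_affine_independent by blast

lemma triangulates_finite_vertices:
  assumes "triangulates K P" shows "finite (\<Union>K)"
  using triangulates_finite[OF assms] triangulates_finite_face[OF assms] by (rule finite_Union)

lemma triangulates_subset:
  assumes "triangulates K P" "F \<in> K" "S \<subseteq> F"
  shows "S \<in> K"
proof -
  have F: "\<not> affine_dependent F" using assms triangulates_def by blast
  have "convex hull S face_of convex hull F"
    using F assms(3) face_of_convex_hull_affine_independent by blast
  then have "convex hull S \<in> (hull) convex ` K"
    using assms unfolding triangulates_def simplicial_complex_def by blast
  then obtain G where "G \<in> K" "convex hull S = convex hull G" by auto
  moreover have "\<not> affine_dependent S" using F assms(3) affine_dependent_subset by blast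
  ultimately show ?thesis
    using assms(1) convex_hull_affine_independent_inj unfolding triangulates_def by metis
qed

text \<open>The intersection is a face of both simplices, hence the hull of a subset of
  \<open>F\<close> and also of a subset of \<open>G\<close>; two affinely independent sets with the
  same hull coincide, so this subset lies in both.\<close>

lemma triangulates_Int:
  assumes "triangulates K P" "F \<in> K" "G \<in> K"
  shows "convex hull F \<inter> convex hull G = convex hull (F \<inter> G)"
proof
  have F: "\<not> affine_dependent F" and G: "\<not> affine_dependent G"
    using assms triangulates_def by blast+
  have "(convex hull F \<inter> convex hull G) face_of convex hull F"
       "(convex hull G \<inter> convex hull F) face_of convex hull G"
    using assms unfolding triangulates_def simplicial_complex_def by blast+
  then obtain S T where "S \<subseteq> F" "convex hull F \<inter> convex hull G = convex hull S"
     "T \<subseteq> G" "convex hull G \<inter> convex hull F = convex hull T"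
    using F G face_of_convex_hull_affine_independent by meson
  moreover from this have "S = T"
    by (metis F G Int_commute affine_dependent_subset convex_hull_affine_independent_inj)
  ultimately show "convex hull F \<inter> convex hull G \<subseteq> convex hull (F \<inter> G)"
    by (metis hull_mono Int_greatest)
  show "convex hull (F \<inter> G) \<subseteq> convex hull F \<inter> convex hull G"
    by (simp add: hull_mono)
qed

text \<open>The singleton of \<open>v\<close> is itself a face, so if \<open>v\<close> were not in
  \<open>F\<close> the two hulls would meet in the hull of the empty set. Thus no vertex sits on a
  simplex without being one of its corners, which later makes supports strict off their
  face.\<close>

lemma triangulates_vertex_in_hull:
  assumes "triangulates K P" "F \<in> K" "v \<in> \<Union>K" "v \<in> convex hull F"
  shows "v \<in> F"
proof -
  obtain G where "G \<in> K" "v \<in> G" using assms by auto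
  then have "{v} \<in> K" using triangulates_subset assms(1) by blast
  then have "convex hull F \<inter> convex hull {v} = convex hull (F \<inter> {v})"
    using triangulates_Int assms by blast
  then show ?thesis using assms(4) by (cases "v \<in> F") auto
qed

lemma triangulates_hull_subset:
  assumes "triangulates K P" "F \<in> K" shows "convex hull F \<subseteq> P"
  using assms unfolding triangulates_def by blast

lemma triangulates_vertices_subset:
  assumes "triangulates K P" shows "\<Union>K \<subseteq> P"
  using triangulates_hull_subset[OF assms] hull_subset by fastforce

text \<open>The lifted points of \<open>F\<close> lie on a non-vertical hyperplane and all others
  strictly above it. Strictness pins down \<open>F\<close> itself and not only its hull, and the
  heights are bare numbers at the vertices, free of any convexity condition.\<close>

definition exactly_supported :: "'a::euclidean_space set \<Rightarrow> ('a \<Rightarrow> real) \<Rightarrow> 'a set \<Rightarrow> bool" where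
  "exactly_supported V h F \<longleftrightarrow>
     (\<exists>a b. (\<forall>v\<in>F. a \<bullet> v + h v = b) \<and> (\<forall>v\<in>V - F. a \<bullet> v + h v > b))"

text \<open>The contact set is a face of the hull of finitely many points, hence the hull of some of
  them, and these must lie on the hyperplane.\<close>

lemma lower_face_of_graph_hull:
  fixes V :: "'a::euclidean_space set" and h :: "'a \<Rightarrow> real"
  defines "g \<equiv> \<lambda>v. (v, h v)"
  assumes "finite V" and sub: "convex hull (g ` V) \<subseteq> {z. (a, 1) \<bullet> z \<ge> b}"
  shows "convex hull (g ` V) \<inter> {z. (a, 1) \<bullet> z = b} = convex hull (g ` {v \<in> V. a \<bullet> v + h v = b})"
    (is "?T = _")
proof
  have face: "?T face_of convex hull (g ` V)"
    using sub by (intro face_of_Int_supporting_hyperplane_ge) auto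
  then obtain S where S: "S \<subseteq> g ` V" "?T = convex hull S"
    using face_of_convex_hull_subset[OF finite_imp_compact] \<open>finite V\<close> by (metis finite_imageI)
  have "S \<subseteq> g ` {v \<in> V. a \<bullet> v + h v = b}"
  proof
    fix z assume "z \<in> S"
    then have "z \<in> ?T" unfolding S(2) by (rule hull_inc)
    then show "z \<in> g ` {v \<in> V. a \<bullet> v + h v = b}"
      using S(1) \<open>z \<in> S\<close> by (auto simp: g_def)
  qed
  then show "?T \<subseteq> convex hull (g ` {v \<in> V. a \<bullet> v + h v = b})"
    using S(2) hull_mono by metis
  have "g ` {v \<in> V. a \<bullet> v + h v = b} \<subseteq> ?T"
    by (auto simp: g_def intro: hull_inc)
  moreover have "convex ?T" using face face_of_imp_convex by blast
  ultimately show "convex hull (g ` {v \<in> V. a \<bullet> v + h v = b}) \<subseteq> ?T"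
    by (rule hull_minimal)
qed

lemma fst_graph_hull:
  fixes W :: "'a::euclidean_space set"
  shows "fst ` (convex hull ((\<lambda>v. (v, h v)) ` W)) = convex hull W"
  by (subst convex_hull_linear_image[OF linear_fst]) (simp add: image_image)

lemma graph_hull_above:
  fixes V :: "'a::euclidean_space set" and h :: "'a \<Rightarrow> real"
  assumes "\<And>v. v \<in> V \<Longrightarrow> a \<bullet> v + h v \<ge> b"
  shows "convex hull ((\<lambda>v. (v, h v)) ` V) \<subseteq> {z. (a, 1) \<bullet> z \<ge> b}"
  using assms by (intro hull_minimal) (auto simp: convex_halfspace_ge)

lemma mem_induced_subdivision:
  fixes V :: "'a::euclidean_space set" and h :: "'a \<Rightarrow> real"
  assumes "finite V"
  shows "S \<in> induced_subdivision V h \<longleftrightarrow>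
    (\<exists>a b. (\<forall>v\<in>V. a \<bullet> v + h v \<ge> b) \<and> S = convex hull {v \<in> V. a \<bullet> v + h v = b})"
    (is "_ \<longleftrightarrow> ?R")
proof
  let ?L = "convex hull ((\<lambda>v. (v, h v)) ` V)"
  assume "S \<in> induced_subdivision V h"
  then obtain a b where ab: "?L \<subseteq> {z. (a, 1) \<bullet> z \<ge> b}" "S = fst ` (?L \<inter> {z. (a, 1) \<bullet> z = b})"
    unfolding induced_subdivision_def lower_face_of_def by blast
  have "S = convex hull {v \<in> V. a \<bullet> v + h v = b}"
    unfolding ab(2) lower_face_of_graph_hull[OF assms ab(1)] fst_graph_hull ..
  moreover have "a \<bullet> v + h v \<ge> b" if "v \<in> V" for v
  proof -
    have "(v, h v) \<in> ?L" using that by (auto intro: hull_inc)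
    then show ?thesis using ab(1) by auto
  qed
  ultimately show ?R by blast
next
  let ?L = "convex hull ((\<lambda>v. (v, h v)) ` V)"
  assume ?R
  then obtain a b where ab: "\<forall>v\<in>V. a \<bullet> v + h v \<ge> b" "S = convex hull {v \<in> V. a \<bullet> v + h v = b}"
    by blast
  have L: "?L \<subseteq> {z. (a, 1) \<bullet> z \<ge> b}" using ab by (intro graph_hull_above) auto
  have "S = fst ` (?L \<inter> {z. (a, 1) \<bullet> z = b})"
    unfolding lower_face_of_graph_hull[OF assms L] fst_graph_hull using ab by simp
  then show "S \<in> induced_subdivision V h"
    using L unfolding induced_subdivision_def lower_face_of_def by blast
qed

text \<open>Let W be the set of vertices touching the hyperplane that cuts out the simplex of
  \<open>F\<close>. The vertices of \<open>F\<close> are extreme points of the hull of W, so they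
  belong to W; conversely a point of W is a vertex lying in the simplex of \<open>F\<close>, so it
  belongs to \<open>F\<close>.\<close>

lemma regular_exactly_supported:
  assumes K: "triangulates K P" and "regular K"
  obtains h where "\<And>F. F \<in> K \<Longrightarrow> exactly_supported (\<Union>K) h F"
proof -
  obtain h where h: "(hull) convex ` K = induced_subdivision (\<Union>K) h"
    using assms(2) unfolding regular_def by (elim exE conjE)
  note fin = triangulates_finite_vertices[OF K]
  have "exactly_supported (\<Union>K) h F" if "F \<in> K" for F
  proof -
    have "convex hull F \<in> induced_subdivision (\<Union>K) h" unfolding h[symmetric] using that by (rule imageI)
    then obtain a b where ab: "\<forall>v\<in>\<Union>K. a \<bullet> v + h v \<ge> b"
      "convex hull F = convex hull {v \<in> \<Union>K. a \<bullet> v + h v = b}"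
      unfolding mem_induced_subdivision[OF fin] by blast
    have "F \<subseteq> {v \<in> \<Union>K. a \<bullet> v + h v = b}"
    proof
      fix v assume "v \<in> F"
      then have "v extreme_point_of (convex hull F)"
        by (simp add: extreme_point_of_convex_hull_affine_independent[OF
          triangulates_affine_independent[OF K that]])
      then show "v \<in> {v \<in> \<Union>K. a \<bullet> v + h v = b}"
        unfolding ab(2) by (rule extreme_point_of_convex_hull)
    qed
    moreover have "{v \<in> \<Union>K. a \<bullet> v + h v = b} \<subseteq> F"
    proof
      fix v assume v: "v \<in> {v \<in> \<Union>K. a \<bullet> v + h v = b}"
      then have "v \<in> convex hull F" unfolding ab(2) by (rule hull_inc)
      then show "v \<in> F" using triangulates_vertex_in_hull[OF K that] v by simp
    qed
    ultimately have F: "F = {v \<in> \<Union>K. a \<bullet> v + h v = b}" by (rule subset_antisym)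
    have "\<forall>v\<in>F. a \<bullet> v + h v = b" by (subst F) simp
    moreover have "\<forall>v\<in>\<Union>K - F. a \<bullet> v + h v > b"
      using ab(1) by (subst F) (auto simp: order_less_le)
    ultimately show ?thesis unfolding exactly_supported_def by blast
  qed
  then show ?thesis using that by blast
qed

text \<open>For a point x written as a convex combination, the averaged height is compared with
  \<open>b - a \<bullet> x\<close>, the value at x of the supporting affine function. The two lemmas
  that follow are the cases of equality and of strict inequality.\<close>

lemma sum_height_ge:
  assumes "\<forall>v\<in>W. a \<bullet> v + h v \<ge> b" "\<forall>v\<in>W. u v \<ge> 0" "sum u W = (1::real)"
  shows "(\<Sum>v\<in>W. u v * h v) \<ge> b - a \<bullet> (\<Sum>v\<in>W. u v *\<^sub>R v)"
proof -
  have "(\<Sum>v\<in>W. u v * b) \<le> (\<Sum>v\<in>W. u v * (a \<bullet> v + h v))"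
    using assms by (intro sum_mono mult_left_mono) auto
  moreover have "(\<Sum>v\<in>W. u v * b) = b"
    using assms(3) by (simp add: sum_distrib_right[symmetric])
  ultimately show ?thesis
    by (simp add: inner_sum_right distrib_left sum.distrib)
qed

lemma sum_height_eq:
  assumes "\<forall>v\<in>W. a \<bullet> v + h v = b" "sum u W = (1::real)"
  shows "(\<Sum>v\<in>W. u v * h v) = b - a \<bullet> (\<Sum>v\<in>W. u v *\<^sub>R v)"
proof -
  have "(\<Sum>v\<in>W. u v * b) = (\<Sum>v\<in>W. u v * (a \<bullet> v + h v))"
    using assms by (intro sum.cong) auto
  moreover have "(\<Sum>v\<in>W. u v * b) = b"
    using assms(2) by (simp add: sum_distrib_right[symmetric])
  ultimately show ?thesis
    by (simp add: inner_sum_right distrib_left sum.distrib)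
qed

lemma sum_height_gt:
  assumes "finite W" "\<forall>v\<in>W. a \<bullet> v + h v \<ge> b" "\<forall>v\<in>W. u v \<ge> 0" "sum u W = (1::real)"
    and "w \<in> W" "u w \<noteq> 0" "a \<bullet> w + h w > b"
  shows "(\<Sum>v\<in>W. u v * h v) > b - a \<bullet> (\<Sum>v\<in>W. u v *\<^sub>R v)"
proof -
  have "u w > 0" using assms by (simp add: order_less_le)
  then have "(\<Sum>v\<in>W. u v * b) < (\<Sum>v\<in>W. u v * (a \<bullet> v + h v))"
    using assms by (intro sum_strict_mono_ex1) (auto intro!: mult_left_mono bexI[of _ w])
  moreover have "(\<Sum>v\<in>W. u v * b) = b"
    using assms(4) by (simp add: sum_distrib_right[symmetric])
  ultimately show ?thesis
    by (simp add: inner_sum_right distrib_left sum.distrib)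
qed

text \<open>Over the simplex of an exactly supported face no representation of a point has smaller height,
  so a lower face through the point is spanned by vertices of that simplex.\<close>

lemma exactly_supported_carrier:
  assumes F: "\<forall>v\<in>F. a \<bullet> v + h v = b" "\<forall>v\<in>V - F. a \<bullet> v + h v > (b::real)" "F \<subseteq> V" "finite F"
    and W: "W \<subseteq> V" "finite W" "\<forall>v\<in>W. u v \<ge> 0" "sum u W = 1"
    and x: "(\<Sum>v\<in>W. u v *\<^sub>R v) \<in> convex hull F"
    and c: "\<forall>v\<in>V. c \<bullet> v + h v \<ge> d" "\<forall>v\<in>W. c \<bullet> v + h v = d"
    and w: "w \<in> W" "u w \<noteq> 0"
  shows "w \<in> F"
proof (rule ccontr)
  assume "w \<notin> F"
  define x where "x = (\<Sum>v\<in>W. u v *\<^sub>R v)"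
  have "a \<bullet> v + h v \<ge> b" if "v \<in> V" for v using F that by (cases "v \<in> F") (auto simp: less_imp_le)
  then have 1: "(\<Sum>v\<in>W. u v * h v) > b - a \<bullet> x"
    unfolding x_def using W w \<open>w \<notin> F\<close> F by (intro sum_height_gt[where w = w]) auto
  obtain t where t: "\<forall>v\<in>F. t v \<ge> 0" "sum t F = 1" "(\<Sum>v\<in>F. t v *\<^sub>R v) = x"
    using assms(9) \<open>finite F\<close> unfolding convex_hull_finite[OF \<open>finite F\<close>] x_def by auto
  \<comment> \<open>The same point is represented over \<open>F\<close> and over \<open>W\<close>.
    By the support with normal \<open>c\<close> the representation over \<open>W\<close> is no
    higher; by the support of \<open>F\<close> and the stray vertex \<open>w\<close> it is strictly
    higher.\<close>
  have "(\<Sum>v\<in>F. t v * h v) = b - a \<bullet> x" using sum_height_eq[OF F(1) t(2)] t(3) by simp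
  moreover have "(\<Sum>v\<in>F. t v * h v) \<ge> d - c \<bullet> x"
    using sum_height_ge[of F d c h t] c F(3) t by auto
  moreover have "(\<Sum>v\<in>W. u v * h v) = d - c \<bullet> x"
    unfolding x_def using sum_height_eq[OF c(2) W(4)] .
  ultimately show False using 1 by linarith
qed

text \<open>Write a common point as a convex combination of \<open>G\<close>. The support of
  \<open>G\<close> is a lower face, so every vertex that carries weight also lies in
  \<open>F\<close>.\<close>

lemma exactly_supported_Int:
  assumes F: "exactly_supported V h F" "F \<subseteq> V" and G: "exactly_supported V h G" "G \<subseteq> V"
    and fin: "finite V"
  shows "convex hull F \<inter> convex hull G = convex hull (F \<inter> G)"
proof
  have fins: "finite F" "finite G" using assms finite_subset by blast+
  obtain a b where ab: "\<forall>v\<in>F. a \<bullet> v + h v = b" "\<forall>v\<in>V - F. a \<bullet> v + h v > b"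
    using F exactly_supported_def by metis
  obtain c d where cd: "\<forall>v\<in>G. c \<bullet> v + h v = d" "\<forall>v\<in>V - G. c \<bullet> v + h v > d"
    using G exactly_supported_def by metis
  show "convex hull F \<inter> convex hull G \<subseteq> convex hull (F \<inter> G)"
  proof
    fix x assume x: "x \<in> convex hull F \<inter> convex hull G"
    then obtain u where u: "\<forall>v\<in>G. u v \<ge> 0" "sum u G = 1" "(\<Sum>v\<in>G. u v *\<^sub>R v) = x"
      using fins convex_hull_finite[OF \<open>finite G\<close>] by auto
    have "d \<le> c \<bullet> v + h v" if "v \<in> V" for v
      using cd that by (cases "v \<in> G") (auto simp: less_imp_le)
    then have "w \<in> F" if "w \<in> G" "u w \<noteq> 0" for w
      using exactly_supported_carrier[OF ab F(2) fins(1) G(2) fins(2) u(1,2) _ _ cd(1) that] u(3) x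
      by auto
    then have z: "\<forall>v\<in>G - F \<inter> G. u v = 0" by blast
    have "sum u (F \<inter> G) = sum u G" "(\<Sum>v\<in>F \<inter> G. u v *\<^sub>R v) = (\<Sum>v\<in>G. u v *\<^sub>R v)"
      using z fins by (auto intro!: sum.mono_neutral_left)
    then have "sum u (F \<inter> G) = 1" "(\<Sum>v\<in>F \<inter> G. u v *\<^sub>R v) = x"
      using u by auto
    moreover have "\<forall>v\<in>F \<inter> G. u v \<ge> 0" "finite (F \<inter> G)" using u fins by auto
    ultimately show "x \<in> convex hull (F \<inter> G)"
      unfolding convex_hull_finite[OF \<open>finite (F \<inter> G)\<close>] by blast
  qed
qed (simp add: hull_mono)

lemma convex_on_Max:
  fixes f :: "'i \<Rightarrow> 'a::real_vector \<Rightarrow> real"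
  assumes "finite I" "I \<noteq> {}" "\<And>i. i \<in> I \<Longrightarrow> convex_on UNIV (f i)"
  shows "convex_on UNIV (\<lambda>x. Max ((\<lambda>i. f i x) ` I))"
proof (rule convex_onI)
  fix t :: real and x y :: 'a assume t: "0 < t" "t < 1"
  let ?m = "\<lambda>x. Max ((\<lambda>i. f i x) ` I)"
  have "f i ((1 - t) *\<^sub>R x + t *\<^sub>R y) \<le> (1 - t) * ?m x + t * ?m y" if "i \<in> I" for i
  proof -
    have "f i ((1 - t) *\<^sub>R x + t *\<^sub>R y) \<le> (1 - t) * f i x + t * f i y"
      using assms(3)[OF that] t convex_onD[of UNIV "f i" t x y] by auto
    also have "\<dots> \<le> (1 - t) * ?m x + t * ?m y"
      using t that assms by (intro add_mono mult_left_mono) auto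
    finally show ?thesis .
  qed
  then show "?m ((1 - t) *\<^sub>R x + t *\<^sub>R y) \<le> (1 - t) * ?m x + t * ?m y"
    using assms by (subst Max_le_iff) auto
qed auto

text \<open>The converse of the extraction of supports: supports together with covering give
  everything else. Supports force simplices to meet in common faces, and covering leaves no room for
  further lower faces.\<close>

lemma exactly_supported_regular_triangulation:
  fixes K :: "'a::euclidean_space set set"
  assumes fin: "finite (\<Union>K)" and ne: "K \<noteq> {}"
    and indep: "\<And>F. F \<in> K \<Longrightarrow> \<not> affine_dependent F"
    and sub: "\<And>F S. F \<in> K \<Longrightarrow> S \<subseteq> F \<Longrightarrow> S \<in> K"
    and supp: "\<And>F. F \<in> K \<Longrightarrow> exactly_supported (\<Union>K) h F"
    and P: "\<Union>((hull) convex ` K) = P" "\<Union>K \<subseteq> P" "convex P"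
  shows "triangulates K P \<and> regular K"
proof
  have finK: "finite K" using fin finite_UnionD by blast
  have finF: "finite F" if "F \<in> K" for F using that fin by (meson Union_upper finite_subset)
  have Int: "convex hull F \<inter> convex hull G = convex hull (F \<inter> G)" if "F \<in> K" "G \<in> K" for F G
    using exactly_supported_Int[OF supp _ supp _ fin] that by blast
  have "simplicial_complex ((hull) convex ` K)"
    unfolding simplicial_complex_def
  proof (intro conjI allI ballI impI)
    show "finite ((hull) convex ` K)" using finK by simp
  next
    fix S assume "S \<in> (hull) convex ` K"
    then obtain F where F: "F \<in> K" "S = convex hull F" by blast
    then show "\<exists>n. n simplex S"
      using indep unfolding simplex_def by (intro exI[of _ "int (card F) - 1"]) auto
  next
    fix T S assume "S \<in> (hull) convex ` K \<and> T face_of S"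
    then obtain F where F: "F \<in> K" "T face_of convex hull F" by blast
    then obtain R where "R \<subseteq> F" "T = convex hull R"
      by (auto simp: face_of_convex_hull_affine_independent indep)
    then show "T \<in> (hull) convex ` K"
      using sub[OF F(1)] by blast
  next
    fix S S' assume "S \<in> (hull) convex ` K \<and> S' \<in> (hull) convex ` K"
    then obtain F G where FG: "F \<in> K" "S = convex hull F" "G \<in> K" "S' = convex hull G" by blast
    have "S \<inter> S' = convex hull (F \<inter> G)" using FG Int by simp
    then show "(S \<inter> S') face_of S"
      by (auto simp: FG face_of_convex_hull_affine_independent indep)
  qed
  then show "triangulates K P"
    unfolding triangulates_def using indep P by blast
  obtain a b where ab: "\<And>F v. F \<in> K \<Longrightarrow> v \<in> F \<Longrightarrow> a F \<bullet> v + h v = b F"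
      "\<And>F v. F \<in> K \<Longrightarrow> v \<in> \<Union>K - F \<Longrightarrow> a F \<bullet> v + h v > b F"
    using supp unfolding exactly_supported_def by metis
  have ge: "a F \<bullet> v + h v \<ge> b F" if "F \<in> K" "v \<in> \<Union>K" for F v
    using ab that by (metis Diff_iff less_imp_le order_refl)
  \<comment> \<open>\<open>b F - a F \<bullet> x\<close> is the affine function that equals
    \<open>h\<close> on \<open>F\<close> and stays below \<open>h\<close> at the other vertices. The
    maximum is therefore convex on the whole space and still takes the value \<open>h\<close> at
    every vertex.\<close>
  define lift where "lift x = Max ((\<lambda>F. b F - a F \<bullet> x) ` K)" for x
  have lift: "lift v = h v" if "v \<in> \<Union>K" for v
    unfolding lift_def
  proof (rule Max_eqI)
    obtain F where F: "F \<in> K" "v \<in> F" using \<open>v \<in> \<Union>K\<close> by auto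
    then show "h v \<in> (\<lambda>F. b F - a F \<bullet> v) ` K" using ab(1)[OF F] by force
  qed (use that finK ge in \<open>force+\<close>)
  have "convex_on UNIV lift"
    unfolding lift_def by (rule convex_on_Max) (use finK ne in \<open>auto simp: convex_on_def
       inner_add_right inner_scaleR_right algebra_simps simp flip: distrib_right\<close>)
  moreover have "(hull) convex ` K = induced_subdivision (\<Union>K) lift"
  proof (intro set_eqI iffI)
    fix S assume "S \<in> (hull) convex ` K"
    then obtain F where F: "F \<in> K" "S = convex hull F" by blast
    have "v \<in> F \<longleftrightarrow> v \<in> \<Union>K \<and> a F \<bullet> v + lift v = b F" for v
      using ab(1)[OF F(1), of v] ab(2)[OF F(1), of v] lift[of v] F(1) by force
    then have "{v \<in> \<Union>K. a F \<bullet> v + lift v = b F} = F" by auto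
    moreover have "\<forall>v\<in>\<Union>K. a F \<bullet> v + lift v \<ge> b F" using ge[OF F(1)] lift by simp
    ultimately show "S \<in> induced_subdivision (\<Union>K) lift"
      unfolding mem_induced_subdivision[OF fin] F(2) by metis
  next
    fix S assume "S \<in> induced_subdivision (\<Union>K) lift"
    then obtain c d where cd: "\<forall>v\<in>\<Union>K. c \<bullet> v + lift v \<ge> d"
      "S = convex hull {v \<in> \<Union>K. c \<bullet> v + lift v = d}"
      unfolding mem_induced_subdivision[OF fin] by blast
    define W where "W = {v \<in> \<Union>K. c \<bullet> v + lift v = d}"
    have W: "S = convex hull W" "W \<subseteq> \<Union>K" "finite W"
      using fin by (auto simp: W_def cd(2) intro: finite_subset[OF _ fin])
    have "W \<in> K"
    proof (cases "W = {}")
      case True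
      then show ?thesis using ne sub by blast
    next
      case False
      \<comment> \<open>Uniform weights: the barycenter of \<open>W\<close> lies in some simplex of
        \<open>K\<close>, and since no weight vanishes, all of \<open>W\<close> consists of vertices
        of that simplex.\<close>
      define u where "u v = 1 / real (card W)" for v :: 'a
      have u: "\<forall>v\<in>W. u v > 0" "sum u W = 1"
        using False W(3) by (auto simp: u_def card_gt_0_iff)
      define x where "x = (\<Sum>v\<in>W. u v *\<^sub>R v)"
      have "x \<in> convex hull W" unfolding x_def convex_hull_finite[OF W(3)]
        using u less_imp_le by blast
      moreover have "convex hull W \<subseteq> P" using W(2) P by (intro hull_minimal) auto
      ultimately obtain F where F: "F \<in> K" "x \<in> convex hull F" using P(1) by blast
      have "w \<in> F" if "w \<in> W" for w
      proof (rule exactly_supported_carrier[where a = "a F" and b = "b F" and h = h and V = "\<Union>K"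
            and W = W and u = u and c = c and d = d])
        show "(\<Sum>v\<in>W. u v *\<^sub>R v) \<in> convex hull F" using F x_def by simp
        show "\<forall>v\<in>\<Union> K. d \<le> c \<bullet> v + h v" using cd(1) lift by auto
        show "\<forall>v\<in>W. c \<bullet> v + h v = d" using lift W(2) unfolding W_def by (metis (mono_tags, lifting) mem_Collect_eq)
        show "\<forall>v\<in>W. u v \<ge> 0" using u by (auto intro: less_imp_le)
      qed (use F u that W ab finF in \<open>auto simp: u_def\<close>)
      then show ?thesis using sub F by blast
    qed
    then show "S \<in> (hull) convex ` K" using W by blast
  qed
  ultimately show "regular K" unfolding regular_def by blast
qed


subsection \<open>Chains in products of simplices\<close>

text \<open>Comparability is measured through real labels, so that one notion serves for ranks in
  the vertex orders, for colors, and for points of the plane. The labels may repeat globally;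
  injectivity is demanded where it matters.\<close>

definition mono_chain :: "('a \<Rightarrow> real) \<Rightarrow> ('b \<Rightarrow> real) \<Rightarrow> ('a \<times> 'b) set \<Rightarrow> bool" where
  "mono_chain \<rho> \<sigma> H \<longleftrightarrow> (\<forall>p\<in>H. \<forall>q\<in>H.
     \<rho> (fst p) \<le> \<rho> (fst q) \<and> \<sigma> (snd p) \<le> \<sigma> (snd q) \<or>
     \<rho> (fst q) \<le> \<rho> (fst p) \<and> \<sigma> (snd q) \<le> \<sigma> (snd p))"

lemma mono_chain_subset: "mono_chain \<rho> \<sigma> H \<Longrightarrow> H' \<subseteq> H \<Longrightarrow> mono_chain \<rho> \<sigma> H'"
  unfolding mono_chain_def by blast

lemma mono_chainD:
  assumes "mono_chain \<rho> \<sigma> H" "p \<in> H" "q \<in> H"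
  shows "\<rho> (fst p) \<le> \<rho> (fst q) \<and> \<sigma> (snd p) \<le> \<sigma> (snd q) \<or>
     \<rho> (fst q) \<le> \<rho> (fst p) \<and> \<sigma> (snd q) \<le> \<sigma> (snd p)"
  using assms unfolding mono_chain_def by blast

text \<open>In a chain an element that maximizes the sum of the two labels maximizes both of
  them.\<close>

lemma mono_chain_top:
  assumes "mono_chain \<rho> \<sigma> H" "finite H" "H \<noteq> {}"
  obtains t where "t \<in> H" "\<And>q. q \<in> H \<Longrightarrow> \<rho> (fst q) \<le> \<rho> (fst t) \<and> \<sigma> (snd q) \<le> \<sigma> (snd t)"
proof -
  let ?f = "\<lambda>p. \<rho> (fst p) + \<sigma> (snd p)"
  have "Max (?f ` H) \<in> ?f ` H" using assms by (intro Max_in) auto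
  then obtain t where t: "t \<in> H" "?f t = Max (?f ` H)" by auto
  have "\<rho> (fst q) \<le> \<rho> (fst t) \<and> \<sigma> (snd q) \<le> \<sigma> (snd t)" if q: "q \<in> H" for q
  proof -
    have "?f q \<le> ?f t" unfolding t(2) using q assms(2) by (intro Max_ge) auto
    then show ?thesis using mono_chainD[OF assms(1) q t(1)] by linarith
  qed
  then show ?thesis using that t by blast
qed

text \<open>The potentials are obtained by integrating along the piecewise linear curve through the
  chain, so that they increase by trapezoidal areas from one element of the chain to the next.\<close>

lemma mono_chain_potentials:
  fixes H :: "(real \<times> real) set"
  assumes "finite H" "mono_chain id id H"
  shows "\<exists>\<alpha> \<beta>. \<forall>x\<in>fst ` H. \<forall>y\<in>snd ` H. \<alpha> x + \<beta> y \<ge> x * y \<and> (\<alpha> x + \<beta> y = x * y \<longleftrightarrow> (x, y) \<in> H)"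
  using assms
proof (induction "card H" arbitrary: H rule: less_induct)
  case less
  show ?case
  proof (cases "H = {}")
    case False
    then obtain p where p: "p \<in> H" "\<And>q. q \<in> H \<Longrightarrow> fst q \<le> fst p \<and> snd q \<le> snd p"
      using mono_chain_top[of id id H] less.prems by auto
    obtain r' s' where rs': "p = (r', s')" by fastforce
    define H' where "H' = H - {p}"
    have H: "H = insert (r', s') H'" "(r', s') \<notin> H'" using p rs' by (auto simp: H'_def)
    have le': "fst q \<le> r' \<and> snd q \<le> s'" if "q \<in> H'" for q using p(2)[of q] that rs' by (auto simp: H'_def)
    have card: "card H' < card H" using less.prems(1) p(1) unfolding H'_def by (rule card_Diff1_less)
    have fin: "finite H'" and chain: "mono_chain id id H'"
      using less.prems mono_chain_subset[of id id H H'] by (auto simp: H'_def)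
    obtain \<alpha> \<beta> where ab: "\<And>x y. x \<in> fst ` H' \<Longrightarrow> y \<in> snd ` H' \<Longrightarrow>
        \<alpha> x + \<beta> y \<ge> x * y \<and> (\<alpha> x + \<beta> y = x * y \<longleftrightarrow> (x, y) \<in> H')"
      using less.hyps[OF card fin chain] by blast
    show ?thesis
    proof (cases "H' = {}")
      case True
      then show ?thesis by (intro exI[of _ "\<lambda>_. r' * s'"] exI[of _ "\<lambda>_. 0"]) (simp add: H)
    next
      case False
      then obtain t where t: "t \<in> H'" "\<And>q. q \<in> H' \<Longrightarrow> fst q \<le> fst t \<and> snd q \<le> snd t"
        using mono_chain_top[OF chain fin] by auto
      obtain r s where rs: "t = (r, s)" by fastforce
      have le: "x \<le> r" if "x \<in> fst ` H'" for x using t that rs by fastforce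
      have le2: "y \<le> s" if "y \<in> snd ` H'" for y using t that rs by fastforce
      have in': "r \<in> fst ` H'" "s \<in> snd ` H'" using t rs by force+
      have rr: "r \<le> r'" "s \<le> s'" using le'[OF t(1)] rs by auto
      \<comment> \<open>The two increments are the trapezoids beside and below the segment from (r,
        s) to (r', s'); they add up to \<open>r' * s' - r * s\<close>, so the new top satisfies
        equality again.\<close>
      define \<alpha>' where "\<alpha>' = \<alpha>(r' := \<alpha> r + (s + s') / 2 * (r' - r))"
      define \<beta>' where "\<beta>' = \<beta>(s' := \<beta> s + (r + r') / 2 * (s' - s))"
      have eq: "\<alpha> r + \<beta> s = r * s" using ab[OF in'] t rs by auto
      \<comment> \<open>Overwriting the value at \<open>r'\<close> does not disturb an old abscissa:
        if \<open>r'\<close> is one, then \<open>r = r'\<close> and the increment is zero.\<close>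
      have a': "\<alpha>' x = \<alpha> x" if "x \<in> fst ` H'" for x
        using le[OF that] rr by (cases "r = r'") (auto simp: \<alpha>'_def)
      have b': "\<beta>' x = \<beta> x" if "x \<in> snd ` H'" for x
        using le2[OF that] rr by (cases "s = s'") (auto simp: \<beta>'_def)
      have "\<alpha>' x + \<beta>' y \<ge> x * y \<and> (\<alpha>' x + \<beta>' y = x * y \<longleftrightarrow> (x, y) \<in> H)"
        if x: "x \<in> fst ` H" and y: "y \<in> snd ` H" for x y
      proof -
        consider "x = r'" "y = s'" | "x = r'" "y \<in> snd ` H'" "y \<noteq> s'"
          | "x \<in> fst ` H'" "y = s'" "x \<noteq> r'" | "x \<in> fst ` H'" "y \<in> snd ` H'" "x \<noteq> r'" "y \<noteq> s'"
          using x y unfolding H(1) by auto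
        then show ?thesis
        proof cases
          case 1
          have "\<alpha>' r' + \<beta>' s' = (\<alpha> r + \<beta> s) + (s + s') / 2 * (r' - r) + (r + r') / 2 * (s' - s)"
            by (simp add: \<alpha>'_def \<beta>'_def)
          also have "\<dots> = r' * s'" unfolding eq by (simp add: field_simps)
          finally show ?thesis using 1 H by simp
        next
          case 2
          \<comment> \<open>The slack at (r', y) is the slack at (r, y) plus a term that is positive
            as soon as \<open>r < r'\<close>, because \<open>y\<close> lies below the midpoint of
            \<open>s\<close> and \<open>s'\<close>. In that case the pair is also not in the chain,
            whose older abscissas are at most \<open>r\<close>.\<close>
          have v: "\<alpha>' x + \<beta>' y - x * y = (\<alpha> r + \<beta> y - r * y) + (r' - r) * ((s + s') / 2 - y)"
            using 2 b' by (simp add: \<alpha>'_def field_simps)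
          have mem: "(x, y) \<in> H \<longleftrightarrow> (x, y) \<in> H'" using 2 H by auto
          have ys: "y \<le> s" "y < (s + s') / 2" using le2[of y] 2 rr by auto
          show ?thesis
          proof (cases "r = r'")
            case True
            then show ?thesis using ab[OF in'(1) 2(2)] v mem 2 by auto
          next
            case False
            then have "(r' - r) * ((s + s') / 2 - y) > 0" using rr ys by simp
            moreover have "(x, y) \<notin> H'" using False rr le[of x] 2 by force
            ultimately show ?thesis using ab[OF in'(1) 2(2)] v mem by linarith
          qed
        next
          case 3
          have v: "\<alpha>' x + \<beta>' y - x * y = (\<alpha> x + \<beta> s - x * s) + (s' - s) * ((r + r') / 2 - x)"
            using 3 a' by (simp add: \<beta>'_def field_simps)
          have mem: "(x, y) \<in> H \<longleftrightarrow> (x, y) \<in> H'" using 3 H by auto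
          have xs: "x \<le> r" "x < (r + r') / 2" using le[of x] 3 rr by auto
          show ?thesis
          proof (cases "s = s'")
            case True
            then show ?thesis using ab[OF 3(1) in'(2)] v mem 3 by auto
          next
            case False
            then have "(s' - s) * ((r + r') / 2 - x) > 0" using rr xs by simp
            moreover have "(x, y) \<notin> H'" using False rr le2[of y] 3 by force
            ultimately show ?thesis using ab[OF 3(1) in'(2)] v mem by linarith
          qed
        next
          case 4
          then show ?thesis using ab[OF 4(1,2)] H a' b' by auto
        qed
      qed
      then show ?thesis by blast
    qed
  qed auto
qed

text \<open>The northwest corner rule of the transportation problem, started from the top corner.\<close>

lemma mono_chain_transport:
  fixes F :: "'a::real_vector set" and G :: "'b::real_vector set"
  assumes "finite F" "finite G" "inj_on \<rho> F" "inj_on \<sigma> G"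
    and "\<And>v. v \<in> F \<Longrightarrow> \<alpha> v \<ge> 0" "\<And>w. w \<in> G \<Longrightarrow> \<beta> w \<ge> (0::real)" "sum \<alpha> F = sum \<beta> G"
  shows "\<exists>H\<subseteq>F \<times> G. \<exists>\<gamma>. mono_chain \<rho> \<sigma> H \<and> (\<forall>h\<in>H. \<gamma> h \<ge> 0) \<and> sum \<gamma> H = sum \<alpha> F \<and>
    (\<Sum>h\<in>H. \<gamma> h *\<^sub>R h) = (\<Sum>v\<in>F. \<alpha> v *\<^sub>R v, \<Sum>w\<in>G. \<beta> w *\<^sub>R w)"
  using assms
proof (induction "card F + card G" arbitrary: F G \<alpha> \<beta> rule: less_induct)
  case less
  show ?case
  proof (cases "F = {} \<or> G = {}")
    case True
    then have "sum \<alpha> F = 0" "sum \<beta> G = 0" using less.prems by auto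
    then have "\<forall>v\<in>F. \<alpha> v = 0" "\<forall>w\<in>G. \<beta> w = 0"
      using less.prems by (simp_all add: sum_nonneg_eq_0_iff)
    then show ?thesis using \<open>sum \<alpha> F = 0\<close>
      by (intro exI[of _ "{}"]) (auto simp: mono_chain_def zero_prod_def)
  next
    case False
    have "Max (\<rho> ` F) \<in> \<rho> ` F" "Max (\<sigma> ` G) \<in> \<sigma> ` G" using False less.prems by (auto intro!: Max_in)
    then obtain v w where v: "v \<in> F" "\<rho> v = Max (\<rho> ` F)" and w: "w \<in> G" "\<sigma> w = Max (\<sigma> ` G)" by auto
    have vmax: "\<rho> u \<le> \<rho> v" if "u \<in> F" for u unfolding v(2) using that less.prems by auto
    have wmax: "\<sigma> u \<le> \<sigma> w" if "u \<in> G" for u unfolding w(2) using that less.prems by auto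
    have top: "mono_chain \<rho> \<sigma> (insert (v, w) H)" if "H \<subseteq> F \<times> G" "mono_chain \<rho> \<sigma> H" for H
    proof -
      have "\<rho> (fst q) \<le> \<rho> v \<and> \<sigma> (snd q) \<le> \<sigma> w" if "q \<in> H" for q
        using that \<open>H \<subseteq> F \<times> G\<close> vmax[of "fst q"] wmax[of "snd q"] by (cases q) auto
      then show ?thesis using that(2) unfolding mono_chain_def by simp
    qed
    note Fv = sum.remove[OF less.prems(1) v(1)] and Gw = sum.remove[OF less.prems(2) w(1)]
    show ?thesis
    proof (cases "\<alpha> v \<le> \<beta> w")
      case True
      \<comment> \<open>The corner (v, w) takes the smaller of the two masses, here all of
        \<open>\<alpha> v\<close>; then \<open>v\<close> is exhausted and dropped, and
        \<open>w\<close> keeps the remainder. The other case exchanges the roles.\<close>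
      define \<beta>' where "\<beta>' = \<beta>(w := \<beta> w - \<alpha> v)"
      have sums: "sum \<beta>' (G - {w}) = sum \<beta> (G - {w})"
        "(\<Sum>u\<in>G - {w}. \<beta>' u *\<^sub>R u) = (\<Sum>u\<in>G - {w}. \<beta> u *\<^sub>R u)"
        by (auto simp: \<beta>'_def intro!: sum.cong)
      have "card (F - {v}) + card G < card F + card G"
        using card_Diff1_less[OF less.prems(1) v(1)] by simp
      moreover have "finite (F - {v})" "inj_on \<rho> (F - {v})"
        using less.prems(1,3) by (auto intro: inj_on_subset)
      moreover have "\<alpha> u \<ge> 0" if "u \<in> F - {v}" for u using that less.prems(5) by blast
      moreover have "\<beta>' u \<ge> 0" if "u \<in> G" for u using that less.prems(6) True by (auto simp: \<beta>'_def)
      moreover have "sum \<alpha> (F - {v}) = sum \<beta>' G"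
        using Fv[of \<alpha>] Gw[of \<beta>] Gw[of \<beta>'] sums less.prems(7) by (simp add: \<beta>'_def)
      ultimately obtain H \<gamma> where H: "H \<subseteq> (F - {v}) \<times> G" "mono_chain \<rho> \<sigma> H"
        "\<forall>h\<in>H. \<gamma> h \<ge> 0" "sum \<gamma> H = sum \<alpha> (F - {v})"
        "(\<Sum>h\<in>H. \<gamma> h *\<^sub>R h) = (\<Sum>v\<in>F - {v}. \<alpha> v *\<^sub>R v, \<Sum>w\<in>G. \<beta>' w *\<^sub>R w)"
        using less.hyps[of "F - {v}" G \<alpha> \<beta>'] less.prems(2,4) by blast
      have notin: "(v, w) \<notin> H" and "finite H" using H(1) less.prems by (auto intro: finite_subset[of H "(F - {v}) \<times> G"])
      let ?\<gamma> = "\<gamma>((v, w) := \<alpha> v)"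
      have "sum ?\<gamma> H = sum \<gamma> H" "(\<Sum>h\<in>H. ?\<gamma> h *\<^sub>R h) = (\<Sum>h\<in>H. \<gamma> h *\<^sub>R h)"
        using notin by (auto intro!: sum.cong)
      then have "sum ?\<gamma> (insert (v, w) H) = sum \<alpha> F"
        "(\<Sum>h\<in>insert (v, w) H. ?\<gamma> h *\<^sub>R h) = (\<Sum>v\<in>F. \<alpha> v *\<^sub>R v, \<Sum>w\<in>G. \<beta> w *\<^sub>R w)"
        using notin \<open>finite H\<close> H Fv[of \<alpha>] Fv[of "\<lambda>v. \<alpha> v *\<^sub>R v"] Gw[of "\<lambda>v. \<beta> v *\<^sub>R v"]
          Gw[of "\<lambda>v. \<beta>' v *\<^sub>R v"] sums
        by (auto simp: \<beta>'_def algebra_simps)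
      moreover have "mono_chain \<rho> \<sigma> (insert (v, w) H)" using top H by blast
      moreover have "insert (v, w) H \<subseteq> F \<times> G" using H(1) v w by auto
      moreover have "\<forall>h\<in>insert (v, w) H. ?\<gamma> h \<ge> 0" using H(3) less.prems(5)[OF v(1)] by auto
      ultimately show ?thesis by blast
    next
      case False
      define \<alpha>' where "\<alpha>' = \<alpha>(v := \<alpha> v - \<beta> w)"
      have sums: "sum \<alpha>' (F - {v}) = sum \<alpha> (F - {v})"
        "(\<Sum>u\<in>F - {v}. \<alpha>' u *\<^sub>R u) = (\<Sum>u\<in>F - {v}. \<alpha> u *\<^sub>R u)"
        by (auto simp: \<alpha>'_def intro!: sum.cong)
      have "card F + card (G - {w}) < card F + card G"
        using card_Diff1_less[OF less.prems(2) w(1)] by simp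
      moreover have "finite (G - {w})" "inj_on \<sigma> (G - {w})"
        using less.prems(2,4) by (auto intro: inj_on_subset)
      moreover have "\<beta> u \<ge> 0" if "u \<in> G - {w}" for u using that less.prems(6) by blast
      moreover have "\<alpha>' u \<ge> 0" if "u \<in> F" for u using that less.prems(5) False by (auto simp: \<alpha>'_def)
      moreover have "sum \<alpha>' F = sum \<beta> (G - {w})"
        using Fv[of \<alpha>] Gw[of \<beta>] Fv[of \<alpha>'] sums less.prems(7) by (simp add: \<alpha>'_def)
      ultimately obtain H \<gamma> where H: "H \<subseteq> F \<times> (G - {w})" "mono_chain \<rho> \<sigma> H"
        "\<forall>h\<in>H. \<gamma> h \<ge> 0" "sum \<gamma> H = sum \<alpha>' F"
        "(\<Sum>h\<in>H. \<gamma> h *\<^sub>R h) = (\<Sum>v\<in>F. \<alpha>' v *\<^sub>R v, \<Sum>w\<in>G - {w}. \<beta> w *\<^sub>R w)"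
        using less.hyps[of F "G - {w}" \<alpha>' \<beta>] less.prems(1,3) by blast
      have notin: "(v, w) \<notin> H" and "finite H" using H(1) less.prems by (auto intro: finite_subset[of H "F \<times> (G - {w})"])
      let ?\<gamma> = "\<gamma>((v, w) := \<beta> w)"
      have "sum ?\<gamma> H = sum \<gamma> H" "(\<Sum>h\<in>H. ?\<gamma> h *\<^sub>R h) = (\<Sum>h\<in>H. \<gamma> h *\<^sub>R h)"
        using notin by (auto intro!: sum.cong)
      then have "sum ?\<gamma> (insert (v, w) H) = sum \<alpha> F"
        "(\<Sum>h\<in>insert (v, w) H. ?\<gamma> h *\<^sub>R h) = (\<Sum>v\<in>F. \<alpha> v *\<^sub>R v, \<Sum>w\<in>G. \<beta> w *\<^sub>R w)"
        using notin \<open>finite H\<close> H Fv[of \<alpha>] Fv[of \<alpha>'] Fv[of "\<lambda>v. \<alpha> v *\<^sub>R v"] Gw[of "\<lambda>v. \<beta> v *\<^sub>R v"]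
          Fv[of "\<lambda>v. \<alpha>' v *\<^sub>R v"] sums
        by (auto simp: \<alpha>'_def algebra_simps)
      moreover have "mono_chain \<rho> \<sigma> (insert (v, w) H)" using top[of H] H by blast
      moreover have "insert (v, w) H \<subseteq> F \<times> G" using H(1) v w by auto
      moreover have "\<forall>h\<in>insert (v, w) H. ?\<gamma> h \<ge> 0" using H(3) less.prems(6)[OF w(1)] by auto
      ultimately show ?thesis by blast
    qed
  qed
qed

text \<open>Barycentric coordinates of \<open>x\<close> and \<open>y\<close> act as supply and
  demand; a transport plan supported on a chain is a convex representation of (x, y) over that
  chain.\<close>

lemma mono_chain_cover:
  fixes F :: "'a::euclidean_space set" and G :: "'b::euclidean_space set"
  assumes "finite F" "finite G" "inj_on \<rho> F" "inj_on \<sigma> G" "x \<in> convex hull F" "y \<in> convex hull G"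
  obtains H where "H \<subseteq> F \<times> G" "mono_chain \<rho> \<sigma> H" "(x, y) \<in> convex hull H"
proof -
  obtain \<alpha> \<beta> where a: "\<forall>v\<in>F. \<alpha> v \<ge> 0" "sum \<alpha> F = 1" "(\<Sum>v\<in>F. \<alpha> v *\<^sub>R v) = x"
    and b: "\<forall>v\<in>G. \<beta> v \<ge> 0" "sum \<beta> G = 1" "(\<Sum>v\<in>G. \<beta> v *\<^sub>R v) = y"
    using assms(5,6) unfolding convex_hull_finite[OF assms(1)] convex_hull_finite[OF assms(2)] by blast
  then obtain H \<gamma> where H: "H \<subseteq> F \<times> G" "mono_chain \<rho> \<sigma> H" "\<forall>h\<in>H. \<gamma> h \<ge> 0" "sum \<gamma> H = 1"
    "(\<Sum>h\<in>H. \<gamma> h *\<^sub>R h) = (x, y)"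
    using mono_chain_transport[OF assms(1-4), of \<alpha> \<beta>] by auto
  have "finite H" using H(1) assms finite_subset by blast
  then have "(x, y) \<in> convex hull H" unfolding convex_hull_finite[OF \<open>finite H\<close>] using H by blast
  then show ?thesis using that H by blast
qed

lemma affine_independent_fibre_sum:
  fixes f :: "'a::euclidean_space \<Rightarrow> 'b::euclidean_space"
  assumes "linear f" "\<not> affine_dependent (f ` H)" "finite H"
    "sum U H = 0" "(\<Sum>h\<in>H. U h *\<^sub>R h) = 0" "v \<in> f ` H"
  shows "(\<Sum>h | h \<in> H \<and> f h = v. U h) = 0"
proof -
  define W where "W v = (\<Sum>h | h \<in> H \<and> f h = v. U h)" for v
  have "sum W (f ` H) = 0"
    unfolding W_def using assms(3,4) sum.image_gen[OF assms(3), of U f] by simp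
  moreover have "(\<Sum>v\<in>f ` H. W v *\<^sub>R v) = (\<Sum>h\<in>H. U h *\<^sub>R f h)"
    unfolding sum.image_gen[OF assms(3), of "\<lambda>h. U h *\<^sub>R f h" f] W_def
    by (auto simp: scaleR_sum_left intro!: sum.cong)
  moreover have "(\<Sum>h\<in>H. U h *\<^sub>R f h) = f (\<Sum>h\<in>H. U h *\<^sub>R h)"
    using assms(1) by (simp add: linear_sum linear_cmul)
  moreover have "f 0 = 0" using assms(1) linear_0 by blast
  ultimately have "W v = 0"
    using assms(2,3,5,6) by (auto simp: affine_dependent_explicit_finite)
  then show ?thesis by (simp add: W_def)
qed

text \<open>Take the top element \<open>t\<close> among those with nonzero coefficient in a
  dependence. Fibre sums vanish, so the same column contains another such element \<open>p\<close>
  and the same row another such element \<open>q\<close>. Then \<open>p\<close> is strictly lower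
  and \<open>q\<close> strictly further left, and these two are incomparable.\<close>

lemma mono_chain_affine_independent:
  fixes H :: "('a::euclidean_space \<times> 'b::euclidean_space) set"
  assumes "finite H" "mono_chain \<rho> \<sigma> H" "inj_on \<rho> (fst ` H)" "inj_on \<sigma> (snd ` H)"
    "\<not> affine_dependent (fst ` H)" "\<not> affine_dependent (snd ` H)"
  shows "\<not> affine_dependent H"
proof
  assume "affine_dependent H"
  then obtain U where U: "sum U H = 0" "\<exists>v\<in>H. U v \<noteq> 0" "(\<Sum>h\<in>H. U h *\<^sub>R h) = 0"
    using affine_dependent_explicit_finite[OF assms(1)] by blast
  define N where "N = {h \<in> H. U h \<noteq> 0}"
  have N: "finite N" "N \<noteq> {}" "N \<subseteq> H" using U assms(1) by (auto simp: N_def)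
  then obtain t where t: "t \<in> N" "\<And>q. q \<in> N \<Longrightarrow> \<rho> (fst q) \<le> \<rho> (fst t) \<and> \<sigma> (snd q) \<le> \<sigma> (snd t)"
    using mono_chain_top[OF mono_chain_subset[OF assms(2) N(3)]] by blast
  have "\<exists>p\<in>N. p \<noteq> t \<and> f p = f t" if s: "(\<Sum>h | h \<in> H \<and> f h = f t. U h) = 0" for f :: "_ \<Rightarrow> 'c"
  proof (rule ccontr)
    assume "\<not> ?thesis"
    then have "(\<Sum>h | h \<in> H \<and> f h = f t. U h) = (\<Sum>h\<in>{t}. U h)"
      using assms(1) t(1) by (intro sum.mono_neutral_right) (auto simp: N_def)
    then show False using s t(1) by (simp add: N_def)
  qed
  note fibre = this
  have tH: "t \<in> H" using t N by blast
  obtain p where p: "p \<in> N" "p \<noteq> t" "fst p = fst t"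
    using fibre[of fst] affine_independent_fibre_sum[OF linear_fst assms(5,1) U(1,3)] tH by blast
  obtain q where q: "q \<in> N" "q \<noteq> t" "snd q = snd t"
    using fibre[of snd] affine_independent_fibre_sum[OF linear_snd assms(6,1) U(1,3)] tH by blast
  have "\<sigma> (snd p) \<noteq> \<sigma> (snd t)"
    using p N tH inj_onD[OF assms(4), of "snd p" "snd t"] by (auto simp: prod_eq_iff)
  moreover have "\<rho> (fst q) \<noteq> \<rho> (fst t)"
    using q N tH inj_onD[OF assms(3), of "fst q" "fst t"] by (auto simp: prod_eq_iff)
  ultimately have "\<sigma> (snd p) < \<sigma> (snd t)" "\<rho> (fst q) < \<rho> (fst t)"
    using t(2)[OF p(1)] t(2)[OF q(1)] by auto
  then show False
    using mono_chainD[OF assms(2), of p q] p q N by auto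
qed

section \<open>Heights and the triangulation of the product\<close>

lemma linear_order_rank:
  assumes "finite V" "linear_order_on V r"
  shows "\<exists>\<rho> :: 'a \<Rightarrow> real. inj_on \<rho> V \<and> (\<forall>u\<in>V. \<forall>v\<in>V. (u, v) \<in> r \<longleftrightarrow> \<rho> u \<le> \<rho> v)"
proof -
  have ord: "refl_on V r" "trans r" "antisym r" "total_on V r"
    using assms(2) by (auto simp: linear_order_on_def partial_order_on_def preorder_on_def)
  define D where "D v = {u \<in> V. (u, v) \<in> r}" for v
  have fin: "finite (D v)" for v using assms by (simp add: D_def)
  define \<rho> where "\<rho> v = real (card (D v))" for v
  have le: "\<rho> u \<le> \<rho> v" if "(u, v) \<in> r" for u v
    using that ord(2) fin by (auto simp: \<rho>_def D_def intro!: card_mono dest: transD)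
  have less: "\<rho> u < \<rho> v" if "(u, v) \<in> r" "u \<noteq> v" "v \<in> V" for u v
  proof -
    have "v \<in> D v" "v \<notin> D u" using that ord by (auto simp: D_def refl_on_def dest: antisymD)
    moreover have "D u \<subseteq> D v" using that ord(2) by (auto simp: D_def dest: transD)
    ultimately have "D u \<subset> D v" by blast
    then show ?thesis using fin by (simp add: \<rho>_def psubset_card_mono)
  qed
  have iff: "(u, v) \<in> r \<longleftrightarrow> \<rho> u \<le> \<rho> v" if "u \<in> V" "v \<in> V" for u v
    using le[of u v] less[of v u] that ord unfolding total_on_def refl_on_def by (metis linorder_not_le order_refl)
  moreover have "inj_on \<rho> V"
    using iff ord(3) by (intro inj_onI) (metis antisymD order_refl)
  ultimately show ?thesis by blast
qed

text \<open>The slack of the combined support is \<open>M * A + B\<close>. Here \<open>A\<close> is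
  the slack of the product cell, zero on \<open>F \<times> G\<close> and positive elsewhere, and
  \<open>B\<close> is the slack of the potentials, zero on \<open>H\<close> and positive on the rest
  of \<open>F \<times> G\<close>. Off the cell \<open>B\<close> can be negative, but a large
  \<open>M\<close> outweighs it. Stating this as eventual truth allows one \<open>M\<close> to be
  shared by finitely many chains.\<close>

lemma exactly_supported_product_eventually:
  fixes F :: "'a::euclidean_space set" and G :: "'b::euclidean_space set"
  assumes fin: "finite V" "finite W"
    and F: "fst ` H = F" "F \<subseteq> V" "\<not> affine_dependent F" "exactly_supported V f F"
    and G: "snd ` H = G" "G \<subseteq> W" "\<not> affine_dependent G" "exactly_supported W g G"
    and chain: "mono_chain \<rho> \<sigma> H" "inj_on \<rho> V" "inj_on \<sigma> W"
  shows "\<forall>\<^sub>F M in at_top. exactly_supported (V \<times> W)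
    (\<lambda>p. M * (f (fst p) + g (snd p)) - \<rho> (fst p) * \<sigma> (snd p)) H"
proof -
  obtain a b where ab: "\<forall>v\<in>F. a \<bullet> v + f v = b" "\<forall>v\<in>V - F. a \<bullet> v + f v > b"
    using F(4) exactly_supported_def by metis
  obtain c d where cd: "\<forall>v\<in>G. c \<bullet> v + g v = d" "\<forall>v\<in>W - G. c \<bullet> v + g v > d"
    using G(4) exactly_supported_def by metis
  have HFG: "H \<subseteq> F \<times> G" using F(1) G(1) by force
  have finH: "finite H" using HFG F G fin by (meson finite_SigmaI finite_subset)
  define H2 where "H2 = map_prod \<rho> \<sigma> ` H"
  have fs: "fst ` H2 = \<rho> ` F" "snd ` H2 = \<sigma> ` G"
    unfolding H2_def F(1)[symmetric] G(1)[symmetric] by (force simp: image_image)+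
  have "mono_chain id id H2" using chain(1) unfolding mono_chain_def H2_def by auto
  then obtain \<alpha> \<beta> where pot: "\<forall>x\<in>\<rho> ` F. \<forall>y\<in>\<sigma> ` G. \<alpha> x + \<beta> y \<ge> x * y \<and>
      (\<alpha> x + \<beta> y = x * y \<longleftrightarrow> (x, y) \<in> H2)"
    using mono_chain_potentials[of H2] finH unfolding fs by (auto simp: H2_def)
  have H2: "(\<rho> v, \<sigma> w) \<in> H2 \<longleftrightarrow> (v, w) \<in> H" if "v \<in> V" "w \<in> W" for v w
  proof
    assume "(\<rho> v, \<sigma> w) \<in> H2"
    then obtain v' w' where h: "(v', w') \<in> H" "\<rho> v = \<rho> v'" "\<sigma> w = \<sigma> w'" by (auto simp: H2_def)
    then have "v' \<in> V" "w' \<in> W" using HFG F G by auto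
    then show "(v, w) \<in> H" using h that chain inj_onD by metis
  qed (force simp: H2_def)
  \<comment> \<open>Potentials are numbers attached to ranks; affine independence of the faces turns
    them into affine functions on the ambient spaces.\<close>
  obtain p p0 where p: "\<And>v. v \<in> F \<Longrightarrow> p \<bullet> v + p0 = \<alpha> (\<rho> v)"
    using affine_interpolation[OF F(3), of "\<lambda>v. \<alpha> (\<rho> v)"] by blast
  obtain q q0 where q: "\<And>v. v \<in> G \<Longrightarrow> q \<bullet> v + q0 = \<beta> (\<sigma> v)"
    using affine_interpolation[OF G(3), of "\<lambda>v. \<beta> (\<sigma> v)"] by blast
  define A where "A = (\<lambda>(v, w). (a \<bullet> v + f v - b) + (c \<bullet> w + g w - d))"
  define B where "B = (\<lambda>(v, w). (p \<bullet> v + p0) + (q \<bullet> w + q0) - \<rho> v * \<sigma> w)"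
  have A0: "A z = 0" if "z \<in> F \<times> G" for z using that ab cd by (auto simp: A_def)
  have A1: "A z > 0" if "z \<in> V \<times> W" "z \<notin> F \<times> G" for z
  proof -
    obtain v w where z: "z = (v, w)" "v \<in> V" "w \<in> W" using \<open>z \<in> V \<times> W\<close> by blast
    have "a \<bullet> v + f v = b \<and> v \<in> F \<or> a \<bullet> v + f v > b" "c \<bullet> w + g w = d \<and> w \<in> G \<or> c \<bullet> w + g w > d"
      using ab cd z by blast+
    then show ?thesis using that(2) unfolding A_def z(1) by auto
  qed
  have B0: "B z = 0" if "z \<in> H" for z
  proof -
    obtain v w where z: "z = (v, w)" "v \<in> F" "w \<in> G" "(v, w) \<in> H" using \<open>z \<in> H\<close> HFG by (cases z) blast
    have "\<alpha> (\<rho> v) + \<beta> (\<sigma> w) = \<rho> v * \<sigma> w" using pot z H2[of v w] F G by blast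
    then show ?thesis using z p q by (simp add: B_def)
  qed
  have B1: "B z > 0" if "z \<in> F \<times> G" "z \<notin> H" for z
  proof -
    obtain v w where z: "z = (v, w)" "v \<in> F" "w \<in> G" using \<open>z \<in> F \<times> G\<close> by blast
    have "\<alpha> (\<rho> v) + \<beta> (\<sigma> w) > \<rho> v * \<sigma> w"
      using pot z H2[of v w] F G that by (metis imageI order_less_le subsetD)
    then show ?thesis using z p q by (simp add: B_def)
  qed
  have "\<forall>\<^sub>F M in at_top. M * A z + B z > 0" if "z \<in> V \<times> W - F \<times> G" for z
  proof -
    have "A z > 0" using A1 that by blast
    then have "filterlim (\<lambda>M. B z + A z * M) at_top at_top"
      by (intro filterlim_tendsto_add_at_top[OF tendsto_const]
           filterlim_tendsto_pos_mult_at_top[OF tendsto_const] filterlim_ident)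
    then show ?thesis by (simp add: filterlim_at_top_dense add.commute mult.commute)
  qed
  then have "\<forall>\<^sub>F M in at_top. \<forall>z\<in>V \<times> W - F \<times> G. M * A z + B z > 0"
    using fin by (intro eventually_ball_finite) auto
  then show ?thesis
  proof eventually_elim
    case (elim M)
    let ?a = "(M *\<^sub>R a + p, M *\<^sub>R c + q)" and ?b = "M * (b + d) - p0 - q0"
    have eq: "?a \<bullet> z + (M * (f (fst z) + g (snd z)) - \<rho> (fst z) * \<sigma> (snd z)) - ?b = M * A z + B z" for z
      by (cases z) (simp add: A_def B_def algebra_simps inner_add_left)
    have "?a \<bullet> z + (M * (f (fst z) + g (snd z)) - \<rho> (fst z) * \<sigma> (snd z)) = ?b" if "z \<in> H" for z
      using eq[of z] A0[of z] B0[OF that] that HFG by auto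
    moreover have "?a \<bullet> z + (M * (f (fst z) + g (snd z)) - \<rho> (fst z) * \<sigma> (snd z)) > ?b"
      if "z \<in> V \<times> W - H" for z
    proof (cases "z \<in> F \<times> G")
      case True
      then show ?thesis using eq[of z] A0[of z] B1[of z] that by auto
    next
      case False
      then have "M * A z + B z > 0" using elim that by blast
      then show ?thesis using eq[of z] by linarith
    qed
    ultimately show ?case unfolding exactly_supported_def by blast
  qed
qed

text \<open>The sets \<open>V\<close> and \<open>W\<close> are free so that the labels may be ranks
  on all vertices or colors on the vertices of a single pair of faces, where alone colors reflect
  the order.\<close>

lemma total_on_product_order_iff:
  assumes "H \<subseteq> V \<times> W"
    "\<forall>u\<in>V. \<forall>v\<in>V. (u, v) \<in> r \<longleftrightarrow> \<rho> u \<le> \<rho> v"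
    "\<forall>u\<in>W. \<forall>v\<in>W. (u, v) \<in> s \<longleftrightarrow> \<sigma> u \<le> \<sigma> v"
  shows "total_on H (product_order r s) \<longleftrightarrow> mono_chain \<rho> \<sigma> H"
proof -
  have "(x, y) \<in> product_order r s \<longleftrightarrow> \<rho> (fst x) \<le> \<rho> (fst y) \<and> \<sigma> (snd x) \<le> \<sigma> (snd y)"
    if "x \<in> H" "y \<in> H" for x y
  proof -
    have "fst x \<in> V" "fst y \<in> V" "snd x \<in> W" "snd y \<in> W" using that assms(1) by auto
    then show ?thesis
      using assms(2,3) unfolding product_order_def by (cases x; cases y) simp
  qed
  then show ?thesis unfolding total_on_def mono_chain_def by (metis order_refl)
qed

lemma stc_product_eq:
  assumes "\<forall>u\<in>\<Union>K. \<forall>v\<in>\<Union>K. (u, v) \<in> r \<longleftrightarrow> \<rho> u \<le> \<rho> v"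
    "\<forall>u\<in>\<Union>L. \<forall>v\<in>\<Union>L. (u, v) \<in> s \<longleftrightarrow> \<sigma> u \<le> \<sigma> v"
  shows "stc_product K r L s = {H. fst ` H \<in> K \<and> snd ` H \<in> L \<and> mono_chain \<rho> \<sigma> H}"
proof -
  have "H \<subseteq> \<Union>K \<times> \<Union>L" if "fst ` H \<in> K" "snd ` H \<in> L" for H
  proof -
    have "H \<subseteq> fst ` H \<times> snd ` H" by force
    then show ?thesis using that by blast
  qed
  moreover have "total_on H (product_order r s) \<longleftrightarrow> mono_chain \<rho> \<sigma> H" if "H \<subseteq> \<Union>K \<times> \<Union>L" for H
    using that assms by (rule total_on_product_order_iff)
  ultimately show ?thesis unfolding stc_product_def by blast
qed

lemma vertices_stc_product:
  assumes "triangulates K P" "triangulates L Q" "linear_order_on (\<Union>K) r" "linear_order_on (\<Union>L) s"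
  shows "\<Union>(stc_product K r L s) = \<Union>K \<times> \<Union>L"
proof
  show "\<Union>K \<times> \<Union>L \<subseteq> \<Union>(stc_product K r L s)"
  proof
    fix z assume "z \<in> \<Union>K \<times> \<Union>L"
    then obtain v w F G where z: "z = (v, w)" "v \<in> F" "F \<in> K" "w \<in> G" "G \<in> L" by auto
    then have "{v} \<in> K" "{w} \<in> L" using assms triangulates_subset by blast+
    then have "{z} \<in> stc_product K r L s" using z unfolding stc_product_def by auto
    then show "z \<in> \<Union>(stc_product K r L s)" by blast
  qed
qed (auto simp: stc_product_def)

text \<open>Colors play no part at this stage: arbitrary linear orders are replaced by their ranks.
  Every chain is exactly supported once \<open>M\<close> is large, and there are finitely many
  chains.\<close>

theorem stc_product_regular_triangulation:
  fixes K :: "'a::euclidean_space set set" and L :: "'b::euclidean_space set set"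
  assumes K: "triangulates K P" "regular K" "convex P" "P \<noteq> {}"
    and L: "triangulates L Q" "regular L" "convex Q" "Q \<noteq> {}"
    and ord: "linear_order_on (\<Union>K) r" "linear_order_on (\<Union>L) s"
  shows "triangulates (stc_product K r L s) (P \<times> Q) \<and> regular (stc_product K r L s)"
proof -
  let ?S = "stc_product K r L s"
  note fin = triangulates_finite_vertices[OF K(1)] triangulates_finite_vertices[OF L(1)]
  obtain \<rho> :: "'a \<Rightarrow> real" where "inj_on \<rho> (\<Union>K) \<and> (\<forall>u\<in>\<Union>K. \<forall>v\<in>\<Union>K. (u, v) \<in> r \<longleftrightarrow> \<rho> u \<le> \<rho> v)"
    using linear_order_rank[OF fin(1) ord(1)] by (elim exE)
  note rho = this[THEN conjunct1] this[THEN conjunct2]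
  obtain \<sigma> :: "'b \<Rightarrow> real" where "inj_on \<sigma> (\<Union>L) \<and> (\<forall>u\<in>\<Union>L. \<forall>v\<in>\<Union>L. (u, v) \<in> s \<longleftrightarrow> \<sigma> u \<le> \<sigma> v)"
    using linear_order_rank[OF fin(2) ord(2)] by (elim exE)
  note sig = this[THEN conjunct1] this[THEN conjunct2]
  note S = stc_product_eq[OF rho(2) sig(2)]
  note V = vertices_stc_product[OF K(1) L(1) ord]
  have finV: "finite (\<Union>?S)" unfolding V using fin by blast
  obtain f where f: "\<And>F. F \<in> K \<Longrightarrow> exactly_supported (\<Union>K) f F"
    using regular_exactly_supported[OF K(1,2)] by blast
  obtain g where g: "\<And>F. F \<in> L \<Longrightarrow> exactly_supported (\<Union>L) g F"
    using regular_exactly_supported[OF L(1,2)] by blast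
  let ?h = "\<lambda>M p. M * (f (fst p) + g (snd p)) - \<rho> (fst p) * \<sigma> (snd p)"
  have "\<forall>\<^sub>F M in at_top. exactly_supported (\<Union>K \<times> \<Union>L) (?h M) H" if "H \<in> ?S" for H
  proof -
    have H: "fst ` H \<in> K" "snd ` H \<in> L" "mono_chain \<rho> \<sigma> H" using that unfolding S by auto
    show ?thesis
      using exactly_supported_product_eventually[OF fin refl _
          triangulates_affine_independent[OF K(1) H(1)] f[OF H(1)] refl _
          triangulates_affine_independent[OF L(1) H(2)] g[OF H(2)] H(3) rho(1) sig(1)] H by blast
  qed
  moreover have "finite ?S" using finV finite_UnionD by blast
  ultimately have "\<forall>\<^sub>F M in at_top. \<forall>H\<in>?S. exactly_supported (\<Union>?S) (?h M) H"
    unfolding V by (simp add: eventually_ball_finite)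
  then obtain M where M: "\<And>H. H \<in> ?S \<Longrightarrow> exactly_supported (\<Union>?S) (?h M) H"
    using eventually_happens'[OF trivial_limit_at_top_linorder] by blast
  show ?thesis
  proof (rule exactly_supported_regular_triangulation[OF finV _ _ _ M])
    have "K \<noteq> {}" "L \<noteq> {}" using K(1,4) L(1,4) by (auto simp: triangulates_def)
    then have "{} \<in> K" "{} \<in> L"
      using triangulates_subset[OF K(1) _ empty_subsetI] triangulates_subset[OF L(1) _ empty_subsetI]
      by blast+
    then have "{} \<in> ?S" unfolding S by (simp add: mono_chain_def)
    then show "?S \<noteq> {}" by blast
    show "\<not> affine_dependent H" if "H \<in> ?S" for H
    proof (rule mono_chain_affine_independent)
      have H: "fst ` H \<in> K" "snd ` H \<in> L" "mono_chain \<rho> \<sigma> H" using that unfolding S by auto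
      then show "mono_chain \<rho> \<sigma> H" "\<not> affine_dependent (fst ` H)" "\<not> affine_dependent (snd ` H)"
        using triangulates_affine_independent K L by blast+
      show "finite H" using that finV by (meson Union_upper finite_subset)
      show "inj_on \<rho> (fst ` H)" "inj_on \<sigma> (snd ` H)"
        using H by (auto intro: inj_on_subset[OF rho(1)] inj_on_subset[OF sig(1)])
    qed
    show "H' \<in> ?S" if "H \<in> ?S" "H' \<subseteq> H" for H H'
      using that triangulates_subset[OF K(1), of "fst ` H" "fst ` H'"]
        triangulates_subset[OF L(1), of "snd ` H" "snd ` H'"] mono_chain_subset[of \<rho> \<sigma> H H']
      unfolding S by (simp add: image_mono)
    show "\<Union>?S \<subseteq> P \<times> Q"
      unfolding V using triangulates_vertices_subset[OF K(1)] triangulates_vertices_subset[OF L(1)]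
      by (rule Sigma_mono)
    show conv: "convex (P \<times> Q)" using K L by (simp add: convex_Times)
    show "\<Union> ((hull) convex ` ?S) = P \<times> Q"
    proof
      show "\<Union> ((hull) convex ` ?S) \<subseteq> P \<times> Q"
      proof (rule UN_least)
        fix H assume "H \<in> ?S"
        then have "H \<subseteq> \<Union>?S" by blast
        then show "convex hull H \<subseteq> P \<times> Q"
          using \<open>\<Union>?S \<subseteq> P \<times> Q\<close> conv by (intro hull_minimal) auto
      qed
      show "P \<times> Q \<subseteq> \<Union> ((hull) convex ` ?S)"
      proof
        fix z assume "z \<in> P \<times> Q"
        then obtain x y where z: "z = (x, y)" "x \<in> P" "y \<in> Q" by auto
        then obtain F G where F: "F \<in> K" "x \<in> convex hull F" and G: "G \<in> L" "y \<in> convex hull G"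
          using K(1) L(1) unfolding triangulates_def by blast
        have inj: "inj_on \<rho> F" "inj_on \<sigma> G"
          using F G by (auto intro: inj_on_subset[OF rho(1)] inj_on_subset[OF sig(1)])
        obtain H where H: "H \<subseteq> F \<times> G" "mono_chain \<rho> \<sigma> H" "(x, y) \<in> convex hull H"
          using mono_chain_cover[OF triangulates_finite_face[OF K(1) F(1)]
              triangulates_finite_face[OF L(1) G(1)] inj F(2) G(2)] by blast
        have "fst ` H \<subseteq> F" "snd ` H \<subseteq> G" using H(1) by auto
        then have "fst ` H \<in> K" "snd ` H \<in> L"
          using triangulates_subset[OF K(1) F(1)] triangulates_subset[OF L(1) G(1)] by simp_all
        then have "H \<in> ?S" unfolding S using H(2) by simp
        then show "z \<in> \<Union> ((hull) convex ` ?S)" using H(3) z(1) by (intro UN_I[of H]) simp_all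
      qed
    qed
  qed
qed


subsection \<open>The dual graph and the signature\<close>

lemma facetsD:
  assumes "F \<in> facets (K :: 'a::euclidean_space set set)"
  shows "F \<in> K" "card F = DIM('a) + 1" "finite F" "F \<noteq> {}"
  using assms by (auto simp: facets_def intro: card_ge_0_finite)

lemma triangulates_card_le:
  fixes K :: "'a::euclidean_space set set"
  assumes "triangulates K P" "F \<in> K"
  shows "card F \<le> DIM('a) + 1"
proof -
  have "aff_dim F = int (card F) - 1"
    using triangulates_affine_independent[OF assms] by (simp add: aff_dim_affine_independent)
  then show ?thesis using aff_dim_le_DIM[of F] by linarith
qed

lemma interior_facet:
  fixes K :: "'a::euclidean_space set set"
  assumes "triangulates K P" "F \<in> facets K"
  shows "interior (convex hull F) \<noteq> {}"
proof -
  note F = facetsD[OF assms(2)]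
  have "aff_dim F = int (card F) - 1"
    using triangulates_affine_independent[OF assms(1) F(1)] by (simp add: aff_dim_affine_independent)
  then have "aff_dim (convex hull F) = DIM('a)" using F(2) by (simp add: aff_dim_convex_hull)
  then have "interior (convex hull F) = rel_interior (convex hull F)"
    by (simp add: interior_rel_interior_gen)
  then show ?thesis using F(4) by (simp add: rel_interior_eq_empty)
qed

lemma negligible_affine_hull_card:
  fixes R :: "'a::euclidean_space set"
  assumes "finite R" "card R \<le> DIM('a)"
  shows "negligible (affine hull R)"
proof -
  have "aff_dim (affine hull R) < DIM('a)"
    using aff_dim_le_card[OF assms(1)] assms(2) by simp
  then have "interior (affine hull R) = {}" using aff_dim_nonempty_interior by fastforce
  then show ?thesis using negligible_convex_interior[OF convex_affine_hull] by blast
qed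

lemma negligible_convex_hull_card:
  fixes R :: "'a::euclidean_space set"
  assumes "finite R" "card R \<le> DIM('a)"
  shows "negligible (convex hull R)"
  using negligible_affine_hull_card[OF assms] convex_hull_subset_affine_hull negligible_subset by blast

text \<open>The simplices of lower dimension form a negligible set. The part of the interior of
  \<open>P\<close> missed by the facets is open and contained in it, hence empty; the facets form a
  closed set, so taking closures gives all of \<open>P\<close>.\<close>

lemma facets_cover:
  fixes K :: "'a::euclidean_space set set"
  assumes K: "triangulates K P" and P: "convex P" "interior P \<noteq> {}"
  shows "P \<subseteq> \<Union>((hull) convex ` facets K)"
proof -
  let ?U = "\<Union>((hull) convex ` facets K)" and ?N = "\<Union>((hull) convex ` (K - facets K))"
  have fin: "finite K" using K triangulates_finite by blast
  have "negligible ?N"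
  proof (rule negligible_Union)
    fix S assume "S \<in> (hull) convex ` (K - facets K)"
    then obtain F where F: "F \<in> K" "F \<notin> facets K" "S = convex hull F" by blast
    then have "card F \<le> DIM('a)"
      using triangulates_card_le[OF K F(1)] by (simp add: facets_def)
    then show "negligible S"
      using F negligible_convex_hull_card triangulates_finite_face[OF K] by blast
  qed (use fin in simp)
  have "closed ?U"
    using fin facetsD by (intro closed_Union) (auto simp: facets_def compact_imp_closed
        finite_imp_compact_convex_hull triangulates_finite_face[OF K])
  have "P = ?U \<union> ?N" using K unfolding triangulates_def facets_def by blast
  then have "interior P - ?U \<subseteq> ?N" using interior_subset[of P] by blast
  then have "negligible (interior P - ?U)" using \<open>negligible ?N\<close> negligible_subset by blast
  moreover have "open (interior P - ?U)" using \<open>closed ?U\<close> by (simp add: open_Diff)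
  ultimately have "interior P \<subseteq> ?U" using open_not_negligible by blast
  then have "closure (interior P) \<subseteq> ?U" using \<open>closed ?U\<close> closure_minimal by blast
  then show ?thesis using convex_closure_interior[OF P] closure_subset by blast
qed

text \<open>A generic segment between two facets avoids the faces of codimension two, so that
  it can only change facets through a common face of codimension one.\<close>

lemma dual_graph_connected:
  fixes K :: "'a::euclidean_space set set"
  assumes K: "triangulates K P" and P: "convex P" "interior P \<noteq> {}"
    and C: "C \<subseteq> facets K" "\<And>F G. F \<in> C \<Longrightarrow> dual_adjacent K F G \<Longrightarrow> G \<in> C" "C \<noteq> {}"
  shows "C = facets K"
proof (rule ccontr)
  assume "C \<noteq> facets K"
  then obtain F0 G0 where F0: "F0 \<in> C" and G0: "G0 \<in> facets K" "G0 \<notin> C" using C by blast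
  \<comment> \<open>Fewer than \<open>DIM('a)\<close> vertices means codimension at least two, so
    such a face still spans a negligible affine set after one more point is added.\<close>
  define LL where "LL = {R \<in> K. card R < DIM('a)}"
  have finK: "finite K" using triangulates_finite[OF K] .
  then have finLL: "finite LL" by (simp add: LL_def)
  have finF: "finite F" if "F \<in> K" for F using triangulates_finite_face[OF K that] .
  let ?N = "\<Union>((hull) convex ` LL)"
  have "negligible ?N"
    by (rule negligible_Union) (use finLL in \<open>auto simp: LL_def finF intro!: negligible_convex_hull_card\<close>)
  have "interior (convex hull F0) \<noteq> {}" using interior_facet[OF K] F0 C(1) by blast
  then have "\<not> interior (convex hull F0) \<subseteq> ?N"
    using open_not_negligible[OF open_interior] negligible_subset[OF \<open>negligible ?N\<close>] by blast
  then obtain x where x: "x \<in> interior (convex hull F0)" "x \<notin> ?N" by blast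
  \<comment> \<open>If the segment met the hull of such an \<open>R\<close> at a point other than
    \<open>x\<close>, then \<open>y\<close> would lie on the line through \<open>x\<close> and that
    point, hence in this affine hull. Choosing \<open>y\<close> outside all of them keeps the
    segment clear.\<close>
  let ?M = "\<Union>((\<lambda>R. affine hull (insert x R)) ` LL)"
  have "negligible ?M"
  proof (rule negligible_Union)
    fix S assume "S \<in> (\<lambda>R. affine hull (insert x R)) ` LL"
    then obtain R where R: "R \<in> LL" "S = affine hull (insert x R)" by blast
    then have "finite (insert x R)" "card (insert x R) \<le> DIM('a)"
      using finF by (auto simp: LL_def card_insert_if)
    then show "negligible S" unfolding R(2) by (rule negligible_affine_hull_card)
  qed (use finLL in simp)
  have "interior (convex hull G0) \<noteq> {}" using interior_facet[OF K] G0 by blast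
  then have "\<not> interior (convex hull G0) \<subseteq> ?M"
    using open_not_negligible[OF open_interior] negligible_subset[OF \<open>negligible ?M\<close>] by blast
  then obtain y where y: "y \<in> interior (convex hull G0)" "y \<notin> ?M" by blast
  have xy: "x \<in> convex hull F0" "y \<in> convex hull G0" using x y interior_subset by blast+
  have avoid: "z \<notin> ?N" if "z \<in> closed_segment x y" for z
  proof
    assume "z \<in> ?N"
    then obtain R where R: "R \<in> LL" "z \<in> convex hull R" by blast
    then have "z \<noteq> x" using x by blast
    moreover obtain t where t1: "z = (1 - t) *\<^sub>R x + t *\<^sub>R y"
      using \<open>z \<in> closed_segment x y\<close> by (auto simp: closed_segment_def)
    ultimately have "t \<noteq> 0" by auto
    note t = t1 this
    have "y = (1 - 1 / t) *\<^sub>R x + (1 / t) *\<^sub>R z"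
    proof -
      have "(1 / t) *\<^sub>R z = (1 / t - 1) *\<^sub>R x + y"
        using t(2) by (simp add: t(1) scaleR_add_right diff_divide_distrib)
      then show ?thesis by (simp add: algebra_simps)
    qed
    moreover have "z \<in> affine hull (insert x R)"
      using R(2) convex_hull_subset_affine_hull hull_mono[of R "insert x R" affine] by blast
    moreover have "x \<in> affine hull (insert x R)" by (simp add: hull_inc)
    ultimately have "y \<in> affine hull (insert x R)"
      using mem_affine[OF affine_affine_hull, of x "insert x R" z "1 - 1 / t" "1 / t"] by simp
    then show False using y R by blast
  qed
  let ?A = "\<Union>((hull) convex ` C)" and ?B = "\<Union>((hull) convex ` (facets K - C))"
  have sub: "F \<in> K" if "F \<in> facets K" for F using that by (simp add: facets_def)
  have clo: "closed (\<Union>((hull) convex ` D))" if "D \<subseteq> facets K" for D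
  proof (rule closed_Union)
    show "finite ((hull) convex ` D)" using that finK by (meson finite_imageI finite_subset sub subsetI)
    show "\<forall>S\<in>(hull) convex ` D. closed S"
      using that sub finF by (auto intro!: compact_imp_closed finite_imp_compact_convex_hull)
  qed
  have "closed ?A" "closed ?B" using clo C(1) by auto
  have "x \<in> P" "y \<in> P"
    using xy triangulates_hull_subset[OF K] sub F0 C(1) G0 by blast+
  then have "closed_segment x y \<subseteq> P" using P(1) by (simp add: closed_segment_subset)
  also have "P \<subseteq> ?A \<union> ?B" using facets_cover[OF K P] C(1) by blast
  finally have cov: "closed_segment x y \<subseteq> ?A \<union> ?B" .
  \<comment> \<open>The segment is connected and covered by two closed sets that both meet it, so
    some point of it lies in a facet of \<open>C\<close> and also in a facet outside
    \<open>C\<close>.\<close>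
  have "x \<in> ?A \<inter> closed_segment x y" "y \<in> ?B \<inter> closed_segment x y" using xy F0 G0 by auto
  then have "?A \<inter> ?B \<inter> closed_segment x y \<noteq> {}"
    using connected_segment[of x y] cov \<open>closed ?A\<close> \<open>closed ?B\<close>
    unfolding connected_closed by blast
  then obtain z F G where z: "z \<in> closed_segment x y" "F \<in> C" "z \<in> convex hull F"
    "G \<in> facets K" "G \<notin> C" "z \<in> convex hull G" by blast
  have FK: "F \<in> facets K" using z C by blast
  have "z \<in> convex hull (F \<inter> G)" using triangulates_Int[OF K] z sub FK by blast
  moreover have FGK: "F \<inter> G \<in> K" using triangulates_subset[OF K sub[OF FK], of "F \<inter> G"] by blast
  ultimately have "\<not> card (F \<inter> G) < DIM('a)" using avoid[OF z(1)] by (auto simp: LL_def)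
  moreover have "F \<inter> G \<subset> F"
  proof -
    have "F \<noteq> G" using z by blast
    moreover have "card F = card G" "finite G" using FK z facetsD by metis+
    ultimately show ?thesis by (metis card_subset_eq inf.cobounded2 inf.cobounded1 inf.orderE psubsetI)
  qed
  then have "card (F \<inter> G) < DIM('a) + 1" using facetsD[OF FK] by (metis psubset_card_mono)
  ultimately have "card (F \<inter> G) = DIM('a)" by linarith
  then have "dual_adjacent K F G"
    using FK z FGK unfolding dual_adjacent_def by blast
  then show False using C(2) z by blast
qed

text \<open>An alternating sign function exhibits one black class; by connectedness the only other
  one is its complement, and the absolute value does not see the exchange. Hence any alternating
  sign may be used to compute the signature.\<close>

lemma signature_eq:
  fixes K :: "'a::euclidean_space set set" and s :: "'a set \<Rightarrow> int"
  assumes K: "triangulates K P" and P: "convex P" "interior P \<noteq> {}"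
    and s: "\<And>F. F \<in> facets K \<Longrightarrow> s F = 1 \<or> s F = -1"
      "\<And>F G. dual_adjacent K F G \<Longrightarrow> s G = - s F"
  shows "signature K = \<bar>\<Sum>F\<in>facets K. if odd_simplex F then s F else 0\<bar>"
proof -
  define B0 where "B0 = {F \<in> facets K. s F = 1}"
  have fin: "finite (facets K)" using triangulates_finite[OF K] by (simp add: facets_def)
  let ?val = "\<lambda>B. \<bar>int (card {F \<in> B. odd_simplex F}) - int (card {F \<in> facets K - B. odd_simplex F})\<bar>"
  have adj: "F \<in> facets K \<and> G \<in> facets K" if "dual_adjacent K F G" for F G
    using that by (simp add: dual_adjacent_def)
  have black0: "black_class K B0"
    unfolding black_class_def
  proof (intro conjI allI impI)
    fix F G assume "dual_adjacent K F G"
    then show "F \<in> B0 \<longleftrightarrow> G \<notin> B0"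
      using adj[of F G] s(1)[of F] s(2)[of F G] by (auto simp: B0_def)
  qed (auto simp: B0_def)
  have uniq: "B = B0 \<or> B = facets K - B0" if "black_class K B" for B
  proof -
    \<comment> \<open>The facets on which the two classes agree are closed under adjacency, so they
      are none or all.\<close>
    define C where "C = {F \<in> facets K. F \<in> B \<longleftrightarrow> F \<in> B0}"
    have "G \<in> C" if "F \<in> C" "dual_adjacent K F G" for F G
      using that \<open>black_class K B\<close> black0 adj[of F G] unfolding black_class_def C_def by blast
    moreover have "C \<subseteq> facets K" by (auto simp: C_def)
    ultimately have "C = {} \<or> C = facets K" using dual_graph_connected[OF K P] by blast
    moreover have "B \<subseteq> facets K" "B0 \<subseteq> facets K" using that black0 by (auto simp: black_class_def)
    ultimately show ?thesis unfolding C_def by blast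
  qed
  have val: "?val B = ?val B0" if "black_class K B" for B
  proof -
    have eq: "facets K - (facets K - B0) = B0" by (auto simp: B0_def)
    have "?val (facets K - B0) = ?val B0" unfolding eq by (rule abs_minus_commute)
    then show ?thesis using uniq[OF that] by (elim disjE) simp_all
  qed
  have "signature K = ?val B0"
    unfolding signature_def
  proof (rule the_equality)
    show "\<exists>B. black_class K B \<and> ?val B0 = ?val B" using black0 by (intro exI[of _ B0] conjI refl)
    show "s = ?val B0" if "\<exists>B. black_class K B \<and> s = ?val B" for s using that val by (elim exE conjE) simp
  qed
  also have "int (card {F \<in> B0. odd_simplex F}) - int (card {F \<in> facets K - B0. odd_simplex F}) =
      (\<Sum>F\<in>facets K. if odd_simplex F then s F else 0)"
  proof -
    have "(\<Sum>F\<in>facets K. if odd_simplex F then s F else 0) =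
      (\<Sum>F\<in>facets K. (if F \<in> B0 \<and> odd_simplex F then 1 else 0) - (if F \<notin> B0 \<and> odd_simplex F then 1 else 0))"
      using s(1) by (intro sum.cong) (auto simp: B0_def)
    also have "\<dots> = int (card {F \<in> facets K. F \<in> B0 \<and> odd_simplex F}) - int (card {F \<in> facets K. F \<notin> B0 \<and> odd_simplex F})"
      unfolding sum_subtractf using fin by (simp add: sum.If_cases Int_def)
    also have "{F \<in> facets K. F \<in> B0 \<and> odd_simplex F} = {F \<in> B0. odd_simplex F}"
      by (auto simp: B0_def)
    also have "{F \<in> facets K. F \<notin> B0 \<and> odd_simplex F} = {F \<in> facets K - B0. odd_simplex F}" by auto
    finally show ?thesis by simp
  qed
  finally show ?thesis .
qed


subsection \<open>Determinants of endomorphisms of Euclidean spaces\<close>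

text \<open>The determinant and its volume formula in the library are restricted to matrices indexed
  by well-ordered finite types, so the standard basis is turned into such a type.\<close>

typedef (overloaded) ('a::euclidean_space) basis_index = "Basis :: 'a set"
  morphisms basis_vec Abs_basis_index
  using nonempty_Basis by blast

lemma range_basis_vec: "range (basis_vec :: 'a basis_index \<Rightarrow> 'a::euclidean_space) = Basis"
  using type_definition.Rep_range[OF type_definition_basis_index] .

lemma basis_vec_in_Basis [simp]: "basis_vec i \<in> Basis"
  using basis_vec by blast

lemma inj_basis_vec: "inj basis_vec"
  by (simp add: basis_vec_inject inj_on_def)

lemma basis_vec_inner: "basis_vec i \<bullet> basis_vec j = (if i = j then 1 else 0)"
  by (simp add: inner_Basis basis_vec_inject)

lemma sum_Basis_index: "sum f Basis = (\<Sum>i\<in>UNIV. f (basis_vec i))"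
  by (simp add: range_basis_vec[symmetric] sum.reindex[OF inj_basis_vec])

lemma prod_Basis_index: "prod f Basis = (\<Prod>i\<in>UNIV. f (basis_vec i))"
  by (simp add: range_basis_vec[symmetric] prod.reindex[OF inj_basis_vec])

instance basis_index :: (euclidean_space) finite
proof
  have "finite (range (basis_vec :: 'a basis_index \<Rightarrow> 'a))" by (simp add: range_basis_vec)
  then show "finite (UNIV :: 'a basis_index set)" using inj_basis_vec finite_imageD by blast
qed

text \<open>An arbitrary enumeration of the basis; it supplies the well-order on the index
  type.\<close>

definition basis_rank :: "'a::euclidean_space basis_index \<Rightarrow> nat" where
  "basis_rank = (SOME f. inj f)"

lemma inj_basis_rank: "inj (basis_rank :: 'a::euclidean_space basis_index \<Rightarrow> nat)"
proof -
  have "\<exists>f :: 'a basis_index \<Rightarrow> nat. inj f" using finite_imp_inj_to_nat_seg[of "UNIV :: 'a basis_index set"] by auto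
  then show ?thesis unfolding basis_rank_def by (rule someI_ex)
qed

instantiation basis_index :: (euclidean_space) wellorder
begin

definition less_eq_basis_index :: "'a basis_index \<Rightarrow> 'a basis_index \<Rightarrow> bool" where
  "less_eq_basis_index i j \<longleftrightarrow> basis_rank i \<le> basis_rank j"

definition less_basis_index :: "'a basis_index \<Rightarrow> 'a basis_index \<Rightarrow> bool" where
  "less_basis_index i j \<longleftrightarrow> basis_rank i < basis_rank j"

instance
proof
  fix P :: "'a basis_index \<Rightarrow> bool" and i :: "'a basis_index"
  assume step: "\<And>i. (\<And>j. j < i \<Longrightarrow> P j) \<Longrightarrow> P i"
  show "P i"
  proof (induction "basis_rank i" arbitrary: i rule: less_induct)
    case less
    show ?case by (rule step, rule less) (simp add: less_basis_index_def)
  qed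
qed (auto simp: less_eq_basis_index_def less_basis_index_def dest: injD[OF inj_basis_rank])

end

section \<open>Coordinates and Lebesgue measure\<close>

definition from_coords :: "real ^ ('a::euclidean_space) basis_index \<Rightarrow> 'a" where
  "from_coords x = (\<Sum>i\<in>UNIV. x $ i *\<^sub>R basis_vec i)"

definition to_coords :: "'a::euclidean_space \<Rightarrow> real ^ 'a basis_index" where
  "to_coords x = (\<chi> i. x \<bullet> basis_vec i)"

lemma from_coords_inner: "from_coords x \<bullet> basis_vec i = x $ i"
proof -
  have "from_coords x \<bullet> basis_vec i = (\<Sum>j\<in>UNIV. if j = i then x $ i else 0)"
    unfolding from_coords_def inner_sum_left by (intro sum.cong) (auto simp: basis_vec_inner)
  then show ?thesis by simp
qed

lemma to_from_coords [simp]: "to_coords (from_coords x) = x"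
  by (simp add: to_coords_def from_coords_inner vec_eq_iff)

lemma from_to_coords [simp]: "from_coords (to_coords x) = x"
  using sum_Basis_index[of "\<lambda>b. (x \<bullet> b) *\<^sub>R b"]
  by (simp add: to_coords_def from_coords_def euclidean_representation)

lemma linear_from_coords: "linear from_coords"
  by (rule linearI) (simp_all add: from_coords_def scaleR_add_left sum.distrib scaleR_sum_right)

lemma linear_to_coords: "linear to_coords"
  by (rule linearI) (simp_all add: to_coords_def vec_eq_iff inner_add_left)

lemma linear_conjugate_coords:
  assumes "linear f"
  shows "linear (\<lambda>x. to_coords (f (from_coords x)))"
  using linear_compose[OF linear_compose[OF linear_from_coords assms] linear_to_coords]
  by (simp add: o_def)

lemma from_coords_axis: "from_coords (axis i 1) = basis_vec i"
proof -
  have "from_coords (axis i 1) = (\<Sum>j\<in>UNIV. if j = i then basis_vec i else 0)"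
    unfolding from_coords_def by (intro sum.cong) (auto simp: axis_def)
  then show ?thesis by simp
qed

text \<open>Lebesgue measure is determined by its values on boxes, and a coordinate change between
  orthonormal bases, indexed accordingly, takes boxes to boxes with the same side lengths.\<close>

lemma lborel_from_coords:
  "lborel = distr lborel borel (from_coords :: _ \<Rightarrow> 'a::euclidean_space)"
proof (rule lborel_eqI)
  fix l u :: 'a assume le: "\<And>b. b \<in> Basis \<Longrightarrow> l \<bullet> b \<le> u \<bullet> b"
  have meas: "(from_coords :: _ \<Rightarrow> 'a) \<in> borel_measurable borel"
    using linear_from_coords by (intro borel_measurable_continuous_onI linear_continuous_on) (simp add: linear_conv_bounded_linear)
  have mem: "from_coords x \<in> box l u \<longleftrightarrow> x \<in> box (to_coords l) (to_coords u)" for x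
  proof -
    have "from_coords x \<in> box l u \<longleftrightarrow> (\<forall>i. l \<bullet> basis_vec i < x $ i \<and> x $ i < u \<bullet> basis_vec i)"
      unfolding mem_box using range_basis_vec[where 'a = 'a] from_coords_inner[of x] by (metis rangeE rangeI)
    then show ?thesis by (simp add: mem_box_cart to_coords_def)
  qed
  have "emeasure (distr lborel borel from_coords) (box l u) = emeasure lborel (from_coords -` box l u)"
    using meas by (subst emeasure_distr) auto
  also have "from_coords -` box l u = box (to_coords l) (to_coords u)" using mem by auto
  also have "emeasure lborel \<dots> = (\<Prod>b\<in>Basis. (to_coords u - to_coords l) \<bullet> b)"
    using le by (intro emeasure_lborel_box) (auto simp: Basis_vec_def inner_axis to_coords_def)
  also have "(\<Prod>b\<in>Basis. (to_coords u - to_coords l) \<bullet> b) = (\<Prod>i\<in>UNIV. (to_coords u - to_coords l) $ i)"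
  proof -
    have "Basis = range (\<lambda>i. axis i (1::real) :: real ^ 'a basis_index)" by (auto simp: Basis_vec_def)
    moreover have "inj (\<lambda>i. axis i (1::real) :: real ^ 'a basis_index)"
      by (auto simp: inj_on_def axis_eq_axis)
    ultimately show ?thesis by (metis (no_types, lifting) cart_eq_inner_axis prod.reindex_cong)
  qed
  also have "\<dots> = (\<Prod>b\<in>Basis. (u - l) \<bullet> b)"
    by (simp add: prod_Basis_index to_coords_def inner_diff_left)
  finally show "emeasure (distr lborel borel from_coords) (box l u) = (\<Prod>b\<in>Basis. (u - l) \<bullet> b)" .
qed simp

lemma measure_to_coords:
  assumes "compact (S :: 'a::euclidean_space set)"
  shows "measure lborel (to_coords ` S) = measure lborel S"
proof -
  have meas: "(from_coords :: _ \<Rightarrow> 'a) \<in> borel_measurable borel"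
    using linear_from_coords by (intro borel_measurable_continuous_onI linear_continuous_on) (simp add: linear_conv_bounded_linear)
  have "measure lborel S = measure (distr lborel borel from_coords) S"
    by (subst lborel_from_coords) simp
  also have "\<dots> = measure lborel (from_coords -` S)"
    using meas assms by (subst measure_distr) (auto intro: borel_compact)
  also have "from_coords -` S = to_coords ` S"
    by (auto simp: image_iff) (metis to_from_coords)
  finally show ?thesis by simp
qed

definition edet :: "('a::euclidean_space \<Rightarrow> 'a) \<Rightarrow> real" where
  "edet f = det (\<chi> i j. f (basis_vec j) \<bullet> basis_vec i)"

lemma edet_matrix: "edet f = det (matrix (\<lambda>x. to_coords (f (from_coords x))))"
  by (simp add: edet_def matrix_def from_coords_axis to_coords_def)

lemma edet_cong: "(\<And>b. b \<in> Basis \<Longrightarrow> f b = g b) \<Longrightarrow> edet f = edet g"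
  by (simp add: edet_def)

lemma edet_id: "edet (\<lambda>x. x) = 1"
proof -
  have "(\<chi> i j. basis_vec j \<bullet> basis_vec i) = (mat 1 :: real ^ 'a basis_index ^ 'a basis_index)"
    by (simp add: vec_eq_iff mat_def basis_vec_inner)
  then show ?thesis by (simp add: edet_def)
qed

lemma edet_compose:
  assumes "linear f" "linear g"
  shows "edet (\<lambda>x. f (g x)) = edet f * edet g"
proof -
  let ?f = "\<lambda>x. to_coords (f (from_coords x))" and ?g = "\<lambda>x. to_coords (g (from_coords x))"
  have "linear ?f" "linear ?g"
    using assms by (simp_all add: linear_conjugate_coords)
  then have "matrix (?f \<circ> ?g) = matrix ?f ** matrix ?g" by (intro matrix_compose)
  then show ?thesis by (simp add: edet_matrix o_def det_mul)
qed

lemma measure_linear_image_edet: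
  assumes "linear f" "compact (S :: 'a::euclidean_space set)"
  shows "measure lborel (f ` S) = \<bar>edet f\<bar> * measure lborel S"
proof -
  let ?f = "\<lambda>x. to_coords (f (from_coords x))"
  have lin: "linear ?f"
    using assms(1) by (rule linear_conjugate_coords)
  have comp: "compact (f ` S)" "compact (to_coords ` S)" "compact (to_coords ` f ` S)"
    using assms linear_to_coords
    by (auto intro!: compact_continuous_image linear_continuous_on simp: linear_conv_bounded_linear)
  have leb: "measure lborel A = measure lebesgue A" if "compact A" for A :: "(real ^ 'a basis_index) set"
    using that by (subst measure_completion) (auto intro: borel_compact)
  have "measure lborel (f ` S) = measure lborel (to_coords ` f ` S)"
    by (rule measure_to_coords[symmetric]) fact
  also have "to_coords ` f ` S = ?f ` to_coords ` S" by (simp add: image_image)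
  also have "measure lborel \<dots> = measure lebesgue \<dots>"
    using comp(3) by (intro leb) (simp add: image_image)
  also have "\<dots> = \<bar>det (matrix ?f)\<bar> * measure lebesgue (to_coords ` S)"
    using comp(2) lin
    by (intro measure_lebesgue_linear_transformation) (auto intro: compact_imp_bounded lmeasurable_compact[THEN fmeasurableD])
  also have "\<dots> = \<bar>edet f\<bar> * measure lborel S"
    using comp(2) assms by (simp add: edet_matrix leb[symmetric] measure_to_coords)
  finally show ?thesis .
qed

text \<open>A column operation: the new column is \<open>t\<close> times the old one plus a
  combination of the remaining columns. It is the algebra behind passing from a facet to an adjacent
  one.\<close>

lemma edet_replace:
  fixes f g :: "'a::euclidean_space \<Rightarrow> 'a"
  assumes b0: "b0 \<in> Basis" "f b0 = t *\<^sub>R g b0 + (\<Sum>b\<in>Basis - {b0}. a b *\<^sub>R g b)"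
    and eq: "\<And>b. b \<in> Basis \<Longrightarrow> b \<noteq> b0 \<Longrightarrow> f b = g b"
  shows "edet f = t * edet g"
proof -
  obtain k where k: "b0 = basis_vec k" by (rule basis_vec_cases[OF b0(1)])
  define R where "R j = to_coords (g (basis_vec j))" for j
  define x where "x = to_coords (\<Sum>b\<in>Basis - {b0}. a b *\<^sub>R g b)"
  define A where "A = (\<chi> j. if j = k then t *s R k else R j)"
  \<comment> \<open>After transposition the images of the basis vectors are rows, the form in which
    \<open>det_row_span\<close> and \<open>det_row_mul\<close> apply.\<close>
  have T: "edet h = det (\<chi> j. to_coords (h (basis_vec j)))" for h :: "'a \<Rightarrow> 'a"
    unfolding edet_def by (subst det_transpose[symmetric]) (simp add: transpose_def to_coords_def)
  have "x \<in> vec.span {row j A |j. j \<noteq> k}"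
  proof -
    have x: "x = (\<Sum>b\<in>Basis - {b0}. a b *s to_coords (g b))"
      unfolding x_def
      by (simp add: linear_sum[OF linear_to_coords] linear_cmul[OF linear_to_coords] scalar_mult_eq_scaleR)
    have "to_coords (g b) \<in> {row j A |j. j \<noteq> k}" if "b \<in> Basis - {b0}" for b
    proof -
      have "b \<in> Basis" using that by blast
      then obtain j where j: "b = basis_vec j" by (rule basis_vec_cases)
      then have "j \<noteq> k" using that k by auto
      then have "row j A = to_coords (g b)" by (simp add: A_def row_def R_def j vec_lambda_eta)
      then show ?thesis using \<open>j \<noteq> k\<close> by (intro CollectI exI[of _ j]) simp
    qed
    then show ?thesis unfolding x by (intro vec.span_sum vec.span_scale vec.span_base)
  qed
  then have "det (\<chi> j. if j = k then row k A + x else row j A) = det A" by (rule det_row_span)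
  moreover have "(\<chi> j. if j = k then row k A + x else row j A) = (\<chi> j. to_coords (f (basis_vec j)))"
  proof -
    have "to_coords (f b0) = t *s R k + x"
      unfolding b0(2) R_def x_def k[symmetric]
      by (simp add: linear_add[OF linear_to_coords] linear_cmul[OF linear_to_coords] scalar_mult_eq_scaleR)
    moreover have "to_coords (f (basis_vec j)) = R j" if "j \<noteq> k" for j
      using eq[of "basis_vec j"] that k by (simp add: R_def basis_vec_inject)
    ultimately show ?thesis
      by (simp add: vec_eq_iff row_def A_def k)
  qed
  moreover have "det A = t * det (\<chi> j. R j)"
  proof -
    have "det A = t * det (\<chi> j. if j = k then R j else R j)"
      unfolding A_def using det_row_mul[of k t R R] by (simp cong: if_cong)
    then show ?thesis by simp
  qed
  ultimately show ?thesis unfolding T R_def by simp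
qed

section \<open>Spanned lattices and normalized volume\<close>

definition linear_of :: "('a::euclidean_space \<Rightarrow> 'b::real_vector) \<Rightarrow> 'a \<Rightarrow> 'b" where
  "linear_of g x = (\<Sum>b\<in>Basis. (x \<bullet> b) *\<^sub>R g b)"

lemma linear_linear_of: "linear (linear_of g)"
  by (rule linearI) (simp_all only: linear_of_def inner_add_left inner_scaleR_left scaleR_add_left
      sum.distrib scaleR_sum_right scaleR_scaleR)

lemma linear_of_Basis:
  assumes b: "b \<in> Basis"
  shows "linear_of g b = g b"
proof -
  have "linear_of g b = (\<Sum>b'\<in>Basis. if b' = b then g b else 0)"
    unfolding linear_of_def using b by (intro sum.cong) (auto simp: inner_Basis)
  then show ?thesis using b by simp
qed

lemma edet_Ints:
  assumes "\<And>b. b \<in> Basis \<Longrightarrow> f b \<in> integer_points"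
  shows "edet f \<in> \<int>"
  unfolding edet_def det_def using assms
  by (auto simp: integer_points_def intro!: Ints_sum Ints_mult Ints_prod)

text \<open>If the columns of \<open>T\<close> lie in the lattice spanned by the columns of
  \<open>U\<close>, then on the basis \<open>T\<close> is \<open>U\<close> composed with an integer
  matrix, whose determinant is the factor \<open>k\<close>.\<close>

lemma edet_lattice_dvd:
  assumes "linear U" "\<forall>b\<in>Basis. \<exists>z\<in>integer_points. T b = U z"
  obtains k :: int where "edet T = edet U * of_int k"
proof -
  obtain z where z: "\<And>b. b \<in> Basis \<Longrightarrow> z b \<in> integer_points" "\<And>b. b \<in> Basis \<Longrightarrow> T b = U (z b)"
    using assms(2) by metis
  have "edet T = edet (\<lambda>x. U (linear_of z x))"
    by (rule edet_cong) (simp add: linear_of_Basis z)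
  also have "\<dots> = edet U * edet (linear_of z)"
    using edet_compose[OF assms(1) linear_linear_of] .
  finally have "edet T = edet U * edet (linear_of z)" .
  moreover have "edet (linear_of z) \<in> \<int>" by (rule edet_Ints) (simp add: linear_of_Basis z)
  ultimately show ?thesis using that by (metis Ints_cases)
qed

text \<open>When both maps span the same lattice, the two integer quotients of the determinants are
  inverse to each other, hence units.\<close>

lemma edet_lattice_eq:
  assumes "linear T" "linear U"
    and "\<forall>b\<in>Basis. \<exists>z\<in>integer_points. T b = U z"
    and "\<forall>b\<in>Basis. \<exists>z\<in>integer_points. U b = T z"
  shows "\<bar>edet T\<bar> = \<bar>edet U\<bar>"
proof -
  obtain k where k: "edet T = edet U * of_int k"
    by (rule edet_lattice_dvd[OF assms(2,3)])
  obtain l where l: "edet U = edet T * of_int l"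
    by (rule edet_lattice_dvd[OF assms(1,4)])
  show ?thesis
  proof (cases "edet T = 0")
    case False
    have "edet T = edet T * (of_int l * of_int k)" using k l by simp
    then have "of_int (l * k) = (1::real)" using False by simp
    then have "l * k = 1" using of_int_eq_1_iff by blast
    then have "k = 1 \<or> k = -1" unfolding zmult_eq_1_iff by blast
    then show ?thesis using k by auto
  qed (use l in simp)
qed

text \<open>The simplex is a translate of the image under \<open>T\<close> of the standard simplex,
  whose volume is the reciprocal of the factorial. \<open>T\<close> is described by the set of its
  columns only, since the lattice they span is what matters afterwards.\<close>

lemma normalized_volume_edet:
  fixes F :: "'a::euclidean_space set"
  assumes "card F = DIM('a) + 1" "v0 \<in> F"
  obtains T where "linear T" "T ` Basis = (\<lambda>v. v - v0) ` (F - {v0})" "normalized_volume F = \<bar>edet T\<bar>"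
proof -
  have fin: "finite F" using assms by (simp add: card_ge_0_finite)
  have "card (F - {v0}) = card (Basis :: 'a set)" using assms by simp
  then obtain g where g: "bij_betw g (Basis :: 'a set) (F - {v0})"
    using finite_same_card_bij[of "Basis :: 'a set" "F - {v0}"] fin by auto
  define T where "T = linear_of (\<lambda>b. g b - v0)"
  have lin: "linear T" unfolding T_def by (rule linear_linear_of)
  have img: "T ` Basis = (\<lambda>v. v - v0) ` (F - {v0})"
    unfolding bij_betw_imp_surj_on[OF g, symmetric] by (simp add: T_def linear_of_Basis image_image)
  have "F = (+) v0 ` insert 0 (T ` Basis)"
    unfolding img using assms(2) by (auto simp: image_iff)
  also have "insert 0 (T ` Basis) = T ` insert 0 Basis"
    using linear_0[OF lin] by simp
  finally have "convex hull F = (+) v0 ` T ` (convex hull (insert 0 Basis))"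
    by (simp only: convex_hull_translation convex_hull_linear_image[OF lin])
  moreover have comp: "compact (convex hull (insert 0 Basis :: 'a set))"
    by (simp add: finite_imp_compact_convex_hull)
  have "compact (T ` (convex hull (insert 0 Basis)))"
    using comp lin by (intro compact_continuous_image linear_continuous_on) (simp_all add: linear_conv_bounded_linear)
  moreover have "compact (convex hull F)" using fin by (simp add: finite_imp_compact_convex_hull)
  ultimately have "measure lborel (convex hull F) = measure lborel (T ` (convex hull (insert 0 Basis)))"
    by (metis borel_compact measure_completion measure_translation sets_lborel)
  also have "\<dots> = \<bar>edet T\<bar> / fact DIM('a)"
    using measure_linear_image_edet[OF lin comp] by (simp add: content_std_simplex)
  finally have "normalized_volume F = \<bar>edet T\<bar>" by (simp add: normalized_volume_def)
  then show ?thesis using that lin img by blast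
qed

lemma difference_image:
  assumes "T ` Basis = (\<lambda>v. v - v0) ` (F - {v0})" "b \<in> Basis"
  obtains v where "v \<in> F" "T b = v - v0"
proof -
  have "T b \<in> (\<lambda>v. v - v0) ` (F - {v0})" unfolding assms(1)[symmetric] using assms(2) by (rule imageI)
  then show ?thesis using that by auto
qed

lemma difference_preimage:
  fixes T :: "'a::euclidean_space \<Rightarrow> 'a"
  assumes "linear T" "T ` Basis = (\<lambda>v. v - v0) ` (F - {v0})" "v \<in> F"
  obtains z where "z \<in> integer_points" "v - v0 = T z"
proof (cases "v = v0")
  case True
  have "0 \<in> (integer_points :: 'a set)" by (simp add: integer_points_def)
  then show ?thesis using that[of 0] True linear_0[OF assms(1)] by simp
next
  case False
  have "v - v0 \<in> T ` Basis" unfolding assms(2) using assms(3) False by (intro imageI) simp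
  then obtain b where b: "b \<in> Basis" "v - v0 = T b" by (elim imageE)
  have "b \<in> integer_points" using b(1) by (auto simp: integer_points_def inner_Basis)
  then show ?thesis using that b(2) by simp
qed

lemma integer_points_diff: "x \<in> integer_points \<Longrightarrow> y \<in> integer_points \<Longrightarrow> x - y \<in> integer_points"
  by (simp add: integer_points_def inner_diff_left Ints_diff)

lemma normalized_volume_Nats:
  fixes F :: "'a::euclidean_space set"
  assumes "card F = DIM('a) + 1" "F \<subseteq> integer_points"
  shows "normalized_volume F \<in> \<nat>"
proof -
  obtain v0 where "v0 \<in> F" using assms(1) by (metis One_nat_def add_is_0 card.empty ex_in_conv nat.distinct(1))
  obtain T where T: "linear T" "T ` Basis = (\<lambda>v. v - v0) ` (F - {v0})" "normalized_volume F = \<bar>edet T\<bar>"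
    by (rule normalized_volume_edet[OF assms(1) \<open>v0 \<in> F\<close>])
  have "T b \<in> integer_points" if "b \<in> Basis" for b
  proof -
    obtain v where "v \<in> F" "T b = v - v0" using difference_image[OF T(2) \<open>b \<in> Basis\<close>] .
    then show ?thesis using assms(2) \<open>v0 \<in> F\<close> integer_points_diff[of v v0] by auto
  qed
  then have "edet T \<in> \<int>" by (rule edet_Ints)
  then show ?thesis unfolding T(3) by (simp add: Nats_altdef2)
qed

lemma measure_lborel_Times:
  fixes A :: "'a::euclidean_space set" and B :: "'b::euclidean_space set"
  assumes "compact A" "compact B"
  shows "measure lborel (A \<times> B) = measure lborel A * measure lborel B"
proof -
  have "emeasure lborel (A \<times> B) = emeasure lborel A * emeasure lborel B"
    using assms by (simp add: lborel.emeasure_pair_measure_Times borel_compact flip: lborel_prod)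
  then show ?thesis by (simp add: measure_def enn2real_mult)
qed

lemma linear_map_prod:
  assumes "linear f" "linear g" shows "linear (map_prod f g)"
  by (rule linearI) (auto simp: linear_add[OF assms(1)] linear_add[OF assms(2)]
      linear_cmul[OF assms(1)] linear_cmul[OF assms(2)])

text \<open>Both sides are the volume of the image of the unit cube, which is a product of the
  images of the two smaller cubes; this replaces the expansion of a block determinant.\<close>

lemma abs_edet_map_prod:
  fixes f :: "'a::euclidean_space \<Rightarrow> 'a" and g :: "'b::euclidean_space \<Rightarrow> 'b"
  assumes "linear f" "linear g"
  shows "\<bar>edet (map_prod f g)\<bar> = \<bar>edet f\<bar> * \<bar>edet g\<bar>"
proof -
  let ?A = "cbox 0 One :: 'a set" and ?B = "cbox 0 One :: 'b set"
  have lin: "linear (map_prod f g)"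
    using assms by (rule linear_map_prod)
  have "compact (f ` ?A)" "compact (g ` ?B)"
    using assms by (auto intro!: compact_continuous_image linear_continuous_on simp: linear_conv_bounded_linear)
  then have "measure lborel (f ` ?A \<times> g ` ?B) = \<bar>edet f\<bar> * \<bar>edet g\<bar>"
    using assms by (simp add: measure_lborel_Times measure_linear_image_edet)
  moreover have "f ` ?A \<times> g ` ?B = map_prod f g ` (?A \<times> ?B)"
    by (rule map_prod_surj_on[OF refl refl, symmetric])
  moreover have "measure lborel (map_prod f g ` (?A \<times> ?B)) = \<bar>edet (map_prod f g)\<bar>"
    using lin by (subst measure_linear_image_edet) (simp_all add: compact_Times measure_lborel_Times)
  ultimately show ?thesis by simp
qed

text \<open>Two consecutive elements of the chain differ in one coordinate only, so the lattice spanned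
  by its differences is the product of those of the factors.\<close>

lemma normalized_volume_chain:
  fixes H :: "('a::euclidean_space \<times> 'b::euclidean_space) set" and N :: "'a \<times> 'b \<Rightarrow> nat"
  assumes card: "card (fst ` H) = DIM('a) + 1" "card (snd ` H) = DIM('b) + 1"
      "card H = DIM('a) + DIM('b) + 1"
    and h0: "h0 \<in> H"
    and pred: "\<And>h. h \<in> H \<Longrightarrow> h \<noteq> h0 \<Longrightarrow> \<exists>h'\<in>H. N h' < N h \<and> (fst h' = fst h \<or> snd h' = snd h)"
  shows "normalized_volume H = normalized_volume (fst ` H) * normalized_volume (snd ` H)"
proof -
  obtain v0 w0 where vw: "h0 = (v0, w0)" by fastforce
  have v0: "v0 \<in> fst ` H" and w0: "w0 \<in> snd ` H" using h0 vw by force+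
  obtain S where S: "linear S" "S ` Basis = (\<lambda>v. v - v0) ` (fst ` H - {v0})"
    "normalized_volume (fst ` H) = \<bar>edet S\<bar>"
    by (rule normalized_volume_edet[OF card(1) v0])
  obtain T where T: "linear T" "T ` Basis = (\<lambda>v. v - w0) ` (snd ` H - {w0})"
    "normalized_volume (snd ` H) = \<bar>edet T\<bar>"
    by (rule normalized_volume_edet[OF card(2) w0])
  have cardH: "card H = DIM('a \<times> 'b) + 1" using card(3) by simp
  obtain R where R: "linear R" "R ` Basis = (\<lambda>v. v - h0) ` (H - {h0})"
    "normalized_volume H = \<bar>edet R\<bar>"
    by (rule normalized_volume_edet[OF cardH h0])
  let ?U = "map_prod S T"
  have lin: "linear ?U"
    using S(1) T(1) by (rule linear_map_prod)
  have "\<bar>edet R\<bar> = \<bar>edet ?U\<bar>"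
  proof (rule edet_lattice_eq[OF R(1) lin]; rule ballI)
    fix b :: "'a \<times> 'b" assume "b \<in> Basis"
    then obtain h where h: "h \<in> H" "R b = h - h0" by (rule difference_image[OF R(2)])
    obtain z1 where z1: "z1 \<in> integer_points" "fst h - v0 = S z1"
      using difference_preimage[OF S(1,2) imageI[OF h(1)]] .
    obtain z2 where z2: "z2 \<in> integer_points" "snd h - w0 = T z2"
      using difference_preimage[OF T(1,2) imageI[OF h(1)]] .
    have "(z1, z2) \<in> integer_points" using z1 z2 by (auto simp: integer_points_def Basis_prod_def)
    moreover have "R b = ?U (z1, z2)" using h z1 z2 vw by (simp add: prod_eq_iff)
    ultimately show "\<exists>z\<in>integer_points. R b = ?U z" by (rule bexI[rotated])
  next
    \<comment> \<open>Induction along the chain shows that both components of \<open>h - h0\<close>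
      lie in the lattice separately. The predecessor shares one coordinate with \<open>h\<close> and
      passes that component on; the other one is the difference of \<open>h - h0\<close> and the
      component passed on.\<close>
    have split: "(\<exists>z\<in>integer_points. (fst h - v0, 0) = R z) \<and> (\<exists>z\<in>integer_points. (0, snd h - w0) = R z)"
      if "h \<in> H" for h
      using that
    proof (induction "N h" arbitrary: h rule: less_induct)
      case less
      show ?case
      proof (cases "h = h0")
        case True
        then have "(fst h - v0, 0) = 0" "(0, snd h - w0) = 0" using vw by (simp_all add: zero_prod_def)
        moreover have "0 \<in> (integer_points :: ('a \<times> 'b) set)" by (simp add: integer_points_def)
        ultimately show ?thesis using linear_0[OF R(1)] by metis
      next
        case False
        obtain h' where h': "h' \<in> H" "N h' < N h" "fst h' = fst h \<or> snd h' = snd h"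
          using pred[OF less.prems False] by blast
        obtain z1 where z1: "z1 \<in> integer_points" "(fst h' - v0, 0) = R z1" using less.hyps[OF h'(2,1)] by blast
        obtain z2 where z2: "z2 \<in> integer_points" "(0, snd h' - w0) = R z2" using less.hyps[OF h'(2,1)] by blast
        obtain z where z: "z \<in> integer_points" "h - h0 = R z"
          using difference_preimage[OF R(1,2) less.prems] .
        have hh: "h - h0 = (fst h - v0, 0) + (0, snd h - w0)" using vw by (simp add: prod_eq_iff)
        from h'(3) show ?thesis
        proof
          assume "fst h' = fst h"
          then have 1: "(fst h - v0, 0) = R z1" using z1 by simp
          then have "(0, snd h - w0) = R (z - z1)" using hh z(2) linear_diff[OF R(1)] by simp
          then show ?thesis using 1 z1(1) z(1) integer_points_diff[of z z1] by blast
        next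
          assume "snd h' = snd h"
          then have 1: "(0, snd h - w0) = R z2" using z2 by simp
          then have "(fst h - v0, 0) = R (z - z2)" using hh z(2) linear_diff[OF R(1)] by simp
          then show ?thesis using 1 z2(1) z(1) integer_points_diff[of z z2] by blast
        qed
      qed
    qed
    fix b :: "'a \<times> 'b" assume "b \<in> Basis"
    then consider u where "b = (u, 0)" "u \<in> Basis" | u where "b = (0, u)" "u \<in> Basis"
      unfolding Basis_prod_def by blast
    then show "\<exists>z\<in>integer_points. ?U b = R z"
    proof cases
      case 1
      obtain v where v: "v \<in> fst ` H" "S u = v - v0" by (rule difference_image[OF S(2) 1(2)])
      then obtain h where "h \<in> H" "S u = fst h - v0" by auto
      then show ?thesis using split[of h] 1 linear_0[OF T(1)] by auto
    next
      case 2
      obtain v where v: "v \<in> snd ` H" "T u = v - w0" by (rule difference_image[OF T(2) 2(2)])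
      then obtain h where "h \<in> H" "T u = snd h - w0" by auto
      then show ?thesis using split[of h] 2 linear_0[OF S(1)] by auto
    qed
  qed
  then show ?thesis unfolding R(3) S(3) T(3) using abs_edet_map_prod[OF S(1) T(1)] by simp
qed


subsection \<open>Orientation of facets\<close>

lemma ridge_insert:
  assumes "finite F" "R \<subseteq> F" "card F = Suc (card R)"
  obtains p where "p \<notin> R" "F = insert p R"
proof -
  have "card (F - R) = 1" using assms by (simp add: card_Diff_subset finite_subset)
  then obtain p where "F - R = {p}" by (rule card_1_singletonE)
  then show ?thesis using that[of p] assms(2) by blast
qed

text \<open>Both values are the single element of \<open>S\<close> missed by \<open>R\<close>. It is
  applied to colors, to basis vectors assigned by color, and to heights along a path.\<close>

lemma bij_betw_missing_value:
  assumes "bij_betw f (insert p R) S" "bij_betw f (insert q R) S" "p \<notin> R" "q \<notin> R"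
  shows "f p = f q"
proof -
  have "f p \<notin> f ` R" "f q \<notin> f ` R"
    using assms by (auto simp: bij_betw_def)
  moreover have "insert (f p) (f ` R) = insert (f q) (f ` R)"
    using assms(1,2)[THEN bij_betw_imp_surj_on] by simp
  ultimately show ?thesis by blast
qed

lemma proper_coloring_face:
  fixes K :: "'a::euclidean_space set set"
  assumes "triangulates K P" "proper_coloring K c" "F \<in> K"
  shows "inj_on c F" "c ` F \<subseteq> {0..DIM('a)}"
proof -
  show "inj_on c F"
  proof (rule inj_onI, rule ccontr)
    fix u v assume uv: "u \<in> F" "v \<in> F" "c u = c v" "u \<noteq> v"
    then have "{u, v} \<in> K" using triangulates_subset[OF assms(1,3), of "{u, v}"] by simp
    then show False using assms(2) uv(3,4) unfolding proper_coloring_def by simp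
  qed
  show "c ` F \<subseteq> {0..DIM('a)}"
    using assms(2,3) unfolding proper_coloring_def by auto
qed

lemma proper_coloring_facet:
  fixes K :: "'a::euclidean_space set set"
  assumes "triangulates K P" "proper_coloring K c" "F \<in> facets K"
  shows "bij_betw c F {0..DIM('a)}"
proof -
  note F = facetsD[OF assms(3)]
  note c = proper_coloring_face[OF assms(1,2) F(1)]
  have "card (c ` F) = card {0..DIM('a)}" using c(1) F(2) by (simp add: card_image)
  then have "c ` F = {0..DIM('a)}" using c(2) by (intro card_subset_eq) simp_all
  then show ?thesis using c(1) by (simp add: bij_betw_def)
qed

text \<open>If \<open>t v\<close> were positive, a small step from the barycenter of
  \<open>R\<close> towards \<open>w\<close> would stay inside the simplex on the side of
  \<open>v\<close>. The point reached lies in both simplices, hence in the hull of \<open>R\<close>,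
  and then \<open>w\<close> lies in the affine hull of \<open>R\<close>, which contradicts affine
  independence.\<close>

lemma adjacent_opposite_sides:
  fixes K :: "'a::euclidean_space set set"
  assumes K: "triangulates K P" "insert v R \<in> K" "insert w R \<in> K"
    and R: "v \<notin> R" "w \<notin> R" "v \<noteq> w" "R \<noteq> {}"
    and t: "w = (\<Sum>u\<in>insert v R. t u *\<^sub>R u)" "sum t (insert v R) = 1"
  shows "t v \<le> 0"
proof (rule ccontr)
  assume tv: "\<not> t v \<le> 0"
  have fin: "finite R" using triangulates_finite_face[OF K(1,2)] by simp
  define n where "n = real (card R)"
  define M where "M = (\<Sum>u\<in>R. \<bar>t u\<bar>)"
  \<comment> \<open>With this step length each vertex of \<open>R\<close> keeps the barycentric
    weight \<open>(1 - e) / n = e * M\<close>, just enough to absorb a coefficient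
    \<open>e * t u\<close> that may be negative, as \<open>M\<close> bounds
    \<open>\<bar>t u\<bar>\<close>.\<close>
  define e where "e = 1 / (1 + n * M)"
  have n: "n > 0" using fin R(4) by (simp add: n_def card_gt_0_iff)
  have M: "M \<ge> 0" unfolding M_def by (intro sum_nonneg) simp
  have "1 + n * M > 0" using n M by (simp add: add_pos_nonneg)
  then have e: "e > 0" "e * (1 + n * M) = 1" by (simp_all add: e_def)
  then have e1: "1 - e = n * (e * M)" by (simp add: algebra_simps)
  then have e2: "e \<le> 1" using n M e(1) by (smt (verit) mult_nonneg_nonneg)
  define bary where "bary = (\<Sum>u\<in>R. (1 / n) *\<^sub>R u)"
  have bary: "bary \<in> convex hull R"
    unfolding convex_hull_finite[OF fin] bary_def using n fin
    by (intro CollectI exI[of _ "\<lambda>_. 1 / n"]) (auto simp: n_def)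
  define y where "y = (1 - e) *\<^sub>R bary + e *\<^sub>R w"
  have "convex hull R \<subseteq> convex hull (insert w R)" by (rule hull_mono) blast
  then have "y \<in> convex hull (insert w R)"
    unfolding y_def using bary e(1) e2
    by (intro convexD[OF convex_convex_hull]) (auto intro: hull_inc)
  moreover have "y \<in> convex hull (insert v R)"
  proof -
    define q where "q u = (if u \<in> R then (1 - e) / n else 0) + e * t u" for u
    have "q u \<ge> 0" if "u \<in> insert v R" for u
    proof (cases "u \<in> R")
      case True
      have "\<bar>t u\<bar> \<le> M" unfolding M_def using True fin by (intro member_le_sum) auto
      then have "e * \<bar>t u\<bar> \<le> e * M" using e(1) by (intro mult_left_mono) auto
      moreover have "(1 - e) / n = e * M" unfolding e1 using n by simp
      moreover have "- (e * \<bar>t u\<bar>) \<le> e * t u" using e(1) by (simp add: abs_if)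
      ultimately show ?thesis unfolding q_def using True by simp
    next
      case False
      then show ?thesis using that tv e(1) by (simp add: q_def)
    qed
    moreover have "sum q (insert v R) = 1"
    proof -
      have "sum q (insert v R) = (\<Sum>u\<in>insert v R. if u \<in> R then (1 - e) / n else 0) + e * sum t (insert v R)"
        unfolding sum_distrib_left sum.distrib[symmetric] by (simp add: q_def)
      also have "(\<Sum>u\<in>insert v R. if u \<in> R then (1 - e) / n else 0) = 1 - e"
        using fin R(1,4) by (simp add: n_def)
      finally show ?thesis using t(2) by simp
    qed
    moreover have "(\<Sum>u\<in>insert v R. q u *\<^sub>R u) = y"
    proof -
      have "(\<Sum>u\<in>insert v R. q u *\<^sub>R u) = (\<Sum>u\<in>insert v R. (if u \<in> R then (1 - e) / n else 0) *\<^sub>R u)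
          + e *\<^sub>R (\<Sum>u\<in>insert v R. t u *\<^sub>R u)"
        by (simp only: q_def scaleR_add_left sum.distrib scaleR_sum_right scaleR_scaleR)
      also have "(\<Sum>u\<in>insert v R. (if u \<in> R then (1 - e) / n else 0) *\<^sub>R u) = (\<Sum>u\<in>R. ((1 - e) / n) *\<^sub>R u)"
        using fin R(1) by simp
      also have "\<dots> = (1 - e) *\<^sub>R bary" by (simp add: bary_def scaleR_sum_right)
      finally show ?thesis using t(1) by (simp add: y_def)
    qed
    moreover have "finite (insert v R)" using fin by simp
    ultimately show ?thesis unfolding convex_hull_finite[OF \<open>finite (insert v R)\<close>] by blast
  qed
  ultimately have "y \<in> convex hull (insert v R \<inter> insert w R)"
    using triangulates_Int[OF K] by blast
  moreover have "insert v R \<inter> insert w R = R" using R by blast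
  ultimately have "y \<in> affine hull R" using convex_hull_subset_affine_hull[of R] by auto
  moreover have "bary \<in> affine hull R" using bary convex_hull_subset_affine_hull by blast
  ultimately have "(1 / e) *\<^sub>R y + (1 - 1 / e) *\<^sub>R bary \<in> affine hull R"
    by (intro mem_affine[OF affine_affine_hull]) simp_all
  moreover have "(1 / e) *\<^sub>R y + (1 - 1 / e) *\<^sub>R bary = w"
  proof -
    have "(1 / e) *\<^sub>R y = (1 / e - 1) *\<^sub>R bary + w"
      using e(1) by (simp add: y_def scaleR_add_right diff_divide_distrib)
    then show ?thesis by (simp add: algebra_simps)
  qed
  ultimately have "w \<in> affine hull R" by simp
  moreover have "insert w R - {w} = R" using R(2) by blast
  ultimately have "affine_dependent (insert w R)"
    unfolding affine_dependent_def by (intro bexI[of _ w]) simp_all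
  then show False using triangulates_affine_independent[OF K(1,3)] by simp
qed

text \<open>Homogeneous coordinates treat all the colors alike: adjacent facets differ in one column
  of the matrix of homogeneous coordinates of their vertices, ordered by color.\<close>

lemma facet_orientation:
  fixes K :: "'a::euclidean_space set set"
  assumes K: "triangulates K P" and c: "proper_coloring K c"
  obtains s :: "'a set \<Rightarrow> int"
  where "\<forall>F\<in>facets K. s F = 1 \<or> s F = -1" "\<forall>F G. dual_adjacent K F G \<longrightarrow> s G = - s F"
proof -
  have "card {0..DIM('a)} = card (Basis :: ('a \<times> real) set)" by simp
  then obtain \<beta> where \<beta>: "bij_betw \<beta> {0..DIM('a)} (Basis :: ('a \<times> real) set)"
    using finite_same_card_bij[of "{0..DIM('a)}" "Basis :: ('a \<times> real) set"] by auto
  define \<phi> where "\<phi> = \<beta> \<circ> c"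
  \<comment> \<open>The column at the basis vector belonging to a color is (v, 1) for the vertex
    \<open>v\<close> of that color. A linear relation between these columns is an affine dependence
    of the vertices, so the determinant is nonzero on facets.\<close>
  define T where "T F = linear_of (\<lambda>b. (the_inv_into F \<phi> b, 1::real))" for F
  have phi: "bij_betw \<phi> F Basis" if "F \<in> facets K" for F
    unfolding \<phi>_def using bij_betw_trans[OF proper_coloring_facet[OF K c that] \<beta>] .
  have T: "T F (\<phi> v) = (v, 1)" if F: "F \<in> facets K" "v \<in> F" for F v
  proof -
    have "\<phi> v \<in> Basis" using phi[OF F(1)] F(2) bij_betwE by blast
    moreover have "the_inv_into F \<phi> (\<phi> v) = v"
      using phi[OF F(1)] F(2) by (intro the_inv_into_f_f) (simp_all add: bij_betw_def)
    ultimately show ?thesis by (simp add: T_def linear_of_Basis)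
  qed
  have lin: "linear (T F)" for F unfolding T_def by (rule linear_linear_of)
  have nonzero: "edet (T F) \<noteq> 0" if F: "F \<in> facets K" for F
  proof -
    have "inj (T F)"
    proof (rule linear_injective_0[OF lin, THEN iffD2], intro allI impI)
      fix x assume x: "T F x = 0"
      define u where "u v = x \<bullet> \<phi> v" for v
      have "T F x = T F (\<Sum>b\<in>Basis. (x \<bullet> b) *\<^sub>R b)" by (simp add: euclidean_representation)
      also have "\<dots> = (\<Sum>b\<in>Basis. (x \<bullet> b) *\<^sub>R T F b)"
        by (simp add: linear_sum[OF lin] linear_cmul[OF lin])
      also have "\<dots> = (\<Sum>v\<in>F. (x \<bullet> \<phi> v) *\<^sub>R T F (\<phi> v))"
        by (rule sum.reindex_bij_betw[OF phi[OF F], symmetric])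
      also have "\<dots> = (\<Sum>v\<in>F. u v *\<^sub>R (v, 1))" using T[OF F] by (simp add: u_def)
      also have "\<dots> = (\<Sum>v\<in>F. u v *\<^sub>R v, sum u F)" by (simp add: prod_eq_iff fst_sum snd_sum)
      finally have "(\<Sum>v\<in>F. u v *\<^sub>R v) = 0" "sum u F = 0" using x by (simp_all add: zero_prod_def)
      then have "\<forall>v\<in>F. u v = 0"
        using triangulates_affine_independent[OF K facetsD(1)[OF F]]
        unfolding affine_dependent_explicit_finite[OF facetsD(3)[OF F]] by blast
      then have "\<forall>b\<in>\<phi> ` F. x \<bullet> b = 0" by (simp add: u_def)
      moreover have "\<phi> ` F = Basis" using phi[OF F] by (simp add: bij_betw_def)
      ultimately have "\<forall>b\<in>Basis. x \<bullet> b = 0" by simp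
      then show "x = 0" by (simp add: euclidean_all_zero_iff)
    qed
    then obtain S where "linear S" "S \<circ> T F = id"
      using linear_injective_left_inverse[OF lin] by blast
    then have "(\<lambda>x. S (T F x)) = (\<lambda>x. x)" by (metis comp_apply id_apply)
    then have "edet S * edet (T F) = edet (\<lambda>x :: 'a \<times> real. x)"
      using edet_compose[OF \<open>linear S\<close> lin, of F] by simp
    then show ?thesis by (auto simp: edet_id)
  qed
  define s where "s F = (if edet (T F) > 0 then 1 else -1 :: int)" for F
  have "s G = - s F" if adj: "dual_adjacent K F G" for F G
  proof -
    obtain R where F: "F \<in> facets K" and G: "G \<in> facets K" and "F \<noteq> G" and
      R: "R \<in> K" "card R = DIM('a)" "R \<subseteq> F" "R \<subseteq> G"
      using adj unfolding dual_adjacent_def by blast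
    have "card F = Suc (card R)" "card G = Suc (card R)" using facetsD(2)[OF F] facetsD(2)[OF G] R(2) by simp_all
    obtain v where v: "v \<notin> R" "F = insert v R"
      by (rule ridge_insert[OF facetsD(3)[OF F] R(3) \<open>card F = Suc (card R)\<close>])
    obtain w where w: "w \<notin> R" "G = insert w R"
      by (rule ridge_insert[OF facetsD(3)[OF G] R(4) \<open>card G = Suc (card R)\<close>])
    have vw: "v \<noteq> w" using v w \<open>F \<noteq> G\<close> by blast
    \<comment> \<open>The exchanged vertices have the same color, the one missing from the ridge, so
      the two matrices differ in exactly this column.\<close>
    have phi_eq: "\<phi> v = \<phi> w"
      using bij_betw_missing_value[of \<phi> v R Basis w] phi[OF F] phi[OF G] v w by simp
    have "affine hull F = UNIV"
      using triangulates_affine_independent[OF K facetsD(1)[OF F]] facetsD(2)[OF F]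
      by (simp add: affine_independent_span_eq)
    then have "w \<in> affine hull F" by simp
    then obtain t where t: "sum t F = 1" "(\<Sum>u\<in>F. t u *\<^sub>R u) = w"
      unfolding affine_hull_finite[OF facetsD(3)[OF F]] by blast
    have "R \<noteq> {}" using R(2) by (metis DIM_positive card.empty less_irrefl)
    then have "t v \<le> 0"
      using adjacent_opposite_sides[OF K facetsD(1)[OF F, unfolded v(2)] facetsD(1)[OF G, unfolded w(2)]
          v(1) w(1) vw _ t(2)[symmetric, unfolded v(2)] t(1)[unfolded v(2)]] by blast
    \<comment> \<open>The affine coordinates \<open>t\<close> of \<open>w\<close> also express (w,
      1) through the columns of \<open>F\<close>, because they add up to one. The determinants thus
      have ratio \<open>t v\<close>, which is negative because the facets lie on opposite sides of
      the ridge.\<close>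
    moreover have "edet (T G) = t v * edet (T F)"
    proof (rule edet_replace)
      show "\<phi> v \<in> Basis" using phi[OF F] v bij_betwE by blast
      show "T G (\<phi> v) = t v *\<^sub>R T F (\<phi> v) +
          (\<Sum>b\<in>Basis - {\<phi> v}. t (the_inv_into F \<phi> b) *\<^sub>R T F b)"
      proof -
        have "T G (\<phi> v) = (w, 1)" using T[OF G, of w] w phi_eq by simp
        also have "\<dots> = (\<Sum>u\<in>F. t u *\<^sub>R (u, 1))"
          using t by (simp add: prod_eq_iff fst_sum snd_sum)
        also have "\<dots> = (\<Sum>u\<in>F. t (the_inv_into F \<phi> (\<phi> u)) *\<^sub>R T F (\<phi> u))"
          using T[OF F] phi[OF F] by (intro sum.cong) (simp_all add: the_inv_into_f_f bij_betw_def)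
        also have "\<dots> = (\<Sum>b\<in>Basis. t (the_inv_into F \<phi> b) *\<^sub>R T F b)"
          by (rule sum.reindex_bij_betw[OF phi[OF F]])
        also have "\<dots> = t (the_inv_into F \<phi> (\<phi> v)) *\<^sub>R T F (\<phi> v) +
            (\<Sum>b\<in>Basis - {\<phi> v}. t (the_inv_into F \<phi> b) *\<^sub>R T F b)"
          using \<open>\<phi> v \<in> Basis\<close> by (intro sum.remove) simp_all
        also have "the_inv_into F \<phi> (\<phi> v) = v"
          using phi[OF F] v by (intro the_inv_into_f_f) (simp_all add: bij_betw_def)
        finally show ?thesis .
      qed
      fix b :: "'a \<times> real" assume b: "b \<in> Basis" "b \<noteq> \<phi> v"
      then obtain u where u: "u \<in> F" "b = \<phi> u" using phi[OF F] by (auto simp: bij_betw_def)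
      then have "u \<in> R" using v b by auto
      then show "T G b = T F b" using T[OF F, of u] T[OF G, of u] u v w by simp
    qed
    ultimately have "t v < 0" using nonzero[OF G] by (cases "t v = 0") auto
    then show ?thesis
      using nonzero[OF F] \<open>edet (T G) = t v * edet (T F)\<close>
      by (auto simp: s_def zero_less_mult_iff)
  qed
  moreover have "s F = 1 \<or> s F = -1" for F by (simp add: s_def)
  ultimately show ?thesis using that[of s] by blast
qed


subsection \<open>Colored chains as lattice paths\<close>

text \<open>A maximal chain in a product of two simplices, with vertices indexed by their colors, is a
  monotone lattice path; the sum of the two colors numbers its elements consecutively.\<close>

locale color_path =
  fixes c :: "'a \<Rightarrow> nat" and d :: "'b \<Rightarrow> nat" and m n :: nat and H :: "('a \<times> 'b) set"
  assumes chain: "mono_chain (\<lambda>v. real (c v)) (\<lambda>w. real (d w)) H"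
    and inj: "inj_on c (fst ` H)" "inj_on d (snd ` H)"
    and range: "c ` fst ` H \<subseteq> {0..m}" "d ` snd ` H \<subseteq> {0..n}"
    and card: "card H = m + n + 1"
begin

definition height :: "'a \<times> 'b \<Rightarrow> nat" where
  "height h = c (fst h) + d (snd h)"

lemma finite_path: "finite H"
  using card by (simp add: card_ge_0_finite)

lemma eqI:
  assumes "p \<in> H" "q \<in> H" "c (fst p) = c (fst q)" "d (snd p) = d (snd q)"
  shows "p = q"
  using assms inj_onD[OF inj(1), of "fst p" "fst q"] inj_onD[OF inj(2), of "snd p" "snd q"]
  by (simp add: prod_eq_iff)

lemma comparable:
  assumes "p \<in> H" "q \<in> H"
  shows "c (fst p) \<le> c (fst q) \<and> d (snd p) \<le> d (snd q) \<or>
    c (fst q) \<le> c (fst p) \<and> d (snd q) \<le> d (snd p)"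
  using mono_chainD[OF chain assms] by simp

lemma height_mono:
  assumes "p \<in> H" "q \<in> H" "height p \<le> height q"
  shows "c (fst p) \<le> c (fst q) \<and> d (snd p) \<le> d (snd q)"
  using comparable[OF assms(1,2)] assms(3) unfolding height_def by linarith

lemma inj_height: "inj_on height H"
proof (rule inj_onI)
  fix p q assume pq: "p \<in> H" "q \<in> H" "height p = height q"
  then show "p = q" using height_mono[of p q] height_mono[of q p] by (intro eqI) auto
qed

lemma bounds: "h \<in> H \<Longrightarrow> c (fst h) \<le> m \<and> d (snd h) \<le> n"
  using range by fastforce

lemma bij_height: "bij_betw height H {0..m + n}"
proof -
  have "height ` H \<subseteq> {0..m + n}" using bounds by (force simp: height_def intro: add_mono)
  moreover have "card (height ` H) = card {0..m + n}" using card inj_height by (simp add: card_image)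
  ultimately have "height ` H = {0..m + n}" by (intro card_subset_eq) auto
  then show ?thesis using inj_height by (simp add: bij_betw_def)
qed

lemma obtain_height:
  assumes "k \<le> m + n"
  obtains h where "h \<in> H" "height h = k"
proof -
  have "k \<in> height ` H" using bij_height assms by (simp add: bij_betw_def)
  then show ?thesis using that by auto
qed

text \<open>The element one level lower is comparable with \<open>h\<close>, so exactly one color
  drops, and it drops by one. The unchanged color belongs to the same vertex, as colors are
  injective on the projection.\<close>

lemma predecessor:
  assumes "h \<in> H" "height h > 0"
  shows "\<exists>h'\<in>H. height h = height h' + 1 \<and>
    (c (fst h') = c (fst h) \<and> fst h' = fst h \<and> d (snd h) = d (snd h') + 1 \<or>
     c (fst h) = c (fst h') + 1 \<and> d (snd h') = d (snd h) \<and> snd h' = snd h)"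
proof -
  have "height h \<le> m + n" using bij_height assms(1) bij_betwE by fastforce
  then have "height h - 1 \<le> m + n" by simp
  then obtain h' where h': "h' \<in> H" "height h' = height h - 1" by (rule obtain_height)
  then have le: "c (fst h') \<le> c (fst h) \<and> d (snd h') \<le> d (snd h)"
    using height_mono[OF h'(1) assms(1)] by simp
  have "height h = height h' + 1" using h'(2) assms(2) by simp
  moreover from this le consider "c (fst h') = c (fst h)" "d (snd h) = d (snd h') + 1"
    | "c (fst h) = c (fst h') + 1" "d (snd h') = d (snd h)"
    unfolding height_def by linarith
  then have "c (fst h') = c (fst h) \<and> fst h' = fst h \<and> d (snd h) = d (snd h') + 1 \<or>
     c (fst h) = c (fst h') + 1 \<and> d (snd h') = d (snd h) \<and> snd h' = snd h"
  proof cases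
    case 1
    then show ?thesis using inj_onD[OF inj(1), of "fst h'" "fst h"] h'(1) assms(1) by simp
  next
    case 2
    then show ?thesis using inj_onD[OF inj(2), of "snd h'" "snd h"] h'(1) assms(1) by simp
  qed
  ultimately show ?thesis using h'(1) by blast
qed

lemma top: obtains h where "h \<in> H" "c (fst h) = m" "d (snd h) = n"
proof -
  obtain h where h: "h \<in> H" "height h = m + n" by (rule obtain_height[OF order_refl])
  then have "c (fst h) = m" "d (snd h) = n" using bounds[OF h(1)] unfolding height_def by linarith+
  then show ?thesis using that h(1) by blast
qed

text \<open>A discrete intermediate value argument: along the path the first color rises from 0 to
  \<open>m\<close> in steps of at most one, so it equals \<open>i\<close> at the lowest height where
  it reaches \<open>i\<close>. This makes the projection of a facet of the product a facet of the
  factor.\<close>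

lemma color_surj_fst: "c ` fst ` H = {0..m}"
proof (intro equalityI range subsetI)
  fix i assume "i \<in> {0..m}"
  obtain t where t: "t \<in> H" "c (fst t) = m" by (rule top)
  define k where "k = (LEAST k. \<exists>h\<in>H. height h = k \<and> i \<le> c (fst h))"
  have ex: "\<exists>k. \<exists>h\<in>H. height h = k \<and> i \<le> c (fst h)" using t \<open>i \<in> {0..m}\<close> by auto
  obtain h where h: "h \<in> H" "height h = k" "i \<le> c (fst h)"
    using LeastI_ex[OF ex] unfolding k_def by blast
  have "c (fst h) \<le> i"
  proof (cases "height h = 0")
    case False
    then obtain h' where h': "h' \<in> H" "height h = height h' + 1" "c (fst h) \<le> c (fst h') + 1"
      using predecessor[OF h(1)] by fastforce
    have "\<not> i \<le> c (fst h')"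
    proof
      assume "i \<le> c (fst h')"
      then have "k \<le> height h'" unfolding k_def using h'(1) by (intro Least_le) blast
      then show False using h'(2) h(2) by simp
    qed
    then show ?thesis using h'(3) by simp
  qed (simp add: height_def)
  then show "i \<in> c ` fst ` H" using h by (metis imageI le_antisym)
qed

lemma color_surj_snd: "d ` snd ` H = {0..n}"
proof (intro equalityI range subsetI)
  fix i assume "i \<in> {0..n}"
  obtain t where t: "t \<in> H" "d (snd t) = n" by (rule top)
  define k where "k = (LEAST k. \<exists>h\<in>H. height h = k \<and> i \<le> d (snd h))"
  have ex: "\<exists>k. \<exists>h\<in>H. height h = k \<and> i \<le> d (snd h)" using t \<open>i \<in> {0..n}\<close> by auto
  obtain h where h: "h \<in> H" "height h = k" "i \<le> d (snd h)"
    using LeastI_ex[OF ex] unfolding k_def by blast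
  have "d (snd h) \<le> i"
  proof (cases "height h = 0")
    case False
    then obtain h' where h': "h' \<in> H" "height h = height h' + 1" "d (snd h) \<le> d (snd h') + 1"
      using predecessor[OF h(1)] by fastforce
    have "\<not> i \<le> d (snd h')"
    proof
      assume "i \<le> d (snd h')"
      then have "k \<le> height h'" unfolding k_def using h'(1) by (intro Least_le) blast
      then show False using h'(2) h(2) by simp
    qed
    then show ?thesis using h'(3) by simp
  qed (simp add: height_def)
  then show "i \<in> d ` snd ` H" using h by (metis imageI le_antisym)
qed

lemma card_fst: "card (fst ` H) = m + 1"
  using color_surj_fst card_image[OF inj(1)] by simp

lemma card_snd: "card (snd ` H) = n + 1"
  using color_surj_snd card_image[OF inj(2)] by simp

text \<open>The bottom element has no predecessor; its partner is the element of height one, whose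
  predecessor it is.\<close>

lemma neighbour:
  assumes "h \<in> H" "m + n > 0"
  shows "\<exists>h'\<in>H. h' \<noteq> h \<and> (fst h' = fst h \<or> snd h' = snd h)"
proof (cases "height h = 0")
  case False
  then obtain h' where h': "h' \<in> H" "height h = height h' + 1" "fst h' = fst h \<or> snd h' = snd h"
    using predecessor[OF assms(1)] by blast
  then have "h' \<noteq> h" by auto
  then show ?thesis using h' by blast
next
  case True
  have "1 \<le> m + n" using assms(2) by linarith
  then obtain q where q: "q \<in> H" "height q = 1" by (rule obtain_height)
  then obtain h' where h': "h' \<in> H" "height q = height h' + 1" "fst h' = fst q \<or> snd h' = snd q"
    using predecessor[OF q(1)] by auto
  then have "h' = h" using inj_onD[OF inj_height, of h' h] True q assms(1) by simp
  moreover have "q \<noteq> h" using q True by auto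
  ultimately show ?thesis using q(1) h'(3) by metis
qed

lemma bij_fst: "bij_betw c (fst ` H) {0..m}"
  using color_surj_fst inj by (simp add: bij_betw_def)

lemma bij_snd: "bij_betw d (snd ` H) {0..n}"
  using color_surj_snd inj by (simp add: bij_betw_def)

lemma ridge_projections:
  assumes "H = insert p R" "p \<notin> R" "m + n > 0"
  shows "fst p \<in> fst ` R \<or> snd p \<in> snd ` R"
proof -
  have "p \<in> H" using assms(1) by simp
  then obtain h' where h': "h' \<in> H" "h' \<noteq> p" "fst h' = fst p \<or> snd h' = snd p"
    using neighbour[OF _ assms(3)] by blast
  then have "h' \<in> R" using assms(1) by simp
  then show ?thesis using h'(3) by (metis imageI)
qed

end

text \<open>The exchanged elements have the same height. If both projections survive, the path flips
  at a corner. Otherwise one factor loses a vertex and gains one of the same color, while the other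
  projection is unchanged, since deleting one element of a path cannot remove a vertex from both
  projections.\<close>

lemma color_path_ridge:
  assumes H: "color_path c d m n (insert p R)" and G: "color_path c d m n (insert q R)"
    and pq: "p \<notin> R" "q \<notin> R" "p \<noteq> q" and mn: "m + n > 0"
  obtains (flip) "fst ` insert p R = fst ` insert q R" "snd ` insert p R = snd ` insert q R"
      "c (fst p) = c (fst q) + 1 \<or> c (fst q) = c (fst p) + 1"
  | (left) "fst p \<notin> fst ` R" "fst q \<notin> fst ` R" "snd ` insert p R = snd ` insert q R"
      "fst ` insert p R \<noteq> fst ` insert q R" "c (fst p) = c (fst q)"
  | (right) "snd p \<notin> snd ` R" "snd q \<notin> snd ` R" "fst ` insert p R = fst ` insert q R"
      "snd ` insert p R \<noteq> snd ` insert q R" "c (fst p) = c (fst q)"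
proof -
  interpret H: color_path c d m n "insert p R" by (rule H)
  interpret G: color_path c d m n "insert q R" by (rule G)
  have fin: "finite R" using H.finite_path by simp
  have hpq: "H.height p = H.height q"
    by (rule bij_betw_missing_value[OF H.bij_height G.bij_height pq(1,2)])
  have cardf: "card (insert (fst p) (fst ` R)) = m + 1" "card (insert (fst q) (fst ` R)) = m + 1"
    using H.card_fst G.card_fst by simp_all
  have cards: "card (insert (snd p) (snd ` R)) = n + 1" "card (insert (snd q) (snd ` R)) = n + 1"
    using H.card_snd G.card_snd by simp_all
  have iff1: "fst p \<in> fst ` R \<longleftrightarrow> fst q \<in> fst ` R"
    using cardf fin by (auto simp: card_insert_if split: if_splits)
  have iff2: "snd p \<in> snd ` R \<longleftrightarrow> snd q \<in> snd ` R"
    using cards fin by (auto simp: card_insert_if split: if_splits)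
  show ?thesis
  proof (cases "fst ` insert p R = fst ` insert q R")
    case eq1: True
    show ?thesis
    proof (cases "snd ` insert p R = snd ` insert q R")
      case eq2: True
      have ne: "c (fst p) \<noteq> c (fst q)"
      proof
        assume "c (fst p) = c (fst q)"
        moreover from this have "d (snd p) = d (snd q)" using hpq by (simp add: H.height_def)
        moreover have "fst q \<in> fst ` insert p R" using eq1 by (metis imageI insertI1)
        moreover have "snd q \<in> snd ` insert p R" using eq2 by (metis imageI insertI1)
        ultimately show False
          using inj_onD[OF H.inj(1), of "fst p" "fst q"] inj_onD[OF H.inj(2), of "snd p" "snd q"] pq(3)
          by (auto simp: prod_eq_iff)
      qed
      have "H.height p > 0"
      proof (rule ccontr)
        assume "\<not> ?thesis"
        then show False using ne hpq by (auto simp: H.height_def)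
      qed
      then obtain p' where p': "p' \<in> insert p R" "H.height p = H.height p' + 1"
        "c (fst p) = c (fst p') \<or> c (fst p) = c (fst p') + 1"
        using H.predecessor[of p] by force
      have "G.height q > 0" using \<open>H.height p > 0\<close> hpq by simp
      then obtain q' where q': "q' \<in> insert q R" "G.height q = G.height q' + 1"
        "c (fst q) = c (fst q') \<or> c (fst q) = c (fst q') + 1"
        using G.predecessor[of q] by force
      \<comment> \<open>The predecessors have equal height and both lie in \<open>R\<close>, so they
        coincide. From this common element the first colors of \<open>p\<close> and \<open>q\<close>
        rise by zero or one, and as they differ, they differ by one.\<close>
      have "p' \<in> R" "q' \<in> R" using p' q' by auto
      moreover have "H.height p' = H.height q'" using p'(2) q'(2) hpq by simp
      ultimately have "p' = q'" using inj_onD[OF H.inj_height, of p' q'] by simp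
      then show ?thesis using flip eq1 eq2 ne p' q' by auto
    next
      case False
      then have nin: "snd p \<notin> snd ` R" "snd q \<notin> snd ` R" using iff2 by (auto simp: insert_absorb)
      have "d (snd p) = d (snd q)"
        using bij_betw_missing_value[of d "snd p" "snd ` R" "{0..n}" "snd q"] H.bij_snd G.bij_snd nin by simp
      then have "c (fst p) = c (fst q)" using hpq by (simp add: H.height_def)
      then show ?thesis using right nin eq1 False by blast
    qed
  next
    case False
    then have nin: "fst p \<notin> fst ` R" "fst q \<notin> fst ` R" using iff1 by (auto simp: insert_absorb)
    then have "snd p \<in> snd ` R" using H.ridge_projections[OF refl pq(1) mn] by blast
    then have "snd ` insert p R = snd ` insert q R" using iff2 by (simp add: insert_absorb)
    moreover have "c (fst p) = c (fst q)"
      using bij_betw_missing_value[of c "fst p" "fst ` R" "{0..m}" "fst q"] H.bij_fst G.bij_fst nin by simp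
    ultimately show ?thesis using left nin False by blast
  qed
qed

section \<open>Signed count of lattice paths\<close>

definition lattice_paths :: "nat \<Rightarrow> nat \<Rightarrow> (nat \<times> nat) set set" where
  "lattice_paths m n = {p \<in> Pow ({0..m} \<times> {0..n}). mono_chain real real p \<and> card p = m + n + 1}"

text \<open>A path with v_i vertical steps in column i has the exponent \<Sum> i (v_i + 1). Up to
  the sign (-1)^(m(m+1)/2) the count is therefore the Gaussian binomial coefficient of m + n over m
  at q = -1.\<close>

definition signed_path_count :: "nat \<Rightarrow> nat \<Rightarrow> int" where
  "signed_path_count m n = (\<Sum>p\<in>lattice_paths m n. (-1) ^ (\<Sum>x\<in>p. fst x))"

text \<open>Replacing vertices by colors is a bijection from the maximal chains over a pair of
  facets to the paths in the grid, so the inner sum is the same number for every pair.\<close>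

lemma signed_path_count_transfer:
  assumes c: "bij_betw c F {0..m}" and d: "bij_betw d G {0..n}"
  shows "(\<Sum>H | H \<in> Pow (F \<times> G) \<and> mono_chain (\<lambda>v. real (c v)) (\<lambda>w. real (d w)) H \<and> card H = m + n + 1.
      (-1) ^ (\<Sum>h\<in>H. c (fst h))) = signed_path_count m n"
proof -
  let ?\<phi> = "map_prod c d"
  let ?C = "\<lambda>H. mono_chain (\<lambda>v. real (c v)) (\<lambda>w. real (d w)) H \<and> card H = m + n + 1"
  have bij: "bij_betw ?\<phi> (F \<times> G) ({0..m} \<times> {0..n})" by (rule bij_betw_map_prod[OF c d])
  have injH: "inj_on ?\<phi> H" if "H \<in> Pow (F \<times> G)" for H
    using that bij by (meson PowD bij_betw_imp_inj_on inj_on_subset)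
  have Pow: "bij_betw ((`) ?\<phi>) (Pow (F \<times> G)) (Pow ({0..m} \<times> {0..n}))" by (rule bij_betw_Pow[OF bij])
  have iff: "?C H \<longleftrightarrow> mono_chain real real (?\<phi> ` H) \<and> card (?\<phi> ` H) = m + n + 1"
    if "H \<in> Pow (F \<times> G)" for H
    using card_image[OF injH[OF that]] by (simp add: mono_chain_def)
  have "bij_betw ((`) ?\<phi>) {H. H \<in> Pow (F \<times> G) \<and> ?C H} (lattice_paths m n)"
  proof (rule bij_betw_imageI)
    show "inj_on ((`) ?\<phi>) {H. H \<in> Pow (F \<times> G) \<and> ?C H}"
      using bij_betw_imp_inj_on[OF Pow] by (rule inj_on_subset) blast
    show "(`) ?\<phi> ` {H. H \<in> Pow (F \<times> G) \<and> ?C H} = lattice_paths m n"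
    proof (intro equalityI subsetI)
      fix p assume "p \<in> (`) ?\<phi> ` {H. H \<in> Pow (F \<times> G) \<and> ?C H}"
      then obtain H where H: "H \<in> Pow (F \<times> G)" "?C H" "p = ?\<phi> ` H" by blast
      then show "p \<in> lattice_paths m n"
        using iff[OF H(1)] bij_betwE[OF Pow] by (simp only: lattice_paths_def mem_Collect_eq)
    next
      fix p assume p: "p \<in> lattice_paths m n"
      then have "p \<in> (`) ?\<phi> ` Pow (F \<times> G)"
        unfolding bij_betw_imp_surj_on[OF Pow] by (simp add: lattice_paths_def)
      then obtain H where H: "H \<in> Pow (F \<times> G)" "p = ?\<phi> ` H" by (elim imageE)
      then show "p \<in> (`) ?\<phi> ` {H. H \<in> Pow (F \<times> G) \<and> ?C H}"
        using iff[OF H(1)] p by (intro image_eqI[of _ _ H]) (simp_all add: lattice_paths_def)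
    qed
  qed
  then have "signed_path_count m n =
      (\<Sum>H | H \<in> Pow (F \<times> G) \<and> ?C H. (-1) ^ (\<Sum>x\<in>?\<phi> ` H. fst x))"
    unfolding signed_path_count_def by (rule sum.reindex_bij_betw[symmetric])
  also have "\<dots> = (\<Sum>H | H \<in> Pow (F \<times> G) \<and> ?C H. (-1) ^ (\<Sum>h\<in>H. c (fst h)))"
    using injH by (intro sum.cong arg_cong[where f = "(^) (-1)"]) (auto simp: sum.reindex)
  finally show ?thesis by simp
qed


subsection \<open>The product of two colored triangulations\<close>

text \<open>What the product formula uses of a factor, with the coloring that witnesses color
  consecutiveness fixed. The form covers the given triangulations and the standard simplices
  alike.\<close>

locale colored_triangulation =
  fixes K :: "'a::euclidean_space set set" and P r c
  assumes tri: "triangulates K P" and reg: "regular K"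
    and conv: "convex P" and int: "interior P \<noteq> {}"
    and lattice: "\<Union>K \<subseteq> integer_points"
    and ord: "linear_order_on (\<Union>K) r"
    and col: "proper_coloring K c" and mono: "\<forall>(v, w)\<in>r. c v \<le> c w"
begin

text \<open>The point where color consecutiveness enters: the order never decreases colors, and on a
  face the colors are distinct, so there the color comparison decides the order. Vertices without a
  common face may share a color, hence the restriction to \<open>F\<close>.\<close>

lemma order_iff_color:
  assumes "F \<in> K"
  shows "\<forall>u\<in>F. \<forall>v\<in>F. (u, v) \<in> r \<longleftrightarrow> real (c u) \<le> real (c v)"
proof (intro ballI iffI)
  fix u v assume uv: "u \<in> F" "v \<in> F"
  show "real (c u) \<le> real (c v)" if "(u, v) \<in> r" using mono that by auto
  show "(u, v) \<in> r" if le: "real (c u) \<le> real (c v)"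
  proof (cases "u = v")
    case True
    have "refl_on (\<Union>K) r" using ord by (simp add: linear_order_on_def partial_order_on_def preorder_on_def)
    then show ?thesis using True uv(1) assms by (auto simp: refl_on_def)
  next
    case False
    have "total_on (\<Union>K) r" using ord by (simp add: linear_order_on_def)
    then have "(u, v) \<in> r \<or> (v, u) \<in> r" using False uv assms by (auto simp: total_on_def)
    moreover have "(v, u) \<notin> r"
    proof
      assume "(v, u) \<in> r"
      then have "c v \<le> c u" using mono by auto
      then have "c u = c v" using le by simp
      then show False using proper_coloring_face(1)[OF tri col assms] uv False inj_onD by metis
    qed
    ultimately show ?thesis by blast
  qed
qed

lemma signature_oriented:
  obtains s :: "'a set \<Rightarrow> int" where "\<forall>F\<in>facets K. s F = 1 \<or> s F = -1"
    "\<forall>F G. dual_adjacent K F G \<longrightarrow> s G = - s F"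
    "signature K = \<bar>\<Sum>F\<in>facets K. if odd_simplex F then s F else 0\<bar>"
proof -
  obtain s :: "'a set \<Rightarrow> int" where s: "\<forall>F\<in>facets K. s F = 1 \<or> s F = -1"
    "\<forall>F G. dual_adjacent K F G \<longrightarrow> s G = - s F"
    by (rule facet_orientation[OF tri col])
  moreover have "signature K = \<bar>\<Sum>F\<in>facets K. if odd_simplex F then s F else 0\<bar>"
    using s by (intro signature_eq[OF tri conv int]) blast+
  ultimately show ?thesis by (rule that)
qed

end

locale colored_product = left: colored_triangulation K P r c + right: colored_triangulation L Q t d
  for K :: "'a::euclidean_space set set" and P r c
    and L :: "'b::euclidean_space set set" and Q t d
begin

definition product_complex where "product_complex = stc_product K r L t"

lemma product_triangulates: "triangulates product_complex (P \<times> Q)" and product_regular: "regular product_complex"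
proof -
  have "P \<noteq> {}" "Q \<noteq> {}" using left.int right.int by auto
  then have "triangulates product_complex (P \<times> Q) \<and> regular product_complex"
    unfolding product_complex_def
    by (intro stc_product_regular_triangulation left.tri left.reg left.conv right.tri right.reg
        right.conv left.ord right.ord)
  then show "triangulates product_complex (P \<times> Q)" "regular product_complex" by simp_all
qed

lemma mem_product:
  "H \<in> product_complex \<longleftrightarrow> fst ` H \<in> K \<and> snd ` H \<in> L \<and> mono_chain (\<lambda>v. real (c v)) (\<lambda>w. real (d w)) H"
proof -
  have "total_on H (product_order r t) \<longleftrightarrow> mono_chain (\<lambda>v. real (c v)) (\<lambda>w. real (d w)) H"
    if "fst ` H \<in> K" "snd ` H \<in> L"
  proof (rule total_on_product_order_iff)
    show "H \<subseteq> fst ` H \<times> snd ` H" by force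
  qed (rule left.order_iff_color[OF that(1)], rule right.order_iff_color[OF that(2)])
  moreover have "H \<subseteq> \<Union>K \<times> \<Union>L" if "fst ` H \<in> K" "snd ` H \<in> L"
  proof -
    have "H \<subseteq> fst ` H \<times> snd ` H" by force
    then show ?thesis using that by blast
  qed
  ultimately show ?thesis unfolding product_complex_def stc_product_def by blast
qed

lemma color_path_facet:
  assumes "H \<in> facets product_complex"
  shows "color_path c d DIM('a) DIM('b) H"
proof
  have H: "H \<in> product_complex" "card H = DIM('a) + DIM('b) + 1" using facetsD[OF assms] by simp_all
  show "mono_chain (\<lambda>v. real (c v)) (\<lambda>w. real (d w)) H" using H(1) mem_product by blast
  have "fst ` H \<in> K" "snd ` H \<in> L" using H(1) mem_product by blast+
  then show "inj_on c (fst ` H)" "inj_on d (snd ` H)" "c ` fst ` H \<subseteq> {0..DIM('a)}" "d ` snd ` H \<subseteq> {0..DIM('b)}"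
    using proper_coloring_face[OF left.tri left.col] proper_coloring_face[OF right.tri right.col] by simp_all
  show "card H = DIM('a) + DIM('b) + 1" by (rule H)
qed

lemma facet_projections:
  assumes "H \<in> facets product_complex"
  shows "fst ` H \<in> facets K" "snd ` H \<in> facets L"
proof -
  interpret color_path c d "DIM('a)" "DIM('b)" H by (rule color_path_facet[OF assms])
  show "fst ` H \<in> facets K" "snd ` H \<in> facets L"
    using card_fst card_snd mem_product facetsD(1)[OF assms] by (simp_all add: facets_def)
qed

text \<open>A chain with \<open>DIM('a) + DIM('b) + 1\<close> elements in
  \<open>F \<times> G\<close> uses every color of both factors, so its projections fill
  \<open>F\<close> and \<open>G\<close>. The fibre over a pair of facets is thus the set of all
  maximal chains.\<close>

lemma product_facets_over:
  assumes F: "F \<in> facets K" and G: "G \<in> facets L"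
  shows "{H \<in> facets product_complex. (fst ` H, snd ` H) = (F, G)} = {H. H \<in> Pow (F \<times> G) \<and>
    mono_chain (\<lambda>v. real (c v)) (\<lambda>w. real (d w)) H \<and> card H = DIM('a) + DIM('b) + 1}"
proof (intro equalityI subsetI)
  fix H assume "H \<in> {H \<in> facets product_complex. (fst ` H, snd ` H) = (F, G)}"
  then have H: "H \<in> facets product_complex" "fst ` H = F" "snd ` H = G" by simp_all
  then have "H \<subseteq> F \<times> G" by force
  then show "H \<in> {H. H \<in> Pow (F \<times> G) \<and>
    mono_chain (\<lambda>v. real (c v)) (\<lambda>w. real (d w)) H \<and> card H = DIM('a) + DIM('b) + 1}"
    using facetsD[OF H(1)] mem_product by simp
next
  fix H assume "H \<in> {H. H \<in> Pow (F \<times> G) \<and>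
    mono_chain (\<lambda>v. real (c v)) (\<lambda>w. real (d w)) H \<and> card H = DIM('a) + DIM('b) + 1}"
  then have H: "H \<subseteq> F \<times> G" "mono_chain (\<lambda>v. real (c v)) (\<lambda>w. real (d w)) H"
    "card H = DIM('a) + DIM('b) + 1" by simp_all
  have sub: "fst ` H \<subseteq> F" "snd ` H \<subseteq> G" using H(1) by auto
  have "fst ` H \<in> K" "snd ` H \<in> L"
    using triangulates_subset[OF left.tri facetsD(1)[OF F] sub(1)]
      triangulates_subset[OF right.tri facetsD(1)[OF G] sub(2)] by simp_all
  then have fac: "H \<in> facets product_complex" using H mem_product by (simp add: facets_def)
  then interpret color_path c d "DIM('a)" "DIM('b)" H by (rule color_path_facet)
  have "fst ` H = F" using card_fst facetsD[OF F] sub by (intro card_subset_eq) simp_all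
  moreover have "snd ` H = G" using card_snd facetsD[OF G] sub by (intro card_subset_eq) simp_all
  ultimately show "H \<in> {H \<in> facets product_complex. (fst ` H, snd ` H) = (F, G)}" using fac by simp
qed

text \<open>The volumes of the projections are natural numbers whose product is the volume of
  \<open>H\<close>, and a product is odd exactly when both factors are. The height serves as the
  ranking along the chain.\<close>

lemma odd_simplex_facet:
  assumes "H \<in> facets product_complex"
  shows "odd_simplex H \<longleftrightarrow> odd_simplex (fst ` H) \<and> odd_simplex (snd ` H)"
proof -
  interpret color_path c d "DIM('a)" "DIM('b)" H by (rule color_path_facet[OF assms])
  note fac = facet_projections[OF assms]
  obtain h0 where h0: "h0 \<in> H" "height h0 = 0" by (rule obtain_height[OF le0])
  have "\<exists>h'\<in>H. height h' < height h \<and> (fst h' = fst h \<or> snd h' = snd h)" if "h \<in> H" "h \<noteq> h0" for h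
  proof -
    have "height h > 0" using that h0 inj_onD[OF inj_height, of h h0] by (cases "height h = 0") auto
    then obtain h' where "h' \<in> H" "height h = height h' + 1" "fst h' = fst h \<or> snd h' = snd h"
      using predecessor[OF \<open>h \<in> H\<close>] by blast
    then show ?thesis by (intro bexI[of _ h']) auto
  qed
  then have vol: "normalized_volume H = normalized_volume (fst ` H) * normalized_volume (snd ` H)"
    using normalized_volume_chain[OF card_fst card_snd card h0(1), of height] by blast
  have "fst ` H \<subseteq> integer_points" "snd ` H \<subseteq> integer_points"
    using left.lattice right.lattice facetsD(1)[OF fac(1)] facetsD(1)[OF fac(2)] by blast+
  then obtain k l :: nat where kl: "normalized_volume (fst ` H) = real k" "normalized_volume (snd ` H) = real l"
    using normalized_volume_Nats[of "fst ` H"] normalized_volume_Nats[of "snd ` H"] card_fst card_snd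
    unfolding Nats_def by auto
  have "normalized_volume H = real (k * l)" using vol kl by simp
  then show ?thesis unfolding odd_simplex_def kl by (simp only: of_nat_eq_iff) auto
qed

text \<open>Each kind of ridge changes the sign of exactly one of the three factors: a flip shifts
  the exponent by one, and an exchange in \<open>K\<close> or in \<open>L\<close> reverses the
  orientation there while colors, and so the exponent, stay.\<close>

lemma alternating_sign:
  assumes sK: "\<forall>F G. dual_adjacent K F G \<longrightarrow> sK G = - (sK F :: int)"
    and sL: "\<forall>F G. dual_adjacent L F G \<longrightarrow> sL G = - (sL F :: int)"
    and adj: "dual_adjacent product_complex H H'"
  defines "s \<equiv> \<lambda>H. sK (fst ` H) * sL (snd ` H) * (-1) ^ (\<Sum>h\<in>H. c (fst h))"
  shows "s H' = - s H"
proof -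
  obtain R where H: "H \<in> facets product_complex" "H' \<in> facets product_complex" "H \<noteq> H'"
    and R: "R \<in> product_complex" "card R = DIM('a) + DIM('b)" "R \<subseteq> H" "R \<subseteq> H'"
    using adj unfolding dual_adjacent_def by auto
  have "card H = Suc (card R)" "card H' = Suc (card R)"
    using facetsD(2)[OF H(1)] facetsD(2)[OF H(2)] R(2) by simp_all
  obtain p where p: "p \<notin> R" "H = insert p R"
    by (rule ridge_insert[OF facetsD(3)[OF H(1)] R(3) \<open>card H = Suc (card R)\<close>])
  obtain q where q: "q \<notin> R" "H' = insert q R"
    by (rule ridge_insert[OF facetsD(3)[OF H(2)] R(4) \<open>card H' = Suc (card R)\<close>])
  have fin: "finite R" using facetsD(3)[OF H(1)] p(2) by simp
  have pq: "p \<noteq> q" using p q H(3) by blast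
  have sums: "(\<Sum>h\<in>H. c (fst h)) = c (fst p) + (\<Sum>h\<in>R. c (fst h))"
    "(\<Sum>h\<in>H'. c (fst h)) = c (fst q) + (\<Sum>h\<in>R. c (fst h))"
    using p q fin by simp_all
  have RKL: "fst ` R \<in> K" "snd ` R \<in> L" using R(1) mem_product by blast+
  have adjK: "dual_adjacent K (fst ` H) (fst ` H')"
    if "fst p \<notin> fst ` R" "fst ` H \<noteq> fst ` H'"
  proof -
    have "card (insert (fst p) (fst ` R)) = DIM('a) + 1"
      using facetsD(2)[OF facet_projections(1)[OF H(1)]] p by simp
    then have "card (fst ` R) = DIM('a)" using that(1) fin by simp
    then show ?thesis
      using that(2) RKL facet_projections(1)[OF H(1)] facet_projections(1)[OF H(2)] R(3,4)
      unfolding dual_adjacent_def by (meson image_mono)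
  qed
  have adjL: "dual_adjacent L (snd ` H) (snd ` H')"
    if "snd p \<notin> snd ` R" "snd ` H \<noteq> snd ` H'"
  proof -
    have "card (insert (snd p) (snd ` R)) = DIM('b) + 1"
      using facetsD(2)[OF facet_projections(2)[OF H(1)]] p by simp
    then have "card (snd ` R) = DIM('b)" using that(1) fin by simp
    then show ?thesis
      using that(2) RKL facet_projections(2)[OF H(1)] facet_projections(2)[OF H(2)] R(3,4)
      unfolding dual_adjacent_def by (meson image_mono)
  qed
  have paths: "color_path c d DIM('a) DIM('b) (insert p R)" "color_path c d DIM('a) DIM('b) (insert q R)"
    using color_path_facet[OF H(1)] color_path_facet[OF H(2)] p q by simp_all
  have "DIM('a) + DIM('b) > 0" by simp
  then show ?thesis
  proof (rule color_path_ridge[OF paths p(1) q(1) pq])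
    assume eq: "fst ` insert p R = fst ` insert q R" "snd ` insert p R = snd ` insert q R"
      "c (fst p) = c (fst q) + 1 \<or> c (fst q) = c (fst p) + 1"
    from eq(3) show ?thesis
      using eq(1,2) unfolding s_def sums p(2)[symmetric] q(2)[symmetric] by auto
  next
    assume a: "fst p \<notin> fst ` R" "snd ` insert p R = snd ` insert q R"
      "fst ` insert p R \<noteq> fst ` insert q R" "c (fst p) = c (fst q)"
    then have "sK (fst ` H') = - sK (fst ` H)" using sK adjK p q by simp
    moreover have "snd ` H' = snd ` H" using a(2) p(2) q(2) by simp
    ultimately show ?thesis unfolding s_def sums a(4) by simp
  next
    assume a: "snd p \<notin> snd ` R" "fst ` insert p R = fst ` insert q R"
      "snd ` insert p R \<noteq> snd ` insert q R" "c (fst p) = c (fst q)"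
    then have "sL (snd ` H') = - sL (snd ` H)" using sL adjL p q by simp
    moreover have "fst ` H' = fst ` H" using a(2) p(2) q(2) by simp
    ultimately show ?thesis unfolding s_def sums a(4) by simp
  qed
qed

theorem signature_product:
  "signature product_complex = \<bar>signed_path_count DIM('a) DIM('b)\<bar> * signature K * signature L"
proof -
  obtain sK :: "'a set \<Rightarrow> int" where sK: "\<forall>F\<in>facets K. sK F = 1 \<or> sK F = -1"
    "\<forall>F G. dual_adjacent K F G \<longrightarrow> sK G = - sK F"
    "signature K = \<bar>\<Sum>F\<in>facets K. if odd_simplex F then sK F else 0\<bar>"
    by (rule left.signature_oriented)
  obtain sL :: "'b set \<Rightarrow> int" where sL: "\<forall>F\<in>facets L. sL F = 1 \<or> sL F = -1"
    "\<forall>F G. dual_adjacent L F G \<longrightarrow> sL G = - sL F"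
    "signature L = \<bar>\<Sum>F\<in>facets L. if odd_simplex F then sL F else 0\<bar>"
    by (rule right.signature_oriented)
  define s where "s H = sK (fst ` H) * sL (snd ` H) * (-1) ^ (\<Sum>h\<in>H. c (fst h))" for H
  let ?oK = "\<lambda>F. if odd_simplex F then sK F else 0" and ?oL = "\<lambda>F. if odd_simplex F then sL F else 0"
  have fin: "finite (facets product_complex)" "finite (facets K)" "finite (facets L)"
    using triangulates_finite[OF product_triangulates] triangulates_finite[OF left.tri]
      triangulates_finite[OF right.tri] by (simp_all add: facets_def)
  have "signature product_complex = \<bar>\<Sum>H\<in>facets product_complex. if odd_simplex H then s H else 0\<bar>"
  proof (rule signature_eq[OF product_triangulates])
    show "convex (P \<times> Q)" using left.conv right.conv by (rule convex_Times)
    show "interior (P \<times> Q) \<noteq> {}" using left.int right.int by (simp add: interior_Times)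
    show "s H = 1 \<or> s H = -1" if "H \<in> facets product_complex" for H
      using bspec[OF sK(1) facet_projections(1)[OF that]] bspec[OF sL(1) facet_projections(2)[OF that]]
        neg_one_even_power[of _ , where 'a = int] neg_one_odd_power[where 'a = int]
      unfolding s_def by (cases "even (\<Sum>h\<in>H. c (fst h))") auto
    show "s H' = - s H" if "dual_adjacent product_complex H H'" for H H'
      unfolding s_def using sK(2) sL(2) that by (rule alternating_sign)
  qed
  \<comment> \<open>Grouping by the pair of projections separates the orientations and parities,
    which depend on the pair alone, from the path sum, which does not depend on the pair.\<close>
  also have "(\<Sum>H\<in>facets product_complex. if odd_simplex H then s H else 0) =
      (\<Sum>FG\<in>facets K \<times> facets L. \<Sum>H | H \<in> facets product_complex \<and> (fst ` H, snd ` H) = FG. if odd_simplex H then s H else 0)"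
    using fin facet_projections by (intro sum.group[symmetric]) auto
  also have "\<dots> = (\<Sum>(F, G)\<in>facets K \<times> facets L. ?oK F * ?oL G * signed_path_count DIM('a) DIM('b))"
  proof (intro sum.cong refl)
    fix FG assume "FG \<in> facets K \<times> facets L"
    then obtain F G where FG: "FG = (F, G)" "F \<in> facets K" "G \<in> facets L" by blast
    have "(\<Sum>H | H \<in> facets product_complex \<and> (fst ` H, snd ` H) = FG. if odd_simplex H then s H else 0) =
      (\<Sum>H | H \<in> facets product_complex \<and> (fst ` H, snd ` H) = FG. ?oK F * ?oL G * (-1) ^ (\<Sum>h\<in>H. c (fst h)))"
      using FG(1) odd_simplex_facet by (intro sum.cong) (auto simp: s_def)
    also have "\<dots> = ?oK F * ?oL G * (\<Sum>H | H \<in> facets product_complex \<and> (fst ` H, snd ` H) = FG. (-1) ^ (\<Sum>h\<in>H. c (fst h)))"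
      by (rule sum_distrib_left[symmetric])
    also have "(\<Sum>H | H \<in> facets product_complex \<and> (fst ` H, snd ` H) = FG. (-1) ^ (\<Sum>h\<in>H. c (fst h))) =
        signed_path_count DIM('a) DIM('b)"
      unfolding FG(1) product_facets_over[OF FG(2,3)]
      by (rule signed_path_count_transfer[OF proper_coloring_facet[OF left.tri left.col FG(2)]
            proper_coloring_facet[OF right.tri right.col FG(3)]])
    finally show "(\<Sum>H | H \<in> facets product_complex \<and> (fst ` H, snd ` H) = FG. if odd_simplex H then s H else 0) =
      (case FG of (F, G) \<Rightarrow> ?oK F * ?oL G * signed_path_count DIM('a) DIM('b))"
      by (simp add: FG(1))
  qed
  also have "\<dots> = (\<Sum>F\<in>facets K. \<Sum>G\<in>facets L. ?oK F * ?oL G * signed_path_count DIM('a) DIM('b))"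
    by (rule sum.cartesian_product[symmetric])
  also have "\<dots> = sum ?oK (facets K) * sum ?oL (facets L) * signed_path_count DIM('a) DIM('b)"
    by (subst sum_product) (simp only: sum_distrib_right)
  finally show ?thesis unfolding sK(3) sL(3) abs_mult by (simp only: mult_ac)
qed

lemma product_dense:
  assumes "dense_in K P" "dense_in L Q"
  shows "dense_in product_complex (P \<times> Q)"
proof -
  have "(x, y) \<in> integer_points \<longleftrightarrow> x \<in> integer_points \<and> y \<in> integer_points" for x :: 'a and y :: 'b
    by (simp add: integer_points_def Basis_prod_def ball_Un)
  then have "P \<times> Q \<inter> integer_points = (P \<inter> integer_points) \<times> (Q \<inter> integer_points)" by auto
  then show ?thesis
    using assms unfolding dense_in_def product_complex_def vertices_stc_product[OF left.tri right.tri left.ord right.ord]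
    by simp
qed

text \<open>The sum of the two colors is a coloring with values up to the sum of the dimensions. On
  a chain the two colors grow together, so equal sums force both colors to agree.\<close>

lemma product_foldable: "foldable product_complex"
  unfolding foldable_def nondegenerate_simplicial_map_def
proof (intro exI ballI conjI)
  let ?f = "\<lambda>h. c (fst h) + d (snd h)"
  fix H assume "H \<in> product_complex"
  then have H: "fst ` H \<in> K" "snd ` H \<in> L" "mono_chain (\<lambda>v. real (c v)) (\<lambda>w. real (d w)) H"
    using mem_product by blast+
  note cK = proper_coloring_face[OF left.tri left.col H(1)] and cL = proper_coloring_face[OF right.tri right.col H(2)]
  have "c (fst h) \<le> DIM('a)" "d (snd h) \<le> DIM('b)" if "h \<in> H" for h
    using subsetD[OF cK(2), of "c (fst h)"] subsetD[OF cL(2), of "d (snd h)"] that by simp_all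
  then show "?f ` H \<in> Pow {0..DIM('a \<times> 'b)}" by (force intro: add_mono)
  show "inj_on ?f H"
  proof (rule inj_onI)
    fix p q assume pq: "p \<in> H" "q \<in> H" "?f p = ?f q"
    have "c (fst p) = c (fst q)" "d (snd p) = d (snd q)"
      using mono_chainD[OF H(3) pq(1,2)] pq(3) by linarith+
    then show "p = q"
      using inj_onD[OF cK(1), of "fst p" "fst q"] inj_onD[OF cL(1), of "snd p" "snd q"] pq(1,2)
      by (simp add: prod_eq_iff)
  qed
qed

end


subsection \<open>The standard simplex\<close>

lemma std_vertices_eq: "(std_vertices :: (real ^ 'm::finite) set) = insert 0 Basis"
  by (auto simp: std_vertices_def Basis_vec_def)

lemma affine_independent_std_vertices: "\<not> affine_dependent (std_vertices :: (real ^ 'm::finite) set)"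
  using affine_dependent_iff_dependent[of "0 :: real ^ 'm" Basis] independent_Basis
  by (simp add: std_vertices_eq nonzero_Basis)

lemma card_std_vertices: "card (std_vertices :: (real ^ 'm::finite) set) = CARD('m) + 1"
  by (simp add: std_vertices_eq card_insert_if nonzero_Basis)

lemma facets_Pow_std_vertices: "facets (Pow (std_vertices :: (real ^ 'm::finite) set)) = {std_vertices}"
proof -
  have "finite (std_vertices :: (real ^ 'm) set)" by (simp add: std_vertices_eq)
  then show ?thesis
    using card_subset_eq[of "std_vertices :: (real ^ 'm) set"] by (auto simp: facets_def card_std_vertices)
qed

text \<open>Constant heights suffice: on an affinely independent set the indicator function of the
  complement of a face extends to an affine function, which is an exact support of that
  face.\<close>

lemma triangulates_Pow_std_vertices:
  fixes V :: "(real ^ 'm::finite) set"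
  defines "V \<equiv> std_vertices"
  shows "triangulates (Pow V) (convex hull V)" "regular (Pow V)"
proof -
  have "triangulates (Pow V) (convex hull V) \<and> regular (Pow V)"
  proof (rule exactly_supported_regular_triangulation[where h = "\<lambda>_. 0"])
    show "finite (\<Union>(Pow V))" by (simp add: V_def std_vertices_eq)
    show "\<not> affine_dependent F" if "F \<in> Pow V" for F
      using that affine_independent_std_vertices affine_dependent_subset unfolding V_def by blast
    show "exactly_supported (\<Union>(Pow V)) (\<lambda>_. 0) F" if "F \<in> Pow V" for F
    proof -
      obtain a b where ab: "\<And>v. v \<in> V \<Longrightarrow> a \<bullet> v + b = (if v \<in> F then 0 else 1)"
        using affine_interpolation[OF affine_independent_std_vertices, of "\<lambda>v. if v \<in> F then 0 else 1"]
        unfolding V_def by blast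
      have "a \<bullet> v + 0 = - b" if "v \<in> F" for v using ab[of v] that \<open>F \<in> Pow V\<close> by auto
      moreover have "a \<bullet> v + 0 > - b" if "v \<in> V - F" for v using ab[of v] that by auto
      ultimately show ?thesis unfolding exactly_supported_def by auto
    qed
    have "convex hull F \<subseteq> convex hull V" if "F \<in> Pow V" for F using that by (simp add: hull_mono)
    then show "\<Union> ((hull) convex ` Pow V) = convex hull V" by blast
    show "\<Union> (Pow V) \<subseteq> convex hull V" by (simp add: hull_subset)
  qed auto
  then show "triangulates (Pow V) (convex hull V)" "regular (Pow V)" by simp_all
qed

section \<open>Order, coloring and signature of the standard simplex\<close>

lemma axis_ne_0: "axis i (1::real) \<noteq> 0"
  by (simp add: axis_eq_0_iff)

lemma mem_std_order_0: "(0, v) \<in> std_order \<longleftrightarrow> v \<in> std_vertices"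
  using axis_ne_0 by (auto simp: std_order_def)

lemma mem_std_order_axis:
  "(axis i 1, v) \<in> std_order \<longleftrightarrow> (\<exists>j\<ge>i. v = axis j 1)"
  using axis_ne_0[of i] by (auto simp: std_order_def axis_eq_axis)

lemma linear_order_std_order: "linear_order_on std_vertices (std_order :: (real ^ 'm::{finite, linorder}) rel)"
proof -
  let ?r = "std_order :: (real, 'm) vec rel"
  have cases: "v = 0 \<or> (\<exists>i. v = axis i 1)" if "v \<in> std_vertices" for v :: "(real, 'm) vec"
    using that by (auto simp: std_vertices_def)
  have sub: "?r \<subseteq> std_vertices \<times> std_vertices" by (auto simp: std_order_def std_vertices_def)
  have "refl_on std_vertices ?r"
    unfolding refl_on_def using sub by (auto dest!: cases simp: mem_std_order_0 mem_std_order_axis std_vertices_def)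
  moreover have "trans ?r"
  proof (rule transI)
    fix u v w assume uv: "(u, v) \<in> ?r" and vw: "(v, w) \<in> ?r"
    have "u \<in> std_vertices" "w \<in> std_vertices" using uv vw sub by auto
    then consider "u = 0" | i where "u = axis i 1" using cases by blast
    then show "(u, w) \<in> ?r"
    proof cases
      case 1
      then show ?thesis using \<open>w \<in> std_vertices\<close> by (simp add: mem_std_order_0)
    next
      case 2
      then obtain j where j: "v = axis j 1" "i \<le> j" using uv by (auto simp: mem_std_order_axis)
      then obtain k where "w = axis k 1" "j \<le> k" using vw by (auto simp: mem_std_order_axis)
      then show ?thesis using 2 j(2) by (auto simp: mem_std_order_axis axis_eq_axis)
    qed
  qed
  moreover have "antisym ?r"
  proof (rule antisymI)
    fix u v assume uv: "(u, v) \<in> ?r" and vu: "(v, u) \<in> ?r"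
    have "u \<in> std_vertices" "v \<in> std_vertices" using uv sub by auto
    then show "u = v" using uv vu axis_ne_0
      by (auto dest!: cases simp: mem_std_order_axis axis_eq_axis)
  qed
  moreover have "total_on std_vertices ?r"
  proof (rule total_onI)
    fix u v :: "(real, 'm) vec" assume uv: "u \<in> std_vertices" "v \<in> std_vertices" "u \<noteq> v"
    show "(u, v) \<in> ?r \<or> (v, u) \<in> ?r"
    proof (cases "u = 0 \<or> v = 0")
      case True
      then show ?thesis using uv by (auto simp: mem_std_order_0)
    next
      case False
      then obtain i j where "u = axis i 1" "v = axis j 1" using cases uv by blast
      then show ?thesis using linear[of i j] by (auto simp: mem_std_order_axis)
    qed
  qed
  ultimately show ?thesis
    unfolding linear_order_on_def partial_order_on_def preorder_on_def using sub by simp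
qed

text \<open>The color is the position in the order 0, e_1, e_2, ..., obtained by counting axis
  vectors up to \<open>v\<close>, since the index type carries an order but no numbering.\<close>

definition std_color :: "real ^ 'm::{finite, linorder} \<Rightarrow> nat" where
  "std_color v = card {i. (axis i 1, v) \<in> std_order}"

lemma std_color_mono:
  fixes u v :: "real ^ 'm::{finite, linorder}"
  assumes "(u, v) \<in> std_order" shows "std_color u \<le> std_color v"
proof -
  have "trans (std_order :: (real, 'm) vec rel)"
    using linear_order_std_order[where 'm = 'm] by (simp add: linear_order_on_def partial_order_on_def preorder_on_def)
  then have "{i. (axis i 1, u) \<in> std_order} \<subseteq> {i. (axis i 1, v) \<in> std_order}"
    using assms by (auto dest: transD)
  then show ?thesis unfolding std_color_def by (intro card_mono) simp_all
qed

lemma std_color_axis: "std_color (axis j 1) = card {..j}"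
proof -
  have "{i. (axis i 1, axis j 1) \<in> std_order} = {..j}"
    by (auto simp: mem_std_order_axis axis_eq_axis)
  then show ?thesis by (simp add: std_color_def)
qed

lemma std_color_0: "std_color 0 = 0"
  using axis_ne_0 by (auto simp: std_color_def mem_std_order_axis)

lemma inj_std_color: "inj_on std_color (std_vertices :: (real ^ 'm::{finite, linorder}) set)"
proof -
  have pos: "std_color (axis i 1 :: (real, 'm) vec) > 0" for i
    by (auto simp: std_color_axis card_gt_0_iff)
  have less: "std_color (axis i 1 :: (real, 'm) vec) < std_color (axis j 1 :: (real, 'm) vec)" if "i < j" for i j
    unfolding std_color_axis using that by (intro psubset_card_mono) auto
  show ?thesis
  proof (rule inj_onI)
    fix u v :: "(real, 'm) vec" assume uv: "u \<in> std_vertices" "v \<in> std_vertices" "std_color u = std_color v"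
    have "i = j" if "std_color (axis i 1 :: (real, 'm) vec) = std_color (axis j 1 :: (real, 'm) vec)" for i j
      using that less[of i j] less[of j i] by (cases i j rule: linorder_cases) auto
    then show "u = v"
      using uv pos unfolding std_vertices_def by (auto simp: std_color_0) (metis less_numeral_extra(3))+
  qed
qed

lemma proper_coloring_std_color: "proper_coloring (Pow (std_vertices :: (real ^ 'm::{finite, linorder}) set)) std_color"
proof -
  have "std_color v \<le> CARD('m)" for v :: "(real, 'm) vec"
    unfolding std_color_def by (intro card_mono) simp_all
  then show ?thesis
    using inj_std_color by (auto simp: proper_coloring_def inj_on_def)
qed

lemma colored_triangulation_std:
  "colored_triangulation (Pow (std_vertices :: (real ^ 'm::{finite, linorder}) set))
     (convex hull std_vertices) std_order std_color"
proof
  let ?V = "std_vertices :: (real, 'm) vec set"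
  show "triangulates (Pow ?V) (convex hull ?V)" "regular (Pow ?V)"
    by (rule triangulates_Pow_std_vertices)+
  show "interior (convex hull ?V) \<noteq> {}"
    by (rule interior_facet[OF triangulates_Pow_std_vertices(1)]) (simp add: facets_Pow_std_vertices)
  show "\<Union>(Pow ?V) \<subseteq> integer_points"
    by (auto simp: std_vertices_eq integer_points_def inner_Basis)
  show "linear_order_on (\<Union>(Pow ?V)) std_order" using linear_order_std_order by simp
  show "proper_coloring (Pow ?V) std_color" by (rule proper_coloring_std_color)
  show "\<forall>(v, w)\<in>(std_order :: (real, 'm) vec rel). std_color v \<le> std_color w" using std_color_mono by auto
qed (rule convex_convex_hull)

lemma signature_Pow_std_vertices: "signature (Pow (std_vertices :: (real ^ 'm::{finite, linorder}) set)) = 1"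
proof -
  let ?V = "std_vertices :: (real, 'm) vec set"
  interpret colored_triangulation "Pow ?V" "convex hull ?V" std_order std_color
    by (rule colored_triangulation_std)
  have "normalized_volume ?V = real 1"
    unfolding normalized_volume_def std_vertices_eq content_std_simplex by simp
  then have "odd_simplex ?V" unfolding odd_simplex_def by (intro exI[of _ 1]) simp
  moreover have "signature (Pow ?V) = \<bar>\<Sum>F\<in>facets (Pow ?V). if odd_simplex F then 1 else 0\<bar>"
    by (rule signature_eq[OF tri conv int])
       (simp_all add: dual_adjacent_def facets_Pow_std_vertices)
  ultimately show ?thesis by (simp add: facets_Pow_std_vertices)
qed

text \<open>The product formula is applied to the standard simplices themselves. Each has a single
  facet of normalized volume one, hence signature one, and only the path count remains.\<close>

lemma staircase_signature_eq:
  "staircase_signature TYPE('m::{finite, linorder}) TYPE('n::{finite, linorder}) =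
     \<bar>signed_path_count CARD('m) CARD('n)\<bar>"
proof -
  interpret colored_product "Pow (std_vertices :: (real, 'm) vec set)" "convex hull std_vertices" std_order std_color
    "Pow (std_vertices :: (real, 'n) vec set)" "convex hull std_vertices" std_order std_color
    by (intro colored_product.intro colored_triangulation_std)
  show ?thesis
    using signature_product unfolding staircase_signature_def staircase_triangulation_def product_complex_def
    by (simp add: signature_Pow_std_vertices)
qed

lemma rdf_colored_triangulation:
  fixes P :: "'a::euclidean_space set"
  assumes "lattice_polytope P" "aff_dim P = int DIM('a)" "rdf_triangulation K P" "color_consecutive K r"
  obtains c where "colored_triangulation K P r c"
proof -
  obtain c where c: "proper_coloring K c" "\<forall>(v, w)\<in>r. c v \<le> c w" "linear_order_on (\<Union>K) r"
    using assms(4) unfolding color_consecutive_def by blast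
  have "convex P" using assms(1) polytope_imp_convex by (auto simp: lattice_polytope_def)
  have "interior P = rel_interior P" using assms(2) by (simp add: interior_rel_interior_gen)
  moreover have "P \<noteq> {}" using assms(2) by auto
  ultimately have "interior P \<noteq> {}" using \<open>convex P\<close> by (simp add: rel_interior_eq_empty)
  then have "colored_triangulation K P r c"
    using assms(3) \<open>convex P\<close> c by unfold_locales (auto simp: rdf_triangulation_def dense_in_def)
  then show ?thesis by (rule that)
qed

theorem theorem4p5:
  fixes P :: "(real ^ 'm::{finite, linorder}) set"
    and Q :: "(real ^ 'n::{finite, linorder}) set"
    and K :: "(real ^ 'm::{finite, linorder}) set set"
    and L :: "(real ^ 'n::{finite, linorder}) set set"
    and O\<^sub>P :: "(real ^ 'm::{finite, linorder}) rel"
    and O\<^sub>Q :: "(real ^ 'n::{finite, linorder}) rel"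
  assumes "lattice_polytope P" and "aff_dim P = int CARD('m)"
    and "lattice_polytope Q" and "aff_dim Q = int CARD('n)"
    and "rdf_triangulation K P"
    and "rdf_triangulation L Q"
    and "color_consecutive K O\<^sub>P"
    and "color_consecutive L O\<^sub>Q"
  shows "rdf_triangulation (stc_product K O\<^sub>P L O\<^sub>Q) (P \<times> Q) \<and>
         signature (stc_product K O\<^sub>P L O\<^sub>Q) =
           staircase_signature TYPE('m) TYPE('n) * signature K * signature L"
proof -
  have dim: "aff_dim P = int DIM((real, 'm) vec)" "aff_dim Q = int DIM((real, 'n) vec)" using assms(2,4) by simp_all
  obtain c where c: "colored_triangulation K P O\<^sub>P c"
    by (rule rdf_colored_triangulation[OF assms(1) dim(1) assms(5,7)])
  obtain d where d: "colored_triangulation L Q O\<^sub>Q d"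
    by (rule rdf_colored_triangulation[OF assms(3) dim(2) assms(6,8)])
  interpret colored_product K P O\<^sub>P c L Q O\<^sub>Q d
    using c d by (rule colored_product.intro)
  have "dense_in K P" "dense_in L Q" using assms(5,6) by (simp_all add: rdf_triangulation_def)
  then have "rdf_triangulation product_complex (P \<times> Q)"
    using product_triangulates product_regular product_dense product_foldable by (simp add: rdf_triangulation_def)
  moreover have "signature product_complex = staircase_signature TYPE('m) TYPE('n) * signature K * signature L"
    using signature_product by (simp add: staircase_signature_eq)
  ultimately show ?thesis unfolding product_complex_def by blast
qed

end
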